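(* Let $d\ge2$. Among all pairs $(G,\chi)$, where $G$ is a subgroup of the symmetric group $\mathfrak{S}_d$ and $\chi$ is an irreducible (complex) character of $G$, there is exactly one for which the function $$f^G_\chi:\mathbf{Sym}_d^+\to\mathbb{R}^+,\qquad f^G_\chi(S)=\bigl(J^G_\chi(S)\bigr)^{\frac1{d-1}},$$ displays a maximal gain of integrability, namely the pair $(\mathfrak{S}_d,\epsilon)$, where $\epsilon$ is the signature; for this pair the function is $\det^{\frac1{d-1}}$.
   Context: $\mathbf{Sym}_d^+$ is the cone of real symmetric positive semi-definite $d\times d$ matrices. The immanant associated with $(G,\chi)$ is the polynomial $J^G_\chi(M)=\sum_{g\in G}\chi(g)\prod_{i=1}^dm_{ig(i)}$. On real symmetric matrices it takes real values, and by a theorem of I. Schur $J^G_\chi(S)\ge\chi(1)\det S\ge0$ for $S\in\mathbf{Sym}_d^+$, so $f^G_\chi$ is well defined, continuous, and homogeneous of degree $\frac d{d-1}$ on $\mathbf{Sym}_d^+$. Definition. A continuous function $f:\mathbf{Sym}_d^+\to\mathbb{R}^+$, homogeneous of degree $\frac d{d-1}$, displays a maximal gain of integrability (for divergence-free positive symmetric tensors) if there is a finite constant $c_f$ such that, with $B$ the unit ball of $\mathbb{R}^d$, every divergence-free $T\in L^1(B;\mathbf{Sym}_d^+)$ with an integrable normal trace on $S^{d-1}=\partial B$ satisfies $$\int_Bf(T)\,dx\le c_f\,\|T\vec n\|_{L^1(S^{d-1})}^{\frac d{d-1}}.$$ Here divergence-free means $\sum_j\partial_jT_{ij}=0$ for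 every $i$ in the sense of distributions, $\vec n$ is the outward unit normal, and the normal trace $T\vec n$ is defined by $\langle T\vec n,\psi\rangle=\int_B\mathrm{Tr}(T\nabla\psi)\,dx$ for $\psi\in C^\infty(\mathbb{R}^d;\mathbb{R}^d)$. *)

theory Defs
  imports
    "HOL-Algebra.Bij"
    "Jordan_Normal_Form.VS_Connect"
    "HOL-Analysis.Analysis"
begin

text \<open>Both \<open>HOL-Analysis\<close> (matrices \<^typ>\<open>real^'n^'n\<close>, used for tensors) and
  \<open>Jordan_Normal_Form\<close> (matrices whose size is a natural number, used only for group
  representations, whose degree is not fixed) are needed.  The names that clash refer to
  \<open>HOL-Analysis\<close> below.\<close>

hide_const (open) Determinant.det Matrix.mat Matrix.vec Matrix.row Matrix.rows
  Matrix.transpose_mat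

section \<open>Irreducible characters and immanants\<close>

text \<open>The index set \<open>{1, ..., d}\<close> is the finite type \<^typ>\<open>'n\<close>, so \<open>d\<close> is \<open>CARD('n)\<close>.\<close>

abbreviation symmetric_group :: "('n::finite \<Rightarrow> 'n) monoid"
  where "symmetric_group \<equiv> BijGroup (UNIV :: 'n set)"

definition general_linear_group :: "nat \<Rightarrow> complex Matrix.mat monoid"
  where "general_linear_group k = units_of (ring_mat TYPE(complex) k ())"

definition mat_trace :: "'a::comm_monoid_add Matrix.mat \<Rightarrow> 'a"
  where "mat_trace A = (\<Sum>i<dim_row A. A $$ (i, i))"

definition irreducible_representation ::
    "('g, 'b) monoid_scheme \<Rightarrow> nat \<Rightarrow> ('g \<Rightarrow> complex Matrix.mat) \<Rightarrow> bool"
  where "irreducible_representation G k \<rho> \<longleftrightarrow>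
    0 < k \<and> \<rho> \<in> hom G (general_linear_group k) \<and>
    (\<forall>W. VectorSpace.subspace class_ring W (module_vec TYPE(complex) k) \<and>
         (\<forall>g\<in>carrier G. \<forall>w\<in>W. \<rho> g *\<^sub>v w \<in> W)
       \<longrightarrow> W = {0\<^sub>v k} \<or> W = carrier_vec k)"

text \<open>A character is a function on \<^term>\<open>carrier G\<close> only; it is made extensional so that
  equality of characters is equality in HOL.\<close>

definition irreducible_character ::
    "('g, 'b) monoid_scheme \<Rightarrow> ('g \<Rightarrow> complex) \<Rightarrow> bool"
  where "irreducible_character G \<chi>' \<longleftrightarrow>
    (\<exists>k \<rho>. irreducible_representation G k \<rho> \<and>
           \<chi>' = restrict (\<lambda>g. mat_trace (\<rho> g)) (carrier G))"

definition signature_character :: "('n::finite \<Rightarrow> 'n) \<Rightarrow> complex"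
  where "signature_character = restrict (\<lambda>p. of_int (sign p)) (carrier symmetric_group)"

definition immanant ::
    "('n::finite \<Rightarrow> 'n) set \<Rightarrow> (('n \<Rightarrow> 'n) \<Rightarrow> complex) \<Rightarrow> real^'n^'n \<Rightarrow> complex"
  where "immanant G \<chi>' M = (\<Sum>g\<in>G. \<chi>' g * (\<Prod>i\<in>UNIV. of_real (M $ i $ g i)))"

definition psd_matrices :: "(real^'n^'n) set"
  where "psd_matrices = {S. transpose S = S \<and> (\<forall>v. 0 \<le> inner v (S *v v))}"

text \<open>On \<^const>\<open>psd_matrices\<close> the immanant of a character is a nonnegative real number (Schur),
  so taking \<^const>\<open>Re\<close> only changes the type.\<close>

definition immanant_root ::
    "('n::finite \<Rightarrow> 'n) set \<Rightarrow> (('n \<Rightarrow> 'n) \<Rightarrow> complex) \<Rightarrow> real^'n^'n \<Rightarrow> real"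
  where "immanant_root G \<chi>' S = Re (immanant G \<chi>' S) powr (1 / (real CARD('n) - 1))"

section \<open>Divergence-free tensors and their normal traces\<close>

fun times_differentiable ::
    "nat \<Rightarrow> ('a::real_normed_vector \<Rightarrow> 'b::real_normed_vector) \<Rightarrow> bool"
  where
    "times_differentiable 0 f \<longleftrightarrow> continuous_on UNIV f"
  | "times_differentiable (Suc k) f \<longleftrightarrow>
       (\<forall>x. f differentiable (at x)) \<and>
       (\<forall>v. times_differentiable k (\<lambda>x. frechet_derivative f (at x) v))"

definition smooth :: "('a::real_normed_vector \<Rightarrow> 'b::real_normed_vector) \<Rightarrow> bool"
  where "smooth f \<longleftrightarrow> (\<forall>k. times_differentiable k f)"

definition test_function :: "(real^'n \<Rightarrow> real) \<Rightarrow> bool"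
  where "test_function \<phi> \<longleftrightarrow>
    smooth \<phi> \<and> compact (closure {x. \<phi> x \<noteq> 0}) \<and> closure {x. \<phi> x \<noteq> 0} \<subseteq> ball 0 1"

abbreviation ball_measure :: "(real^'n) measure"
  where "ball_measure \<equiv> lebesgue_on (ball 0 1)"

definition L1_psd_tensor :: "(real^'n \<Rightarrow> real^'n^'n) \<Rightarrow> bool"
  where "L1_psd_tensor T \<longleftrightarrow>
    integrable ball_measure T \<and> (AE x in ball_measure. T x \<in> psd_matrices)"

definition divergence_free :: "(real^'n \<Rightarrow> real^'n^'n) \<Rightarrow> bool"
  where "divergence_free T \<longleftrightarrow>
    (\<forall>i \<phi>. test_function \<phi> \<longrightarrow>
      (\<Sum>j\<in>UNIV. LINT x|ball_measure.
         T x $ i $ j * frechet_derivative \<phi> (at x) (axis j 1)) = 0)"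

text \<open>The surface measure of the unit sphere in polar coordinates: the area of \<open>A\<close> is
  \<open>d\<close> times the volume of the cone \<open>{r a | a \<in> A, 0 < r < 1}\<close>.\<close>

definition sphere_measure :: "'a::euclidean_space measure"
  where "sphere_measure =
    distr (scale_measure (of_nat DIM('a)) (restrict_space lborel (ball 0 1 - {0})))
      (restrict_space borel (sphere 0 1)) (\<lambda>x. x /\<^sub>R norm x)"

lemma emeasure_sphere_measure:
  fixes A :: "'a::euclidean_space set"
  assumes "A \<in> sets borel" "A \<subseteq> sphere 0 1"
  shows "emeasure sphere_measure A =
    of_nat DIM('a) * emeasure lborel {r *\<^sub>R a | r a. a \<in> A \<and> 0 < r \<and> r < 1}"
proof -
  let ?M = "restrict_space lborel (ball 0 1 - {0 :: 'a})"
  have m: "(\<lambda>x. x /\<^sub>R norm x) \<in> measurable (scale_measure (of_nat DIM('a)) ?M)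
      (restrict_space borel (sphere 0 (1::real)))"
  proof -
    have b: "(\<lambda>x::'a. x /\<^sub>R norm x) \<in> borel_measurable borel" by measurable
    then have "(\<lambda>x. x /\<^sub>R norm x) \<in> measurable ?M borel"
      by (intro measurable_restrict_space1) simp
    then have "(\<lambda>x. x /\<^sub>R norm x) \<in> measurable ?M (restrict_space borel (sphere 0 (1::real)))"
      by (rule measurable_restrict_space2[rotated]) (auto simp: space_restrict_space)
    then show ?thesis
      by (simp add: measurable_def space_scale_measure)
  qed
  have cone: "(\<lambda>x. x /\<^sub>R norm x) -` A \<inter> (ball 0 1 - {0}) =
      {r *\<^sub>R a | r a. a \<in> A \<and> 0 < r \<and> r < 1}" (is "?L = ?R")
  proof
    show "?L \<subseteq> ?R"
    proof
      fix x assume x: "x \<in> ?L"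
      then have "x = norm x *\<^sub>R (x /\<^sub>R norm x)" "x /\<^sub>R norm x \<in> A" "0 < norm x" "norm x < 1"
        by auto
      then show "x \<in> ?R" by blast
    qed
    show "?R \<subseteq> ?L" using assms(2) by (auto simp: subset_iff)
  qed
  have "A \<in> sets (restrict_space borel (sphere 0 1))"
    using assms by (auto simp: sets_restrict_space_iff)
  then show ?thesis
    unfolding sphere_measure_def using m assms(2)
    by (simp add: emeasure_distr space_scale_measure space_restrict_space cone)
      (subst emeasure_restrict_space, auto simp: subset_iff)
qed

text \<open>\<open>g\<close> represents the normal trace of \<open>T\<close> as an integrable function on the sphere.
  \<^const>\<open>jacobian\<close> is the gradient matrix of \<open>\<psi>\<close>.\<close>

definition has_normal_trace :: "(real^'n \<Rightarrow> real^'n^'n) \<Rightarrow> (real^'n \<Rightarrow> real^'n) \<Rightarrow> bool"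
  where "has_normal_trace T g \<longleftrightarrow>
    integrable sphere_measure g \<and>
    (\<forall>\<psi> :: real^'n \<Rightarrow> real^'n. smooth \<psi> \<longrightarrow>
      (LINT x|ball_measure. trace (T x ** jacobian \<psi> (at x))) =
      (LINT x|sphere_measure. inner (g x) (\<psi> x)))"

text \<open>The left-hand side of the estimate is an integral with values in \<open>[0, \<infinity>]\<close>, so the
  estimate includes the integrability of \<open>f(T)\<close>.\<close>

definition displays_maximal_gain :: "(real^'n^'n \<Rightarrow> real) \<Rightarrow> bool"
  where "displays_maximal_gain f \<longleftrightarrow>
    (let d = real CARD('n) in
      continuous_on psd_matrices f \<and>
      (\<forall>S\<in>psd_matrices. 0 \<le> f S) \<and>
      (\<forall>S\<in>psd_matrices. \<forall>t>0. f (t *\<^sub>R S) = t powr (d / (d - 1)) * f S) \<and>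
      (\<exists>c\<ge>0. \<forall>T g. L1_psd_tensor T \<and> divergence_free T \<and> has_normal_trace T g \<longrightarrow>
        (\<integral>\<^sup>+ x. ennreal (f (T x)) \<partial>ball_measure) \<le>
        ennreal (c * (LINT x|sphere_measure. norm (g x)) powr (d / (d - 1)))))"

end

(* A psd divergence-free T is tested with the gradient of a convex function phi: the definition of
   the normal trace gives int Tr(T D^2 phi) <= sup |grad phi| * ||T n||_1, and Tr(T D^2 phi) controls
   (det T)^(1/d) (det D^2 phi)^(1/d).  With det D^2 phi comparable to h^d and h = (det T)^(1/(d(d-1)))
   this is the estimate for det^(1/(d-1)).  The function phi is a Kantorovich potential for the
   transport of h^d dx to a ball.  No regularity theory is needed: the Euler-Lagrange relation alone
   bounds a sum of second differences of phi from below, with the correct power of the determinant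
   and a dimensional constant, and this bound survives mollification.

   Conversely, if S n = 0 then T = exp(-(c x.n)^2) S is divergence-free, and letting c tend to
   infinity forces f(S) = 0.  For S the identity matrix with a 2 x 2 block of ones at (a, b) the
   immanant is chi(1) + chi((a b)), so every transposition lies in G and acts as -1; hence G is the
   symmetric group, and irreducibility leaves only the signature. *)

theory Submission
  imports Defs "HOL-Complex_Analysis.Great_Picard" "Jordan_Normal_Form.Schur_Decomposition"
begin

hide_const (open) Determinant.det Matrix.mat Matrix.vec Matrix.row Matrix.rows
  Matrix.transpose_mat

no_notation Matrix.vec_index (infixl "$" 100)

section \<open>Positive semi-definite matrices\<close>

text \<open>The potential is convex but may lack second derivatives, so the link between traces and
  determinants is proved for second differences. With T = V^T V only the rows V_i of V enter. If s
  is the sum of the second differences at x0 along the rows, the potential minus a supporting affine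
  function stays in [0, s] on the cross-polytope with vertices x0 + V_i and x0 - V_i. Its slopes
  over an inner ellipsoid of volume about |det V| thus lie in an ellipsoid of volume about s^d /
  |det V|. The mass h^d |det V| cannot be transported into less volume, so h^d (det V)^2 is at most
  a constant times s^d. Unlike a determinant, a sum of second differences is linear in the
  potential; hence averaging preserves the bound. The weight h is such that h^d and (det T)^(1/d) h
  coincide: one integral appears on both sides, on the right to the power 1/d. It must be finite to
  be absorbed, hence the truncations. In the converse the boundary flux is at most a constant times
  the mass of the slab, and this mass tends to 0. As the flux carries an exponent above 1, the
  estimate fails in the limit unless f(S) = 0.\<close>

lemma psd_gram_aux:
  fixes S :: "real^'n^'n"
  assumes "finite I" "S \<in> psd_matrices" "\<And>i j. S$i$j \<noteq> 0 \<Longrightarrow> i \<in> I \<and> j \<in> I"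
  shows "\<exists>v::'n \<Rightarrow> real^'n. \<forall>j k. S$j$k = (\<Sum>i\<in>I. v i $ j * v i $ k)"
  using assms
proof (induction I arbitrary: S rule: finite_induct)
  case empty
  then have "S$j$k = 0" for j k by blast
  then show ?case by simp
next
  case (insert a I)
  have sym: "S$i$j = S$j$i" for i j
    using insert.prems(1) unfolding psd_matrices_def by (metis (mono_tags, lifting) mem_Collect_eq transpose_def vec_lambda_beta)
  have q: "0 \<le> inner x (S *v x)" for x using insert.prems(1) unfolding psd_matrices_def by auto
  have qe: "inner x (S *v x) = (\<Sum>i\<in>UNIV. \<Sum>j\<in>UNIV. x$i * S$i$j * x$j)" for x
    by (simp add: inner_vec_def matrix_vector_mult_def sum_distrib_left mult.assoc)
  have in1: "inner x (S *v axis a 1) = (\<Sum>j\<in>UNIV. x$j * S$j$a)" for x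
    by (simp add: inner_vec_def matrix_vector_mult_def axis_def if_distrib cong: if_cong)
  have in2: "inner (axis a 1) (S *v x) = (\<Sum>j\<in>UNIV. x$j * S$j$a)" for x
    unfolding inner_axis' matrix_vector_mult_def by (auto intro!: sum.cong simp: sym)
  have in3: "inner (axis a 1) (S *v axis a 1) = S$a$a"
    unfolding in1 by (simp add: axis_def if_distrib[of "\<lambda>x. x * _"] cong: if_cong)
  have exp: "inner (x + t *\<^sub>R axis a 1) (S *v (x + t *\<^sub>R axis a 1)) =
     inner x (S *v x) + 2 * t * (\<Sum>j\<in>UNIV. x$j * S$j$a) + t^2 * S$a$a" for x t
  proof -
    have "inner (x + t *\<^sub>R axis a 1) (S *v (x + t *\<^sub>R axis a 1)) =
       inner x (S *v x) + t * inner x (S *v axis a 1) + t * inner (axis a 1) (S *v x)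
         + t * (t * inner (axis a 1) (S *v axis a 1))"
      by (simp only: matrix_vector_right_distrib inner_add_left inner_add_right
         matrix_vector_mult_scaleR inner_scaleR_left inner_scaleR_right algebra_simps)
    also have "\<dots> = inner x (S *v x) + 2 * t * (\<Sum>j\<in>UNIV. x$j * S$j$a) + t^2 * S$a$a"
      unfolding in3 unfolding in1 in2 by (simp only: power2_eq_square algebra_simps mult_2)
    finally show ?thesis .
  qed
  \<comment> \<open>One step of a Cholesky factorisation: if the pivot \<open>S$a$a\<close>
    vanishes, so does its whole row, and \<open>a\<close> leaves the support; otherwise a rank-one
    term is split off and the Schur complement is supported on \<open>I\<close>.\<close>
  show ?case
  proof (cases "S$a$a = 0")
    case True
    have "S$b$a = 0" for b
    proof (rule ccontr)
      assume nz: "S$b$a \<noteq> 0"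
      have e: "(\<Sum>j\<in>UNIV. (axis b 1::real^'n)$j * S$j$a) = S$b$a"
        by (simp add: axis_def if_distrib[of "\<lambda>x. x * _"] cong: if_cong)
      let ?c = "inner (axis b 1) (S *v axis b (1::real))"
      \<comment> \<open>With a zero pivot the form is affine in the coefficient of
        \<open>axis a 1\<close>; this coefficient brings it down to -1.\<close>
      have "0 \<le> ?c + 2 * (-(?c + 1) / (2 * S$b$a)) * S$b$a"
        using q[of "axis b 1 + (-(?c + 1) / (2 * S$b$a)) *\<^sub>R axis a 1"] unfolding exp e True by simp
      also have "\<dots> = -1" using nz by (simp add: field_simps)
      finally show False by simp
    qed
    then have "\<And>i j. S$i$j \<noteq> 0 \<Longrightarrow> i \<in> I \<and> j \<in> I"
      using insert.prems(2) sym by (metis insertE)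
    from insert.IH[OF insert.prems(1) this] obtain v :: "'n \<Rightarrow> real^'n" where
      v: "\<forall>j k. S$j$k = (\<Sum>i\<in>I. v i $ j * v i $ k)" by auto
    have "\<forall>j k. S$j$k = (\<Sum>i\<in>insert a I. (v(a:=0)) i $ j * (v(a:=0)) i $ k)"
      using v insert.hyps by (auto intro!: sum.cong)
    then show ?thesis by blast
  next
    case False
    have "0 \<le> S$a$a" using q[of "axis a 1"] in3 by simp
    with False have pos: "0 < S$a$a" by simp
    \<comment> \<open>The pivot column over the square root of the pivot: \<open>w$i * w$j\<close>
      agrees with \<open>S\<close> in row and column \<open>a\<close>, so the difference
      \<open>S'\<close> vanishes there.\<close>
    define w :: "real^'n" where "w = (\<chi> j. S$j$a / sqrt (S$a$a))"
    define S' :: "real^'n^'n" where "S' = (\<chi> i j. S$i$j - w$i * w$j)"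
    have ww: "w$i * w$j = S$i$a * S$j$a / S$a$a" for i j
      using pos by (simp add: w_def)
    have "S' \<in> psd_matrices"
      unfolding psd_matrices_def
    proof (intro CollectI conjI allI)
      show "transpose S' = S'" by (simp add: S'_def transpose_def vec_eq_iff sym mult.commute)
      fix x :: "real^'n"
      let ?m = "\<Sum>j\<in>UNIV. x$j * S$j$a"
      have "inner x (S' *v x) = (\<Sum>i\<in>UNIV. \<Sum>j\<in>UNIV. x$i * S$i$j * x$j) - (\<Sum>i\<in>UNIV. \<Sum>j\<in>UNIV. (x$i * S$i$a) * (x$j * S$j$a)) / S$a$a"
        unfolding inner_vec_def matrix_vector_mult_def S'_def
        by (simp add: sum_distrib_left ww algebra_simps sum_subtractf sum_divide_distrib)
      also have "\<dots> = inner x (S *v x) - ?m^2 / S$a$a"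
        unfolding qe power2_eq_square sum_product ..
      \<comment> \<open>The form of the Schur complement is the form of \<open>S\<close> at its
        minimiser in the direction \<open>axis a 1\<close>, hence nonnegative.\<close>
      also have "\<dots> = inner (x + (- ?m / S$a$a) *\<^sub>R axis a 1) (S *v (x + (- ?m / S$a$a) *\<^sub>R axis a 1))"
        unfolding exp using pos by (simp add: field_simps power2_eq_square)
      also have "\<dots> \<ge> 0" by (rule q)
      finally show "0 \<le> inner x (S' *v x)" .
    qed
    moreover have "i \<in> I \<and> j \<in> I" if nz: "S'$i$j \<noteq> 0" for i j
    proof -
      have z1: "S'$a$j = 0" "S'$i$a = 0" for i j
        using pos by (auto simp: S'_def ww sym)
      have "i \<noteq> a" "j \<noteq> a" using nz z1 by auto
      moreover have "i \<in> insert a I" "j \<in> insert a I"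
      proof -
        show "i \<in> insert a I"
        proof (rule ccontr)
          assume "i \<notin> insert a I"
          then have "S$i$j = 0" "S$i$a = 0" using insert.prems(2) by blast+
          then show False using nz by (simp add: S'_def ww)
        qed
        show "j \<in> insert a I"
        proof (rule ccontr)
          assume "j \<notin> insert a I"
          then have "S$i$j = 0" "S$j$a = 0" using insert.prems(2) by blast+
          then show False using nz by (simp add: S'_def ww)
        qed
      qed
      ultimately show ?thesis by auto
    qed
    ultimately obtain v :: "'n \<Rightarrow> real^'n" where
      v: "\<forall>j k. S'$j$k = (\<Sum>i\<in>I. v i $ j * v i $ k)" using insert.IH by blast
    have "S$j$k = (\<Sum>i\<in>insert a I. (v(a:=w)) i $ j * (v(a:=w)) i $ k)" for j k
    proof -
      have "(\<Sum>i\<in>I. (v(a:=w)) i $ j * (v(a:=w)) i $ k) = (\<Sum>i\<in>I. v i $ j * v i $ k)"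
        using insert.hyps by (auto intro!: sum.cong)
      also have "\<dots> = S'$j$k" using v by simp
      finally show ?thesis using insert.hyps by (simp add: S'_def)
    qed
    then show ?thesis by blast
  qed
qed

lemma psd_gram:
  fixes S :: "real^'n^'n"
  assumes "S \<in> psd_matrices"
  obtains V :: "real^'n^'n" where "S = transpose V ** V"
proof -
  obtain v :: "'n \<Rightarrow> real^'n" where v: "\<forall>j k. S$j$k = (\<Sum>i\<in>UNIV. v i $ j * v i $ k)"
    using psd_gram_aux[of UNIV S] assms by auto
  have "S = transpose (\<chi> i. v i) ** (\<chi> i. v i)"
    by (simp add: vec_eq_iff matrix_matrix_mult_def transpose_def v)
  then show thesis by (rule that)
qed

text \<open>The form in which the trace is compared with second differences: when \<open>M\<close>
  is the Jacobian of a gradient, each term is a second derivative of the potential along a row of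
  \<open>V\<close>.\<close>

lemma trace_gram_mult:
  fixes V M :: "real^'n^'n"
  shows "trace ((transpose V ** V) ** M) = (\<Sum>i\<in>UNIV. inner (V$i) (M *v V$i))"
proof -
  have "trace ((transpose V ** V) ** M) = (\<Sum>a\<in>UNIV. \<Sum>b\<in>UNIV. \<Sum>i\<in>UNIV. V$i$a * V$i$b * M$b$a)"
    by (simp add: trace_def matrix_matrix_mult_def transpose_def sum_distrib_right)
  also have "\<dots> = (\<Sum>b\<in>UNIV. \<Sum>a\<in>UNIV. \<Sum>i\<in>UNIV. V$i$a * V$i$b * M$b$a)"
    by (rule sum.swap)
  also have "\<dots> = (\<Sum>b\<in>UNIV. \<Sum>i\<in>UNIV. \<Sum>a\<in>UNIV. V$i$a * V$i$b * M$b$a)"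
    by (rule sum.cong[OF refl], rule sum.swap)
  also have "\<dots> = (\<Sum>i\<in>UNIV. \<Sum>b\<in>UNIV. \<Sum>a\<in>UNIV. V$i$a * V$i$b * M$b$a)"
    by (rule sum.swap)
  also have "\<dots> = (\<Sum>i\<in>UNIV. inner (V$i) (M *v V$i))"
    by (simp add: inner_vec_def matrix_vector_mult_def sum_distrib_left mult_ac)
  finally show ?thesis .
qed

lemma det_psd_nonneg:
  fixes S :: "real^'n^'n"
  assumes "S \<in> psd_matrices"
  shows "0 \<le> det S"
proof -
  obtain V :: "real^'n^'n" where "S = transpose V ** V" by (rule psd_gram[OF assms])
  then have "det S = (det V)^2" by (simp add: det_mul power2_eq_square)
  then show ?thesis by simp
qed

text \<open>A crude Leibniz bound, enough to make the \<open>d\<close>-th root of the determinant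
  grow at most linearly, hence integrable along an integrable tensor.\<close>

lemma abs_det_le:
  fixes A :: "real^'n^'n"
  shows "\<bar>det A\<bar> \<le> fact CARD('n) * norm A ^ CARD('n)"
proof -
  have ent: "\<bar>A$i$j\<bar> \<le> norm A" for i j
    using component_le_norm_cart[of "A$i" j] Finite_Cartesian_Product.norm_nth_le[of A i] by linarith
  have "\<bar>det A\<bar> \<le> (\<Sum>p\<in>{p. p permutes (UNIV::'n set)}. \<bar>of_int (sign p) * (\<Prod>i\<in>UNIV. A$i$p i)\<bar>)"
    unfolding det_def by (rule sum_abs)
  also have "\<dots> \<le> (\<Sum>p\<in>{p. p permutes (UNIV::'n set)}. norm A ^ CARD('n))"
  proof (rule sum_mono)
    fix p assume "p \<in> {p. p permutes (UNIV::'n set)}"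
    have "\<bar>of_int (sign p) * (\<Prod>i\<in>UNIV. A$i$p i)\<bar> = (\<Prod>i\<in>UNIV. \<bar>A$i$p i\<bar>)"
      by (simp add: abs_mult abs_prod sign_def)
    also have "\<dots> \<le> (\<Prod>i\<in>(UNIV::'n set). norm A)" by (rule prod_mono) (simp add: ent)
    finally show "\<bar>of_int (sign p) * (\<Prod>i\<in>UNIV. A$i$p i)\<bar> \<le> norm A ^ CARD('n)" by simp
  qed
  also have "\<dots> = fact CARD('n) * norm A ^ CARD('n)"
    by (simp add: card_permutations[OF refl])
  finally show ?thesis .
qed

section \<open>Duality for quadratic optimal transport\<close>

text \<open>The Legendre transform with the supremum restricted to \<open>X\<close>. For compact
  nonempty \<open>X\<close> and continuous \<open>u\<close> the supremum is attained, so the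
  transform is finite on the whole space.\<close>

definition conj_on :: "'a::euclidean_space set \<Rightarrow> ('a \<Rightarrow> real) \<Rightarrow> 'a \<Rightarrow> real"
  where "conj_on X u y = (SUP x\<in>X. inner x y - u x)"

lemma conj_on_upper:
  assumes "compact X" "continuous_on X u" "x \<in> X"
  shows "inner x y - u x \<le> conj_on X u y"
proof -
  have "compact ((\<lambda>x. inner x y - u x) ` X)"
    by (intro compact_continuous_image continuous_intros assms)
  then have "bdd_above ((\<lambda>x. inner x y - u x) ` X)"
    by (intro bounded_imp_bdd_above compact_imp_bounded)
  then show ?thesis unfolding conj_on_def by (rule cSUP_upper[OF assms(3)])
qed

lemma conj_on_least:
  assumes "X \<noteq> {}" "\<And>x. x \<in> X \<Longrightarrow> inner x y - u x \<le> c"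
  shows "conj_on X u y \<le> c"
  unfolding conj_on_def using assms by (rule cSUP_least)

lemma conj_on_attained:
  assumes "compact X" "X \<noteq> {}" "continuous_on X u"
  obtains x where "x \<in> X" "conj_on X u y = inner x y - u x"
proof -
  have "continuous_on X (\<lambda>x. inner x y - u x)" by (intro continuous_intros assms)
  then obtain x where x: "x \<in> X" "\<forall>z\<in>X. inner z y - u z \<le> inner x y - u x"
    using continuous_attains_sup[OF assms(1,2)] by blast
  have "conj_on X u y = inner x y - u x"
    using conj_on_least[OF assms(2), of y u] conj_on_upper[OF assms(1,3) x(1), of y] x(2)
    by (meson antisym)
  with x(1) show thesis by (rule that)
qed

text \<open>A supremum of affine functions with slopes in \<open>X\<close>, so the constant does not
  depend on \<open>u\<close>. This gives the equicontinuity of minimising sequences and later the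
  bound on the gradient of the potential.\<close>

lemma conj_on_lipschitz:
  assumes "compact X" "X \<noteq> {}" "continuous_on X u" "X \<subseteq> cball 0 r"
  shows "\<bar>conj_on X u y - conj_on X u y'\<bar> \<le> r * norm (y - y')"
proof -
  have *: "conj_on X u y \<le> conj_on X u y' + r * norm (y - y')" for y y'
  proof (rule conj_on_least[OF assms(2)])
    fix x assume x: "x \<in> X"
    have "inner x (y - y') \<le> norm x * norm (y - y')" by (rule norm_cauchy_schwarz)
    also have "\<dots> \<le> r * norm (y - y')"
      using x assms(4) by (intro mult_right_mono) auto
    finally show "inner x y - u x \<le> conj_on X u y' + r * norm (y - y')"
      using conj_on_upper[OF assms(1,3) x, of y'] by (simp add: inner_diff_right)
  qed
  show ?thesis using *[of y y'] *[of y' y] by (simp add: norm_minus_commute)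
qed

lemma compact_subset_cball_0:
  fixes X :: "'a::real_normed_vector set"
  assumes "compact X"
  obtains r where "0 \<le> r" "X \<subseteq> cball 0 r"
proof -
  obtain r where "\<forall>x\<in>X. norm x \<le> r"
    using compact_imp_bounded[OF assms] unfolding bounded_iff by blast
  then have "X \<subseteq> cball 0 (max r 0)" by auto
  then show thesis using that[of "max r 0"] by simp
qed

lemma continuous_on_conj_on:
  assumes "compact X" "X \<noteq> {}" "continuous_on X u"
  shows "continuous_on A (conj_on X u)"
proof -
  obtain r where r: "0 \<le> r" "X \<subseteq> cball 0 r" by (rule compact_subset_cball_0[OF assms(1)])
  have "r-lipschitz_on A (conj_on X u)"
    by (rule lipschitz_onI[OF _ r(1)])
      (use conj_on_lipschitz[OF assms r(2)] in \<open>simp add: dist_norm\<close>)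
  then show ?thesis by (rule lipschitz_on_continuous_on)
qed

lemma conj_on_mono:
  assumes "compact X" "X \<noteq> {}" "continuous_on X v" "\<And>x. x \<in> X \<Longrightarrow> v x \<le> u x + e"
  shows "conj_on X u y \<le> conj_on X v y + e"
proof (rule conj_on_least[OF assms(2)])
  fix x assume "x \<in> X"
  then show "inner x y - u x \<le> conj_on X v y + e"
    using conj_on_upper[OF assms(1,3), of x y] assms(4)[of x] by linarith
qed

lemma biconj_on_le:
  assumes "compact X" "X \<noteq> {}" "continuous_on X u" "Y \<noteq> {}" "x \<in> X"
  shows "conj_on Y (conj_on X u) x \<le> u x"
proof (rule conj_on_least[OF assms(4)])
  fix y
  show "inner y x - conj_on X u y \<le> u x"
    using conj_on_upper[OF assms(1,3,5), of y] by (simp add: inner_commute)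
qed

lemma conj_on_biconj_on_le:
  assumes "compact X" "X \<noteq> {}" "continuous_on X u" "compact Y" "y \<in> Y"
  shows "conj_on X (conj_on Y (conj_on X u)) y \<le> conj_on X u y"
proof (rule conj_on_least[OF assms(2)])
  fix x
  show "inner x y - conj_on Y (conj_on X u) x \<le> conj_on X u y"
    using conj_on_upper[OF assms(4) continuous_on_conj_on[OF assms(1-3)] assms(5), of x]
    by (simp add: inner_commute)
qed

text \<open>Kantorovich's dual functional for moving \<open>w dx\<close> on \<open>X\<close> to
  Lebesgue measure on \<open>Y\<close> with the correlation \<open>inner x y\<close>; the second
  potential is eliminated as the conjugate of the first.\<close>

definition transport_dual ::
    "'a::euclidean_space set \<Rightarrow> 'a set \<Rightarrow> ('a \<Rightarrow> real) \<Rightarrow> ('a \<Rightarrow> real) \<Rightarrow> real"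
  where "transport_dual X Y w u =
    (LINT x:X|lborel. u x * w x) + (LINT y:Y|lborel. conj_on X u y)"

lemma set_integrable_compact:
  fixes f :: "'a::euclidean_space \<Rightarrow> real"
  assumes "compact X" "continuous_on X f"
  shows "set_integrable lborel X f"
  unfolding set_integrable_def using assms by (rule borel_integrable_compact)

lemma set_integral_const_compact:
  fixes X :: "'a::euclidean_space set"
  assumes "compact X"
  shows "(LINT x:X|lborel. (c::real)) = c * measure lborel X"
  using assms by (simp add: set_lebesgue_integral_def emeasure_compact_finite borel_compact mult.commute)

text \<open>One comparison serves the passage to a double conjugate, the shift by a constant and the
  limit of a minimising sequence; hence two separate errors \<open>e\<close> and
  \<open>e'\<close>.\<close>

lemma transport_dual_mono:
  assumes X: "compact X" "X \<noteq> {}" and Y: "compact Y"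
    and w: "continuous_on X w" "\<And>x. x \<in> X \<Longrightarrow> 0 \<le> w x"
    and u: "continuous_on X u" and v: "continuous_on X v"
    and le: "\<And>x. x \<in> X \<Longrightarrow> v x \<le> u x + e"
      "\<And>y. y \<in> Y \<Longrightarrow> conj_on X v y \<le> conj_on X u y + e'"
  shows "transport_dual X Y w v \<le> transport_dual X Y w u
    + e * (LINT x:X|lborel. w x) + e' * measure lborel Y"
proof -
  have "(LINT x:X|lborel. v x * w x) \<le> (LINT x:X|lborel. u x * w x + e * w x)"
    using le(1) w(2)
    by (intro set_integral_mono set_integrable_compact X continuous_intros u v w)
       (metis distrib_right mult_right_mono)
  also have "\<dots> = (LINT x:X|lborel. u x * w x) + e * (LINT x:X|lborel. w x)"
    by (subst set_integral_add) (auto intro!: set_integrable_compact X continuous_intros u w)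
  finally have 1: "(LINT x:X|lborel. v x * w x) \<le> (LINT x:X|lborel. u x * w x) + e * (LINT x:X|lborel. w x)" .
  have "(LINT y:Y|lborel. conj_on X v y) \<le> (LINT y:Y|lborel. conj_on X u y + e')"
    using le(2)
    by (intro set_integral_mono set_integrable_compact Y continuous_intros continuous_on_conj_on X u v)
  also have "\<dots> = (LINT y:Y|lborel. conj_on X u y) + e' * measure lborel Y"
    by (subst set_integral_add)
      (auto intro!: set_integrable_compact Y continuous_intros continuous_on_conj_on X u
        simp: set_integral_const_compact[OF Y])
  finally show ?thesis using 1 unfolding transport_dual_def by linarith
qed

lemma transport_dual_biconj_le:
  assumes X: "compact X" "X \<noteq> {}" and Y: "compact Y" "Y \<noteq> {}"
    and w: "continuous_on X w" "\<And>x. x \<in> X \<Longrightarrow> 0 \<le> w x"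
    and u: "continuous_on X u"
  shows "transport_dual X Y w (conj_on Y (conj_on X u)) \<le> transport_dual X Y w u"
  using transport_dual_mono[OF X Y(1) w u, of "conj_on Y (conj_on X u)" 0 0]
    biconj_on_le[OF X u Y(2)] conj_on_biconj_on_le[OF X u Y(1)]
    continuous_on_conj_on[OF Y] continuous_on_conj_on[OF X u]
  by simp

text \<open>A shift by \<open>c\<close> adds \<open>c\<close> times the mass of \<open>w\<close> and
  removes \<open>c\<close> times the volume of \<open>Y\<close>; the balance \<open>bal\<close>
  makes them cancel.\<close>

lemma transport_dual_shift:
  assumes X: "compact X" "X \<noteq> {}" and Y: "compact Y"
    and w: "continuous_on X w" "\<And>x. x \<in> X \<Longrightarrow> 0 \<le> w x"
    and bal: "(LINT x:X|lborel. w x) = measure lborel Y"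
    and u: "continuous_on X u"
  shows "transport_dual X Y w (\<lambda>x. u x + c) \<le> transport_dual X Y w u"
proof -
  have uc: "continuous_on X (\<lambda>x. u x + c)" by (intro continuous_intros u)
  show ?thesis
    using transport_dual_mono[OF X Y w u uc, of c "-c"] conj_on_mono[OF X u, of "\<lambda>x. u x + c" "-c"]
    by (simp add: bal)
qed

lemma le_if_le_add_eps_mult:
  fixes a b c :: real
  assumes "\<And>e. 0 < e \<Longrightarrow> a \<le> b + e * c" "0 < c"
  shows "a \<le> b"
proof (rule field_le_epsilon)
  fix e :: real assume "0 < e"
  then show "a \<le> b + e" using assms(1)[of "e / c"] assms(2) by simp
qed

text \<open>Double conjugation does not increase the functional and yields a Lipschitz constant that
  depends on \<open>Y\<close> alone. The infimum can thus be taken over an equicontinuous and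
  equibounded class, where Arzela-Ascoli applies. The minimiser is returned as a conjugate, which
  keeps it convex and defined on the whole space.\<close>

theorem transport_dual_minimiser:
  fixes X Y :: "'a::euclidean_space set"
  assumes X: "compact X" "0 \<in> X" and Y: "compact Y" "Y \<noteq> {}"
    and w: "continuous_on X w" "\<And>x. x \<in> X \<Longrightarrow> 0 \<le> w x"
    and bal: "(LINT x:X|lborel. w x) = measure lborel Y"
  obtains \<psi> where "continuous_on Y \<psi>"
    "\<And>u. continuous_on X u \<Longrightarrow> transport_dual X Y w (conj_on Y \<psi>) \<le> transport_dual X Y w u"
proof -
  note X' = X(1) ex_in_conv[THEN iffD1, OF exI, OF X(2)]
  let ?J = "transport_dual X Y w"
  \<comment> \<open>The functional is invariant under adding constants; normalising at
    \<open>0\<close>, a point of \<open>X\<close>, makes the class bounded on \<open>X\<close> and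
    the conjugates nonnegative.\<close>
  define C where "C = {u. \<exists>\<psi>. continuous_on Y \<psi> \<and> u = (\<lambda>x. conj_on Y \<psi> x - conj_on Y \<psi> 0)}"
  obtain r where r0: "0 \<le> r" and r: "Y \<subseteq> cball 0 r" by (rule compact_subset_cball_0[OF Y(1)])
  obtain s where s0: "0 \<le> s" and s: "X \<subseteq> cball 0 s" by (rule compact_subset_cball_0[OF X(1)])
  have Clip: "\<bar>u x - u y\<bar> \<le> r * norm (x - y)" if "u \<in> C" for u x y
    using that conj_on_lipschitz[OF Y _ r] unfolding C_def by fastforce
  have C0: "u 0 = 0" if "u \<in> C" for u using that unfolding C_def by auto
  have Ccont: "continuous_on A u" if "u \<in> C" for u A
    using that unfolding C_def by (auto intro!: continuous_intros continuous_on_conj_on[OF Y])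
  have Cbd: "\<bar>u x\<bar> \<le> r * s" if "u \<in> C" "x \<in> X" for u x
  proof -
    have "\<bar>u x\<bar> \<le> r * norm x" using Clip[OF that(1), of x 0] C0[OF that(1)] by simp
    also have "\<dots> \<le> r * s" using s that(2) r0 by (intro mult_left_mono) auto
    finally show ?thesis .
  qed
  have Cmin: "\<exists>v\<in>C. ?J v \<le> ?J u" if u: "continuous_on X u" for u
  proof -
    let ?u2 = "conj_on Y (conj_on X u)"
    have c: "continuous_on Y (conj_on X u)" by (rule continuous_on_conj_on[OF X' u])
    have "(\<lambda>x. ?u2 x + (- ?u2 0)) \<in> C" unfolding C_def using c by auto
    moreover have "?J (\<lambda>x. ?u2 x + (- ?u2 0)) \<le> ?J ?u2"
      by (intro transport_dual_shift X' Y w bal continuous_on_conj_on c)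
    moreover have "?J ?u2 \<le> ?J u" by (intro transport_dual_biconj_le X' Y w u)
    ultimately show ?thesis by (meson order_trans)
  qed
  have Jbd: "?J u \<ge> - (r * s) * (LINT x:X|lborel. w x)" if "u \<in> C" for u
  proof -
    have "(LINT x:X|lborel. - (r * s) * w x) \<le> (LINT x:X|lborel. u x * w x)"
      using Cbd[OF that] w(2)
      by (intro set_integral_mono set_integrable_compact X continuous_intros w Ccont that mult_right_mono)
        (auto simp: abs_le_iff minus_le_iff)
    then have 1: "- (r * s) * (LINT x:X|lborel. w x) \<le> (LINT x:X|lborel. u x * w x)"
      by (simp only: set_integral_mult_right)
    have "0 \<le> conj_on X u y" for y
      using conj_on_upper[OF X(1) Ccont[OF that] X(2), of y] C0[OF that] by simp
    then have "0 \<le> (LINT y:Y|lborel. conj_on X u y)"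
      unfolding set_lebesgue_integral_def by (intro integral_nonneg_AE) (auto simp: indicator_def)
    with 1 show ?thesis unfolding transport_dual_def by linarith
  qed
  have bdd: "bdd_below (?J ` C)" using Jbd by (auto intro!: bdd_belowI2)
  have Cne: "C \<noteq> {}" using Cmin[of "\<lambda>_. 0"] by auto
  define I where "I = Inf (?J ` C)"
  have "\<exists>u\<in>C. ?J u < I + 1 / real (Suc n)" for n
    using cInf_lessD[of "?J ` C" "I + 1 / real (Suc n)"] Cne unfolding I_def by auto
  then obtain un where un: "\<And>n. un n \<in> C" "\<And>n. ?J (un n) < I + 1 / real (Suc n)" by metis
  have eq: "\<exists>d. 0 < d \<and> (\<forall>n y. y \<in> X \<and> norm(x - y) < d \<longrightarrow> norm(un n x - un n y) < e)"
    if "x \<in> X" "0 < e" for x e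
  proof (intro exI conjI allI impI)
    show "0 < e / (r + 1)" using that r0 by simp
    fix n y assume "y \<in> X \<and> norm(x - y) < e / (r + 1)"
    then have "(r + 1) * norm (x - y) < e" using r0 by (simp add: field_simps)
    then show "norm(un n x - un n y) < e" using Clip[OF un(1), of n x y] 
      by (simp add: distrib_right) (smt (verit) norm_ge_zero)
  qed
  obtain g k where g: "continuous_on X g" "strict_mono (k :: nat \<Rightarrow> nat)"
    "\<And>e. 0 < e \<Longrightarrow> \<exists>N. \<forall>n x. n \<ge> N \<and> x \<in> X \<longrightarrow> norm(un (k n) x - g x) < e"
    using Arzela_Ascoli[OF X(1), of un "r * s"] Cbd[OF un(1)] eq by (metis real_norm_def)
  have "?J g \<le> I + e * (1 + (LINT x:X|lborel. w x) + measure lborel Y)" if e: "0 < e" for e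
  proof -
    obtain N where N: "\<And>n x. n \<ge> N \<Longrightarrow> x \<in> X \<Longrightarrow> norm(un (k n) x - g x) < e"
      using g(3)[OF e] by blast
    obtain M where M: "1 / real (Suc M) < e" using nat_approx_posE[OF e] by blast
    define n where "n = max N M"
    have nn: "1 / real (Suc (k n)) \<le> 1 / real (Suc M)"
      using seq_suble[OF g(2), of n] by (simp add: n_def frac_le)
    have d: "g x \<le> un (k n) x + e" "un (k n) x \<le> g x + e" if "x \<in> X" for x
      using N[of n x] that by (auto simp: n_def abs_less_iff)
    have "?J g \<le> ?J (un (k n)) + e * (LINT x:X|lborel. w x) + e * measure lborel Y"
      by (intro transport_dual_mono X' Y w g Ccont un d conj_on_mono)
    then show ?thesis using un(2)[of "k n"] nn M by (simp add: algebra_simps)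
  qed
  moreover have "0 \<le> (LINT x:X|lborel. w x)" unfolding bal by simp
  ultimately have "?J g \<le> I"
    by (intro le_if_le_add_eps_mult[of "?J g" I]) (auto simp: add_pos_nonneg)
  show thesis
  proof (rule that)
    show c: "continuous_on Y (conj_on X g)" by (rule continuous_on_conj_on[OF X' g(1)])
    fix u :: "'a \<Rightarrow> real" assume u: "continuous_on X u"
    have "?J (conj_on Y (conj_on X g)) \<le> ?J g" by (intro transport_dual_biconj_le X' Y w g)
    also note \<open>?J g \<le> I\<close>
    also obtain v where v: "v \<in> C" "?J v \<le> ?J u" using Cmin[OF u] by blast
    have "I \<le> ?J v" unfolding I_def by (rule cINF_lower[OF bdd v(1)])
    also note v(2)
    finally show "?J (conj_on Y (conj_on X g)) \<le> ?J u" .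
  qed
qed

text \<open>\<open>S\<close> contains the slopes in \<open>Y\<close> that support
  \<open>\<phi>\<close> at a point of \<open>K\<close>. Lowering \<open>\<phi>\<close> by
  \<open>\<eta> / (n + 1)\<close> cannot decrease the functional, and it raises the conjugate by at
  most \<open>1 / (n + 1)\<close>, in the limit only over \<open>Y \<inter> S\<close>. So the mass
  seen by \<open>\<eta>\<close> is at most the volume of these slopes. This one-sided relation takes
  the place of a transport map.\<close>

lemma transport_dual_euler_lagrange:
  fixes X Y :: "'a::euclidean_space set"
  assumes X: "compact X" "X \<noteq> {}" and Y: "compact Y"
    and w: "continuous_on X w" "\<And>x. x \<in> X \<Longrightarrow> 0 \<le> w x"
    and \<phi>: "continuous_on X \<phi>"
    and min: "\<And>u. continuous_on X u \<Longrightarrow> transport_dual X Y w \<phi> \<le> transport_dual X Y w u"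
    and \<eta>: "continuous_on X \<eta>" "\<And>x. x \<in> X \<Longrightarrow> 0 \<le> \<eta> x" "\<And>x. x \<in> X \<Longrightarrow> \<eta> x \<le> 1"
    and K: "compact K" "K \<subseteq> X" "\<And>x. x \<in> X - K \<Longrightarrow> \<eta> x = 0"
    and S: "S \<in> sets borel" "\<And>x y. y \<in> Y - S \<Longrightarrow> x \<in> K \<Longrightarrow> inner x y - \<phi> x < conj_on X \<phi> y"
  shows "(LINT x:X|lborel. \<eta> x * w x) \<le> measure lborel (Y \<inter> S)"
proof -
  define un where "un n x = \<phi> x - \<eta> x / real (Suc n)" for n x
  have unc: "continuous_on X (un n)" for n unfolding un_def by (intro continuous_intros \<phi> \<eta>) auto
  \<comment> \<open>The difference quotient of the conjugate with respect to the size of the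
    perturbation. It lies in \<open>[0, 1]\<close>, which is the domination used on
    \<open>Y\<close>.\<close>
  define D where "D n y = real (Suc n) * (conj_on X (un n) y - conj_on X \<phi> y)" for n y
  have Dc: "continuous_on A (D n)" for A n unfolding D_def
    by (intro continuous_intros continuous_on_conj_on X unc \<phi>)
  have un1: "un n x \<le> \<phi> x" "\<phi> x \<le> un n x + 1 / real (Suc n)" if "x \<in> X" for n x
    using \<eta>(2,3)[OF that] by (auto simp: un_def divide_right_mono)
  have D0: "0 \<le> D n y" for n y
    using conj_on_mono[OF X unc, of n \<phi> 0 y] un1 unfolding D_def by auto
  have D1: "D n y \<le> 1" for n y
  proof -
    have "conj_on X (un n) y \<le> conj_on X \<phi> y + 1 / real (Suc n)"
      by (rule conj_on_mono[OF X \<phi> un1(2)])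
    then show ?thesis unfolding D_def by (simp add: field_simps)
  qed
  have Dlim: "(\<lambda>n. D n y) \<longlonglongrightarrow> 0" if y: "y \<in> Y - S" for y
  proof -
    \<comment> \<open>Compactness of \<open>K\<close> turns the strict inequalities at
      \<open>y\<close> into a uniform gap. A perturbation smaller than the gap leaves the conjugate
      at \<open>y\<close> unchanged, so \<open>D n y\<close> is eventually 0.\<close>
    have "\<exists>\<gamma>>0. \<forall>x\<in>K. inner x y - \<phi> x \<le> conj_on X \<phi> y - \<gamma>"
    proof (cases "K = {}")
      case False
      have "continuous_on K (\<lambda>x. inner x y - \<phi> x)"
        by (intro continuous_intros continuous_on_subset[OF \<phi> K(2)])
      then obtain x where x: "x \<in> K" "\<forall>z\<in>K. inner z y - \<phi> z \<le> inner x y - \<phi> x"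
        using continuous_attains_sup[OF K(1) False] by blast
      show ?thesis
        using x S(2)[OF y x(1)] by (intro exI[of _ "conj_on X \<phi> y - (inner x y - \<phi> x)"]) auto
    qed (auto intro!: exI[of _ 1])
    then obtain \<gamma> where \<gamma>: "\<gamma> > 0" "\<And>x. x \<in> K \<Longrightarrow> inner x y - \<phi> x \<le> conj_on X \<phi> y - \<gamma>" by blast
    obtain M where M: "1 / real (Suc M) < \<gamma>" using nat_approx_posE[OF \<gamma>(1)] by blast
    have "D n y = 0" if "n \<ge> M" for n
    proof -
      have n: "1 / real (Suc n) < \<gamma>" using M that by (smt (verit) frac_le of_nat_0_less_iff of_nat_le_iff Suc_le_mono zero_less_Suc)
      have "conj_on X (un n) y \<le> conj_on X \<phi> y"
      proof (rule conj_on_least[OF X(2)])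
        fix x assume x: "x \<in> X"
        show "inner x y - un n x \<le> conj_on X \<phi> y"
        proof (cases "x \<in> K")
          case True
          then show ?thesis using \<gamma>(2)[OF True] un1(2)[OF x, of n] n by linarith
        next
          case False
          then have "un n x = \<phi> x" using K(3) x by (simp add: un_def)
          then show ?thesis using conj_on_upper[OF X(1) \<phi> x] by simp
        qed
      qed
      then have "D n y \<le> 0" unfolding D_def by (simp add: mult_le_0_iff)
      then show ?thesis using D0[of n y] by linarith
    qed
    then show ?thesis by (intro tendsto_eventually) (auto simp: eventually_sequentially)
  qed
  have Yb: "Y \<in> sets borel" "S \<inter> Y \<in> sets borel" "Y \<inter> S \<in> sets borel"
    using Y S(1) by (auto simp: borel_compact)
  have fin: "emeasure lborel Y < \<infinity>" by (rule emeasure_compact_finite[OF Y])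
  have iY: "integrable lborel (indicat_real Y)" using Yb fin by auto
  have key: "(LINT x:X|lborel. \<eta> x * w x) \<le> (LINT y:Y|lborel. D n y)" for n
  proof -
    have 1: "transport_dual X Y w \<phi> \<le> transport_dual X Y w (un n)" by (rule min[OF unc])
    have "(LINT x:X|lborel. un n x * w x) =
       (LINT x:X|lborel. \<phi> x * w x - (1 / real (Suc n)) * (\<eta> x * w x))"
      unfolding un_def by (simp add: left_diff_distrib)
    also have "\<dots> = (LINT x:X|lborel. \<phi> x * w x) - (1 / real (Suc n)) * (LINT x:X|lborel. \<eta> x * w x)"
      by (subst set_integral_diff) (auto intro!: set_integrable_compact X continuous_intros \<phi> \<eta> w)
    finally have "(1 / real (Suc n)) * (LINT x:X|lborel. \<eta> x * w x)
        \<le> (LINT y:Y|lborel. conj_on X (un n) y) - (LINT y:Y|lborel. conj_on X \<phi> y)"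
      using 1 unfolding transport_dual_def by linarith
    then have "(LINT x:X|lborel. \<eta> x * w x)
        \<le> real (Suc n) * ((LINT y:Y|lborel. conj_on X (un n) y) - (LINT y:Y|lborel. conj_on X \<phi> y))"
      by (simp add: divide_le_eq mult.commute)
    also have "\<dots> = (LINT y:Y|lborel. D n y)"
      unfolding D_def
      by (subst set_integral_diff(2)[symmetric]) (auto intro!: set_integrable_compact Y continuous_on_conj_on X unc \<phi>)
    finally show ?thesis .
  qed
  define E where "E n y = indicat_real (Y - S) y * D n y" for n y
  have Em: "E n \<in> borel_measurable lborel" for n
    unfolding E_def using borel_measurable_continuous_onI[OF Dc[of UNIV n]] Yb S(1)
    by (intro borel_measurable_times) auto
  have "(\<lambda>n. LINT y|lborel. E n y) \<longlonglongrightarrow> integral\<^sup>L lborel (\<lambda>y::'a. 0::real)"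
  proof (rule integral_dominated_convergence[where w = "indicat_real Y"])
    show "AE y in lborel. (\<lambda>n. E n y) \<longlonglongrightarrow> 0"
      using Dlim by (intro AE_I2) (auto simp: E_def indicator_def)
    show "AE y in lborel. norm (E n y) \<le> indicat_real Y y" for n
      using D0 D1 by (intro AE_I2) (auto simp: E_def indicator_def)
  qed (use Em iY in auto)
  then have Elim: "(\<lambda>n. (LINT y|lborel. E n y) + measure lborel (Y \<inter> S)) \<longlonglongrightarrow> 0 + measure lborel (Y \<inter> S)"
    by (intro tendsto_intros) simp
  have le: "(LINT x:X|lborel. \<eta> x * w x) \<le> (LINT y|lborel. E n y) + measure lborel (Y \<inter> S)" for n
  proof -
    have Ei: "integrable lborel (E n)"
      by (rule Bochner_Integration.integrable_bound[OF iY Em]) (use D0 D1 in \<open>auto simp: E_def indicator_def\<close>)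
    have Si: "integrable lborel (indicat_real (Y \<inter> S))"
      by (rule Bochner_Integration.integrable_bound[OF iY]) (use Yb in \<open>auto simp: indicator_def\<close>)
    have "(LINT y:Y|lborel. D n y) \<le> (LINT y|lborel. E n y + indicat_real (Y \<inter> S) y)"
      unfolding set_lebesgue_integral_def
      using D1 set_integrable_compact[OF Y Dc, of n] Ei Si
      by (intro integral_mono Bochner_Integration.integrable_add Ei Si)
        (auto simp add: E_def indicator_def set_integrable_def)
    also have "\<dots> = (LINT y|lborel. E n y) + measure lborel (Y \<inter> S)"
      using Ei Si by simp
    finally show ?thesis using key[of n] by linarith
  qed
  show ?thesis using LIMSEQ_le_const[OF Elim] le by auto
qed

section \<open>Volume and second differences\<close>

text \<open>\<open>measure_linear_image\<close> of the library asks for a well-ordered index type; the determinant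
  of a shear is the only place where the order matters, and a row operation avoids it.\<close>

lemma measure_linear_image_cbox_finite:
  fixes f :: "real^'n \<Rightarrow> real^'n"
  assumes "linear f"
  shows "measure lebesgue (f ` cbox a b) = \<bar>det (matrix f)\<bar> * measure lebesgue (cbox a b)"
proof -
  have "\<forall>a b. measure lebesgue (f ` cbox a b) = \<bar>det (matrix f)\<bar> * measure lebesgue (cbox a b)"
  proof (rule induct_linear_elementary[OF assms]; intro allI)
    fix f g :: "real^'n \<Rightarrow> real^'n" and a b :: "real^'n"
    assume f: "linear f" "\<forall>a b. measure lebesgue (f ` cbox a b) = \<bar>det (matrix f)\<bar> * measure lebesgue (cbox a b)"
      and g: "linear g" "\<forall>a b. measure lebesgue (g ` cbox a b) = \<bar>det (matrix g)\<bar> * measure lebesgue (cbox a b)"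
    have "measure lebesgue (f ` (g ` cbox a b)) = \<bar>det (matrix f)\<bar> * measure lebesgue (g ` cbox a b)"
      using measure_linear_sufficient[OF f(1) measurable_linear_image_interval[OF g(1)]] f(2) by metis
    then show "measure lebesgue ((f \<circ> g) ` cbox a b) = \<bar>det (matrix (f \<circ> g))\<bar> * measure lebesgue (cbox a b)"
      using g(2) by (simp add: image_comp matrix_compose[OF g(1) f(1)] det_mul abs_mult)
  next
    fix f :: "real^'n \<Rightarrow> real^'n" and i and a b :: "real^'n"
    assume f: "linear f" "\<And>x. f x $ i = 0"
    have "axis i 1 \<notin> range f"
      using f(2) by (metis axis_nth imageE zero_neq_one)
    then have ni: "\<not> inj f" using linear_injective_imp_surjective[OF f(1)] by auto
    have "matrix f $ i = 0" using f(2) by (simp add: matrix_def vec_eq_iff)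
    then have "det (matrix f) = 0" by (intro det_zero_row) (simp add: row_def vec_eq_iff)
    then show "measure lebesgue (f ` cbox a b) = \<bar>det (matrix f)\<bar> * measure lebesgue (cbox a b)"
      using negligible_linear_singular_image[OF f(1) ni, of "cbox a b"] by (simp add: negligible_imp_measure0)
  next
    fix c and a b :: "real^'n"
    show "measure lebesgue ((\<lambda>x. \<chi> i. c i * x $ i) ` cbox a b)
        = \<bar>det (matrix (\<lambda>x. \<chi> i. c i * x $ i))\<bar> * measure lebesgue (cbox a b)"
      by (subst measure_stretch) (auto simp: matrix_def axis_def det_diagonal)
  next
    fix m n :: 'n and a b :: "real^'n"
    let ?t = "Transposition.transpose m n"
    let ?h = "\<lambda>v::real^'n. \<chi> i. v $ ?t i"
    have p: "?t permutes UNIV" by (rule permutes_swap_id) auto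
    have inv: "?h (?h v) = v" for v by (simp add: vec_eq_iff)
    have "?h ` cbox a b = cbox (?h a) (?h b)"
    proof
      show "cbox (?h a) (?h b) \<subseteq> ?h ` cbox a b"
      proof
        fix x assume "x \<in> cbox (?h a) (?h b)"
        then have "\<And>i. a $ ?t i \<le> x $ i \<and> x $ i \<le> b $ ?t i" by (simp add: mem_box_cart)
        then have "a $ i \<le> x $ ?t i \<and> x $ ?t i \<le> b $ i" for i
          by (metis transpose_involutory)
        then have "?h x \<in> cbox a b" by (simp add: mem_box_cart)
        then show "x \<in> ?h ` cbox a b" using inv[of x] by (metis image_eqI)
      qed
    qed (auto simp: mem_box_cart)
    moreover have "measure lebesgue (cbox (?h a) (?h b)) = measure lebesgue (cbox a b)"
    proof -
      have "(\<forall>i. a $ ?t i \<le> b $ ?t i) \<longleftrightarrow> (\<forall>i. a $ i \<le> b $ i)" by (metis transpose_involutory)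
      moreover have "(\<Prod>i\<in>UNIV. b $ ?t i - a $ ?t i) = (\<Prod>i\<in>UNIV. b $ i - a $ i)"
        using prod.permute[OF p, of "\<lambda>i. b $ i - a $ i"] by (simp add: o_def)
      ultimately show ?thesis by (simp add: content_cbox_if_cart interval_eq_empty_cart not_less[symmetric])
    qed
    moreover have "matrix ?h = (\<chi> i j. mat 1 $ i $ ?t j)"
      by (auto simp: matrix_def axis_def mat_def vec_eq_iff)
    then have "\<bar>det (matrix ?h)\<bar> = 1"
      by (simp add: det_permute_columns[OF p] abs_mult sign_def)
    ultimately show "measure lebesgue (?h ` cbox a b) = \<bar>det (matrix ?h)\<bar> * measure lebesgue (cbox a b)"
      by simp
  next
    fix m n :: 'n and a b :: "real^'n"
    assume mn: "m \<noteq> n"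
    let ?h = "\<lambda>v::real^'n. \<chi> i. if i = m then v $ m + v $ n else v $ i"
    have lin: "linear ?h" by (rule linearI) (auto simp: algebra_simps vec_eq_iff)
    have "matrix ?h = (\<chi> k. if k = m then row m (mat 1) + 1 *s row n (mat 1) else row k (mat 1))"
      using mn by (auto simp: matrix_def axis_def mat_def row_def vec_eq_iff)
    then have d: "det (matrix ?h) = 1" using det_row_operation[OF mn, of "mat 1 :: real^'n^'n" 1] by simp
    \<comment> \<open>The shear formula is applied to a box whose lower \<open>n\<close>-th
      coordinate is nonnegative; translation by \<open>?u\<close> moves that coordinate to
      0.\<close>
    let ?u = "axis n (- a $ n) :: real^'n"
    have "measure lebesgue (?h ` cbox a b) = measure lebesgue ((+) (?h ?u) ` ?h ` cbox a b)"
      by (rule measure_translation[symmetric])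
    also have "(+) (?h ?u) ` ?h ` cbox a b = ?h ` ((+) ?u ` cbox a b)"
      unfolding image_image by (intro image_cong refl) (simp add: linear_add[OF lin])
    also have "(+) ?u ` cbox a b = cbox (?u + a) (?u + b)" by (rule cbox_translation[symmetric])
    also have "measure lebesgue (?h ` cbox (?u + a) (?u + b)) = measure lebesgue (cbox (?u + a) (?u + b))"
    proof (cases "cbox (?u + a) (?u + b) = {}")
      case False
      then show ?thesis by (intro measure_shear_interval mn) (simp_all add: axis_def)
    qed simp
    also have "\<dots> = measure lebesgue ((+) ?u ` cbox a b)" by (simp only: cbox_translation)
    also have "\<dots> = measure lebesgue (cbox a b)" by (rule measure_translation)
    finally show "measure lebesgue (?h ` cbox a b) = \<bar>det (matrix ?h)\<bar> * measure lebesgue (cbox a b)"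
      using d by simp
  qed
  then show ?thesis by blast
qed

lemma measure_linear_image_finite:
  fixes f :: "real^'n \<Rightarrow> real^'n"
  assumes "linear f" "S \<in> lmeasurable"
  shows "measure lebesgue (f ` S) = \<bar>det (matrix f)\<bar> * measure lebesgue S"
  using measure_linear_sufficient[OF assms measure_linear_image_cbox_finite[OF assms(1)]] by simp

lemma measure_lborel_linear_image_cball:
  fixes A :: "real^'n^'n"
  assumes "0 \<le> r"
  shows "measure lborel ((\<lambda>z. c + A *v z) ` cball 0 r) = \<bar>det A\<bar> * (unit_ball_vol (real CARD('n)) * r ^ CARD('n))"
proof -
  have lm: "cball (0::real^'n) r \<in> lmeasurable" by simp
  have 1: "measure lebesgue ((*v) A ` cball 0 r) = \<bar>det A\<bar> * measure lebesgue (cball (0::real^'n) r)"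
    using measure_linear_image_finite[OF matrix_vector_mul_linear lm, of A] by simp
  have "compact ((*v) A ` cball (0::real^'n) r)"
    by (intro compact_continuous_image compact_cball continuous_intros linear_continuous_on matrix_vector_mul_bounded_linear)
  then have "measure lborel ((*v) A ` cball 0 r) = measure lebesgue ((*v) A ` cball (0::real^'n) r)"
    by (simp add: borel_compact)
  moreover have "(\<lambda>z. c + A *v z) ` cball 0 r = (+) c ` ((*v) A ` cball 0 r)" by auto
  moreover have "measure lebesgue ((+) c ` ((*v) A ` cball 0 r)) = measure lebesgue ((*v) A ` cball (0::real^'n) r)"
    by (rule measure_translation)
  moreover have "compact ((\<lambda>z. c + A *v z) ` cball (0::real^'n) r)"
    by (intro compact_continuous_image compact_cball continuous_intros linear_continuous_on matrix_vector_mul_bounded_linear)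
  ultimately show ?thesis using 1 content_cball[OF assms, of "0::real^'n"]
    by (simp add: borel_compact)
qed

section \<open>Second differences of a transport potential\<close>

definition second_difference :: "('a::real_vector \<Rightarrow> real) \<Rightarrow> 'a \<Rightarrow> 'a \<Rightarrow> real"
  where "second_difference f v x = f (x + v) + f (x - v) - 2 * f x"

text \<open>The affine function that attains the conjugate at \<open>x\<close> lies below it at
  \<open>x + v\<close> and at \<open>x - v\<close>.\<close>

lemma second_difference_conj_on_nonneg:
  assumes "compact Y" "Y \<noteq> {}" "continuous_on Y \<psi>"
  shows "0 \<le> second_difference (conj_on Y \<psi>) v x"
proof -
  obtain p where p: "p \<in> Y" "conj_on Y \<psi> x = inner p x - \<psi> p"
    by (rule conj_on_attained[OF assms])
  show ?thesis
    using p(2) conj_on_upper[OF assms(1,3) p(1), of "x + v"] conj_on_upper[OF assms(1,3) p(1), of "x - v"]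
    by (simp add: second_difference_def inner_add_right inner_diff_right)
qed

lemma norm1_le_card_norm:
  fixes z :: "real^'n"
  shows "(\<Sum>i\<in>UNIV. \<bar>z$i\<bar>) \<le> real CARD('n) * norm z"
  using sum_bounded_above[of UNIV "\<lambda>i. \<bar>z$i\<bar>" "norm z"] component_le_norm_cart[of z] by simp

text \<open>\<open>P\<close> concerns the cross-polytope spanned by the rows of \<open>V\<close>
  around \<open>x0\<close>. In the coordinates \<open>z\<close> it contains the Euclidean ball of
  radius \<open>1 / d\<close>: half of this radius is spent on the points considered, half on the
  step from such a point to a second one, and the cutoff is at least \<open>1/2\<close> on a ball of
  half the size again. Both sides have the same degree under scaling of \<open>V\<close> when
  \<open>\<phi>\<close> is quadratic.\<close>

lemma transport_dual_second_difference:
  fixes X Y :: "(real^'n) set" and V :: "real^'n^'n"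
  defines "d \<equiv> CARD('n)"
  assumes X: "compact X" and Y: "compact Y" "Y \<noteq> {}"
    and w: "continuous_on X w" "\<And>x. x \<in> X \<Longrightarrow> 0 \<le> w x"
    and \<psi>: "continuous_on Y \<psi>" and \<phi>: "\<phi> = conj_on Y \<psi>"
    and min: "\<And>u. continuous_on X u \<Longrightarrow> transport_dual X Y w \<phi> \<le> transport_dual X Y w u"
    and P: "\<And>z. (\<Sum>i\<in>UNIV. \<bar>z$i\<bar>) \<le> 1 \<Longrightarrow> x0 + z v* V \<in> X \<and> m \<le> w (x0 + z v* V)"
    and m: "0 \<le> m"
  shows "m * (det V)\<^sup>2 \<le> 2 * (8 * real d ^ 2 * (\<Sum>i\<in>UNIV. second_difference \<phi> (V$i) x0)) ^ d"
proof (cases "det V = 0")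
  case True
  have "0 \<le> (\<Sum>i\<in>UNIV. second_difference \<phi> (V$i) x0)"
    unfolding \<phi> by (intro sum_nonneg second_difference_conj_on_nonneg Y \<psi>)
  then show ?thesis using True by (simp add: d_def)
next
  case False
  define s where "s = (\<Sum>i\<in>UNIV. second_difference \<phi> (V$i) x0)"
  have d0: "0 < real d" by (simp add: d_def)
  have s0: "0 \<le> s" unfolding s_def \<phi> by (intro sum_nonneg second_difference_conj_on_nonneg Y \<psi>)
  have comp: "inner (z v* V) p = (\<Sum>i\<in>UNIV. z$i * inner (V$i) p)" for z p
    unfolding dot_lmul_matrix by (simp add: inner_vec_def[of z] matrix_vector_mul_component)
  obtain p0 where p0: "p0 \<in> Y" "\<phi> x0 = inner p0 x0 - \<psi> p0"
    unfolding \<phi> by (rule conj_on_attained[OF Y \<psi>])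
  have sup: "inner p0 (x - x0) \<le> \<phi> x - \<phi> x0" for x
    using conj_on_upper[OF Y(1) \<psi> p0(1), of x] p0(2) unfolding \<phi> by (simp add: inner_diff_right)
  \<comment> \<open>\<open>\<phi>\<close> in the coordinates of the rows of \<open>V\<close>, minus
    its supporting affine function of slope \<open>p0\<close> at \<open>x0\<close>; hence
    \<open>\<Phi>\<close> is nonnegative and vanishes at 0.\<close>
  define \<Phi> where "\<Phi> z = \<phi> (x0 + z v* V) - \<phi> x0 - inner p0 (z v* V)" for z
  have \<Phi>0: "0 \<le> \<Phi> z" for z using sup[of "x0 + z v* V"] unfolding \<Phi>_def by simp
  \<comment> \<open>By convexity the vertices control the cross-polytope. Concretely, take the
    affine function that touches \<open>\<phi>\<close> at the point of coordinates \<open>z\<close>.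
    Its gap \<open>a\<close> at \<open>x0\<close> enters every vertex bound once, and since the
    weights \<open>\<bar>z$i\<bar>\<close> sum to at most 1 it is cancelled by the
    \<open>- a\<close> in \<open>\<Phi> z\<close>.\<close>
  have \<Phi>s: "\<Phi> z \<le> s" if z: "(\<Sum>i\<in>UNIV. \<bar>z$i\<bar>) \<le> 1" for z
  proof -
    obtain y where y: "y \<in> Y" "\<phi> (x0 + z v* V) = inner y (x0 + z v* V) - \<psi> y"
      unfolding \<phi> by (rule conj_on_attained[OF Y \<psi>])
    have up: "inner y x - \<psi> y \<le> \<phi> x" for x using conj_on_upper[OF Y(1) \<psi> y(1), of x] unfolding \<phi> .
    define a where "a = \<phi> x0 - (inner y x0 - \<psi> y)"
    have a: "0 \<le> a" using up[of x0] unfolding a_def by simp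
    have one: "z$i * inner (V$i) (y - p0) \<le> \<bar>z$i\<bar> * (s + a)" for i
    proof -
      let ?A = "\<phi> (x0 + V$i) - \<phi> x0 - inner p0 (V$i)" and ?B = "\<phi> (x0 - V$i) - \<phi> x0 + inner p0 (V$i)"
      have AB: "0 \<le> ?A" "0 \<le> ?B" using sup[of "x0 + V$i"] sup[of "x0 - V$i"] by (auto)
      have "?A + ?B = second_difference \<phi> (V$i) x0" by (simp add: second_difference_def)
      also have "\<dots> \<le> s" unfolding s_def
        by (rule member_le_sum) (auto simp: \<phi> intro: second_difference_conj_on_nonneg[OF Y \<psi>])
      finally have "?A \<le> s" "?B \<le> s" using AB by linarith+
      moreover have "inner (V$i) (y - p0) \<le> ?A + a" "- inner (V$i) (y - p0) \<le> ?B + a"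
        using up[of "x0 + V$i"] up[of "x0 - V$i"] unfolding a_def
        by (simp_all add: inner_add_right inner_diff_right inner_commute[of _ "V$i"])
      ultimately have "\<bar>inner (V$i) (y - p0)\<bar> \<le> s + a" by linarith
      then have "\<bar>z$i\<bar> * \<bar>inner (V$i) (y - p0)\<bar> \<le> \<bar>z$i\<bar> * (s + a)" by (intro mult_left_mono) auto
      then show ?thesis by (metis abs_ge_self abs_mult order_trans)
    qed
    have "\<Phi> z = - a + inner (z v* V) (y - p0)"
      unfolding \<Phi>_def y(2) a_def by (simp add: inner_add_right inner_diff_right inner_commute)
    also have "inner (z v* V) (y - p0) \<le> (\<Sum>i\<in>UNIV. \<bar>z$i\<bar> * (s + a))"
      unfolding comp by (rule sum_mono) (rule one)
    also have "\<dots> \<le> 1 * (s + a)" unfolding sum_distrib_right[symmetric]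
      using z s0 a by (intro mult_right_mono) auto
    finally show ?thesis by simp
  qed
  obtain B where B: "V ** B = mat 1" "B ** V = mat 1"
    using False invertible_det_nz[of V] unfolding invertible_def by blast
  have detB: "det B * det V = 1" using B(2) by (metis det_I det_mul)
  \<comment> \<open>The slopes found below satisfy
    \<open>norm (V *v (p - p0)) \<le> 2 * d * s\<close>, so they lie in the image of a ball under
    \<open>B\<close>, the inverse of \<open>V\<close>.\<close>
  define S where "S = (\<lambda>q. p0 + B *v q) ` cball 0 (2 * d * s)"
  \<comment> \<open>Twice this radius still fits into the cross-polytope, because the 1-norm is at
    most \<open>d\<close> times the Euclidean norm.\<close>
  define h where "h = (1 / (2 * real d))"
  have h0: "0 < h" using d0 by (simp add: h_def)
  define K where "K = (\<lambda>z. x0 + transpose V *v z) ` cball 0 h"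
  define K' where "K' = (\<lambda>z. x0 + transpose V *v z) ` cball 0 (h / 2)"
  \<comment> \<open>A Lipschitz profile in the coordinates \<open>z\<close>: zero off
    \<open>K\<close> and at least \<open>1/2\<close> on the half-size copy
    \<open>K'\<close>.\<close>
  define \<eta> where "\<eta> x = max 0 (1 - norm (transpose B *v (x - x0)) / h)" for x
  have cont: "continuous_on A (\<lambda>z. c + M *v z)" for A and M :: "real^'n^'n" and c
    by (intro continuous_intros linear_continuous_on matrix_vector_mul_bounded_linear)
  have cK: "compact K" "compact K'" "compact S" unfolding K_def K'_def S_def
    by (intro compact_continuous_image cont compact_cball)+
  have tB: "transpose B ** transpose V = mat 1" "transpose V ** transpose B = mat 1"
    using B by (simp_all flip: matrix_transpose_mul)
  have Bx: "transpose B *v (x0 + transpose V *v z - x0) = z" for z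
    unfolding add_diff_cancel_left' matrix_vector_mul_assoc tB by (rule matrix_vector_mul_lid)
  have xB: "x0 + transpose V *v (transpose B *v (x - x0)) = x" for x
    unfolding matrix_vector_mul_assoc tB matrix_vector_mul_lid by simp
  have inX: "x0 + transpose V *v z \<in> X \<and> m \<le> w (x0 + transpose V *v z)" if "norm z \<le> h" for z
  proof -
    have "(\<Sum>i\<in>UNIV. \<bar>z$i\<bar>) \<le> real d * norm z" unfolding d_def by (rule norm1_le_card_norm)
    also have "\<dots> \<le> real d * h" using that d0 by (intro mult_left_mono) auto
    also have "\<dots> \<le> 1" using d0 by (simp add: h_def)
    finally show ?thesis using P[of z] by simp
  qed
  have KX: "K \<subseteq> X" using inX unfolding K_def by auto
  then have Xne: "X \<noteq> {}" using h0 unfolding K_def by auto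
  have K'X: "K' \<subseteq> X" using inX h0 unfolding K'_def by auto
  have "(LINT x:X|lborel. \<eta> x * w x) \<le> measure lborel (Y \<inter> S)"
  proof (rule transport_dual_euler_lagrange[OF X Xne Y(1) w _ min])
    show "continuous_on X \<phi>" unfolding \<phi> by (intro continuous_on_conj_on Y \<psi>)
    have "continuous_on X (\<lambda>x. transpose B *v (x - x0))"
      by (intro bounded_linear.continuous_on[OF matrix_vector_mul_bounded_linear] continuous_intros)
    then show "continuous_on X \<eta>" unfolding \<eta>_def using h0 by (intro continuous_intros) auto
    show "0 \<le> \<eta> x" "\<eta> x \<le> 1" for x using h0 by (auto simp: \<eta>_def)
    show "compact K" "K \<subseteq> X" by fact+
    show "S \<in> sets borel" using cK by (simp add: borel_compact)
    fix x
    show "\<eta> x = 0" if "x \<in> X - K"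
    proof -
      have "\<not> norm (transpose B *v (x - x0)) \<le> h"
      proof
        assume "norm (transpose B *v (x - x0)) \<le> h"
        then have "x \<in> K" unfolding K_def using xB[of x]
          by (intro image_eqI[of _ _ "transpose B *v (x - x0)"]) auto
        then show False using that by simp
      qed
      then show ?thesis using h0 by (simp add: \<eta>_def divide_simps)
    qed
    fix p assume p: "p \<in> Y - S" and xK: "x \<in> K"
    show "inner x p - \<phi> x < conj_on X \<phi> p"
    proof (rule ccontr)
      assume "\<not> ?thesis"
      then have sub: "\<phi> x + inner p (x' - x) \<le> \<phi> x'" if "x' \<in> X" for x'
        using conj_on_upper[OF X _ that, of \<phi> p] \<open>continuous_on X \<phi>\<close>
        by (simp add: inner_diff_right inner_commute)
      obtain z where z: "norm z \<le> h" "x = x0 + transpose V *v z" using xK unfolding K_def by auto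
      define q where "q = V *v (p - p0)"
      have "norm q \<le> 2 * d * s"
      proof (cases "q = 0")
        case True
        then show ?thesis using s0 by simp
      next
        case False
        \<comment> \<open>A step of length \<open>h\<close> in the direction of \<open>q\<close>
          raises the supporting function of slope \<open>p\<close> by \<open>h * norm q\<close>
          relative to \<open>p0\<close> and stays in the cross-polytope, where \<open>\<Phi>\<close>
          is at most \<open>s\<close>; so \<open>h * norm q \<le> s\<close>.\<close>
        define z' where "z' = z + h *\<^sub>R (q /\<^sub>R norm q)"
        have "(\<Sum>i\<in>UNIV. \<bar>z'$i\<bar>) \<le> real d * norm z'" unfolding d_def by (rule norm1_le_card_norm)
        also have "norm z' \<le> h + norm (h *\<^sub>R (q /\<^sub>R norm q))" unfolding z'_def
          using norm_triangle_ineq[of z "h *\<^sub>R (q /\<^sub>R norm q)"] z(1) by linarith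
        also have "norm (h *\<^sub>R (q /\<^sub>R norm q)) = h" using False h0 by simp
        also have "real d * (h + h) = 1" using d0 by (simp add: h_def)
        finally have z'1: "(\<Sum>i\<in>UNIV. \<bar>z'$i\<bar>) \<le> 1" using d0 by simp
        have "\<Phi> z + inner (p - p0) (z' v* V - z v* V) \<le> \<Phi> z'"
          using sub[of "x0 + z' v* V"] P[OF z'1] unfolding \<Phi>_def z(2)
          by (simp add: inner_diff_left inner_diff_right)
        moreover have "inner (p - p0) (z' v* V - z v* V) = h * norm q"
        proof -
          have "inner (p - p0) (z' v* V - z v* V) = inner (z' - z) q"
            unfolding q_def by (simp add: inner_diff_left[of z'] inner_diff_right[of _ "z' v* V"] dot_lmul_matrix inner_commute[of "p - p0"])
          also have "\<dots> = h * (inner q q / norm q)" unfolding z'_def by (simp add: divide_inverse)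
          also have "inner q q / norm q = norm q" using False by (simp add: dot_square_norm power2_eq_square)
          finally show ?thesis .
        qed
        ultimately have "h * norm q \<le> s" using \<Phi>0[of z] \<Phi>s[OF z'1] by linarith
        then show ?thesis using d0 by (simp add: h_def field_simps)
      qed
      moreover have "p = p0 + B *v q" unfolding q_def by (simp add: matrix_vector_mul_assoc B)
      ultimately have "p \<in> S" unfolding S_def by auto
      then show False using p by simp
    qed
  qed
  also have "\<dots> \<le> measure lborel S"
    using cK Y(1) emeasure_compact_finite[OF cK(3)]
    by (intro measure_mono_fmeasurable) (auto simp: borel_compact fmeasurable_def)
  finally have up: "(LINT x:X|lborel. \<eta> x * w x) \<le> measure lborel S" .
  have "m / 2 * measure lborel K' = (LINT x:K'|lborel. m / 2)"
    by (simp add: set_integral_const_compact[OF cK(2)])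
  also have "\<dots> \<le> (LINT x:K'|lborel. \<eta> x * w x)"
  proof (rule set_integral_mono)
    have cB: "continuous_on K' (\<lambda>x. transpose B *v (x - x0))"
      by (intro bounded_linear.continuous_on[OF matrix_vector_mul_bounded_linear] continuous_intros)
    show "set_integrable lborel K' (\<lambda>x. m / 2)" by (intro set_integrable_compact cK continuous_intros)
    show "set_integrable lborel K' (\<lambda>x. \<eta> x * w x)" unfolding \<eta>_def using h0
      by (intro set_integrable_compact cK continuous_intros cB continuous_on_subset[OF w(1) K'X]) auto
    fix x assume "x \<in> K'"
    then obtain z where z: "norm z \<le> h / 2" "x = x0 + transpose V *v z" unfolding K'_def by auto
    have "1 / 2 \<le> \<eta> x" unfolding \<eta>_def z(2) Bx using z(1) h0 by (simp add: le_max_iff_disj field_simps)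
    moreover have "m \<le> w x" unfolding z(2) using inX[of z] z(1) h0 by simp
    ultimately have "1 / 2 * m \<le> \<eta> x * w x" using m by (intro mult_mono) auto
    then show "m / 2 \<le> \<eta> x * w x" by simp
  qed
  also have "\<dots> \<le> (LINT x:X|lborel. \<eta> x * w x)"
  proof -
    have cB: "continuous_on X (\<lambda>x. transpose B *v (x - x0))"
      by (intro bounded_linear.continuous_on[OF matrix_vector_mul_bounded_linear] continuous_intros)
    have i: "set_integrable lborel X (\<lambda>x. \<eta> x * w x)" unfolding \<eta>_def using h0
      by (intro set_integrable_compact X continuous_intros cB w(1)) auto
    have i': "set_integrable lborel K' (\<lambda>x. \<eta> x * w x)"
      by (rule set_integrable_subset[OF i _ K'X]) (use cK in \<open>simp add: borel_compact\<close>)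
    show ?thesis unfolding set_lebesgue_integral_def
      using i i' K'X w(2) unfolding set_integrable_def
      by (intro integral_mono) (auto simp: indicator_def \<eta>_def)
  qed
  also note up
  also have "measure lborel S = \<bar>det B\<bar> * (unit_ball_vol (real d) * (2 * d * s) ^ d)"
    unfolding S_def d_def using s0 by (intro measure_lborel_linear_image_cball) auto
  also have "measure lborel K' = \<bar>det V\<bar> * (unit_ball_vol (real d) * (h / 2) ^ d)"
    unfolding K'_def d_def using measure_lborel_linear_image_cball[of "h/2" x0 "transpose V"] h0 by simp
  finally have "unit_ball_vol (real d) * (m / 2 * \<bar>det V\<bar> * (h / 2) ^ d) \<le> unit_ball_vol (real d) * (\<bar>det B\<bar> * (2 * d * s) ^ d)"
    by (simp add: mult_ac)
  then have 1: "m / 2 * \<bar>det V\<bar> * (h / 2) ^ d \<le> \<bar>det B\<bar> * (2 * d * s) ^ d"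
    using unit_ball_vol_pos[of "real d"] by (simp del: unit_ball_vol_pos)
  have bv: "\<bar>det V\<bar> * \<bar>det B\<bar> = 1" using detB by (metis abs_mult abs_one mult.commute)
  have "m / 2 * (det V)^2 * (h / 2) ^ d = \<bar>det V\<bar> * (m / 2 * \<bar>det V\<bar> * (h / 2) ^ d)"
    by (simp add: power2_eq_square)
  also have "\<dots> \<le> \<bar>det V\<bar> * (\<bar>det B\<bar> * (2 * d * s) ^ d)" by (intro mult_left_mono 1) auto
  also have "\<dots> = (2 * d * s) ^ d" using bv by (simp flip: mult.assoc)
  \<comment> \<open>\<open>(4 * d) ^ d\<close> cancels \<open>(h / 2) ^ d\<close>, and
    \<open>2 d s\<close> times \<open>4 d\<close> is \<open>8 d^2 s\<close>. The outer factor 2 of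
    the claim stems from the lower bound \<open>1/2\<close> of the cutoff on
    \<open>K'\<close>.\<close>
  finally have "m / 2 * (det V)^2 * (h / 2) ^ d * (4 * real d) ^ d \<le> (2 * d * s) ^ d * (4 * real d) ^ d"
    using d0 by (intro mult_right_mono) auto
  moreover have "(h / 2) ^ d * (4 * real d) ^ d = (h / 2 * (4 * real d)) ^ d"
    by (rule power_mult_distrib[symmetric])
  moreover have "h / 2 * (4 * real d) = 1" using d0 by (simp add: h_def)
  moreover have "(2 * d * s) ^ d * (4 * real d) ^ d = (2 * d * s * (4 * real d)) ^ d"
    by (rule power_mult_distrib[symmetric])
  moreover have "2 * d * s * (4 * real d) = 8 * real d ^ 2 * s" by (simp add: power2_eq_square)
  ultimately have "m / 2 * (det V)^2 \<le> (8 * real d ^ 2 * s) ^ d" by (simp only: mult.assoc power_one mult_1_right)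
  then show ?thesis unfolding s_def[symmetric] by linarith
qed

section \<open>Mollification\<close>

lemma times_differentiable_Suc_imp:
  "times_differentiable (Suc k) f \<Longrightarrow> times_differentiable k f"
proof (induction k arbitrary: f)
  case 0
  then have "\<forall>x. f differentiable (at x)" by simp
  then show ?case
    by (auto simp: continuous_on_eq_continuous_at intro: differentiable_imp_continuous_within)
next
  case (Suc k)
  then show ?case by (metis times_differentiable.simps(2))
qed

lemma times_differentiable_SucI:
  assumes "\<And>x. (f has_derivative f' x) (at x)" "\<And>v. times_differentiable k (\<lambda>x. f' x v)"
  shows "times_differentiable (Suc k) f"
proof -
  have "f' x = frechet_derivative f (at x)" for x by (rule frechet_derivative_at[OF assms(1)])
  then show ?thesis using assms by (auto simp: differentiable_def)
qed

lemma times_differentiable_SucD: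
  assumes "times_differentiable (Suc k) f"
  shows "(f has_derivative frechet_derivative f (at x)) (at x)"
    "times_differentiable k (\<lambda>x. frechet_derivative f (at x) v)"
  using assms by (auto simp: frechet_derivative_works)

lemma times_differentiable_const: "times_differentiable k (\<lambda>x. c)"
proof (induction k arbitrary: c)
  case (Suc k)
  show ?case by (rule times_differentiable_SucI[OF has_derivative_const Suc])
qed simp

lemma times_differentiable_add:
  "times_differentiable k f \<Longrightarrow> times_differentiable k g \<Longrightarrow> times_differentiable k (\<lambda>x. f x + g x)"
proof (induction k arbitrary: f g)
  case (Suc k)
  show ?case
    by (rule times_differentiable_SucI[OF has_derivative_add[OF times_differentiable_SucD(1)[OF Suc.prems(1)] times_differentiable_SucD(1)[OF Suc.prems(2)]]])
      (intro Suc.IH Suc.prems[THEN times_differentiable_SucD(2)])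
qed (auto intro: continuous_intros)

lemma times_differentiable_mult:
  fixes f g :: "'a::real_normed_vector \<Rightarrow> real"
  shows "times_differentiable k f \<Longrightarrow> times_differentiable k g \<Longrightarrow> times_differentiable k (\<lambda>x. f x * g x)"
proof (induction k arbitrary: f g)
  case (Suc k)
  show ?case
    by (rule times_differentiable_SucI[OF has_derivative_mult[OF times_differentiable_SucD(1)[OF Suc.prems(1)] times_differentiable_SucD(1)[OF Suc.prems(2)]]])
      (intro times_differentiable_add Suc.IH Suc.prems[THEN times_differentiable_SucD(2)]
        Suc.prems[THEN times_differentiable_Suc_imp])
qed (auto intro: continuous_intros)

lemma times_differentiable_bounded_linear:
  assumes "bounded_linear f"
  shows "times_differentiable k f"
proof (cases k)
  case 0
  then show ?thesis using assms by (simp add: linear_continuous_on)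
next
  case (Suc j)
  show ?thesis unfolding Suc
    by (rule times_differentiable_SucI[OF bounded_linear_imp_has_derivative[OF assms] times_differentiable_const])
qed

lemma times_differentiable_vec:
  fixes f :: "'n::finite \<Rightarrow> 'a::real_normed_vector \<Rightarrow> real"
  shows "(\<And>i. times_differentiable k (f i)) \<Longrightarrow> times_differentiable k (\<lambda>x. \<chi> i. f i x)"
proof (induction k arbitrary: f)
  case (Suc k)
  show ?case
  proof (rule times_differentiable_SucI)
    fix x
    have "((\<lambda>x. f i x) has_derivative frechet_derivative (f i) (at x)) (at x)" for i
      by (rule times_differentiable_SucD[OF Suc.prems])
    then have "((\<lambda>x. \<Sum>i\<in>UNIV. f i x *\<^sub>R axis i 1) has_derivative
        (\<lambda>h. \<Sum>i\<in>UNIV. frechet_derivative (f i) (at x) h *\<^sub>R axis i (1::real))) (at x)"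
      by (intro has_derivative_sum has_derivative_scaleR_left)
    moreover have "(\<Sum>i\<in>UNIV. a i *\<^sub>R axis i 1) = (\<chi> i. a i)" for a :: "'n \<Rightarrow> real"
      by (simp add: vec_eq_iff axis_def if_distrib cong: if_cong)
    ultimately show "((\<lambda>x. \<chi> i. f i x) has_derivative (\<lambda>h. \<chi> i. frechet_derivative (f i) (at x) h)) (at x)"
      by simp
  next
    fix v
    show "times_differentiable k (\<lambda>x. \<chi> i. frechet_derivative (f i) (at x) v)"
      by (intro Suc.IH times_differentiable_SucD(2)[OF Suc.prems])
  qed
qed (auto intro: continuous_on_vec_lambda)

text \<open>The exponent \<open>m\<close> closes the family under differentiation: the derivative is
  a combination of the members \<open>m + 2\<close> and \<open>m + 1\<close>. Smoothness then
  follows by a single induction for all \<open>m\<close>.\<close>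

definition cutoff_exp :: "nat \<Rightarrow> real \<Rightarrow> real"
  where "cutoff_exp m t = (if t \<le> 0 then 0 else (1 / t) ^ m * exp (- (1 / t)))"

lemma cutoff_exp_tendsto_0: "(cutoff_exp m \<longlongrightarrow> 0) (at 0)"
proof -
  have "((\<lambda>x. x ^ m / exp x) \<longlongrightarrow> (0::real)) at_top" by (rule tendsto_power_div_exp_0)
  then have "((\<lambda>t. (inverse t) ^ m / exp (inverse t)) \<longlongrightarrow> (0::real)) (at_right 0)"
    by (rule filterlim_compose[OF _ filterlim_inverse_at_top_right])
  then have "(cutoff_exp m \<longlongrightarrow> 0) (at_right 0)"
    by (rule Lim_transform_eventually)
      (auto simp: eventually_at_filter cutoff_exp_def exp_minus divide_inverse)
  moreover have "(cutoff_exp m \<longlongrightarrow> 0) (at_left 0)"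
    by (rule tendsto_eventually) (auto simp: eventually_at_filter cutoff_exp_def)
  ultimately show ?thesis by (simp add: filterlim_at_split)
qed

lemma has_derivative_cutoff_exp:
  "(cutoff_exp m has_real_derivative (cutoff_exp (m + 2) t - real m * cutoff_exp (m + 1) t)) (at t)"
proof -
  consider "t < 0" | "t = 0" | "t > 0" by linarith
  then show ?thesis
  proof cases
    case 1
    have "((\<lambda>_. 0) has_real_derivative 0) (at t)" by simp
    then have "(cutoff_exp m has_real_derivative 0) (at t)"
      by (rule has_field_derivative_transform_within_open[where S = "{..<0}"])
        (use 1 in \<open>auto simp: cutoff_exp_def\<close>)
    then show ?thesis using 1 by (simp add: cutoff_exp_def)
  next
    case 2
    \<comment> \<open>At 0 the difference quotient is the next member of the family, which tends to
      0.\<close>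
    have "((\<lambda>h. cutoff_exp m h / h) \<longlongrightarrow> 0) (at 0)"
      by (rule Lim_transform_eventually[OF cutoff_exp_tendsto_0[of "Suc m"]])
        (auto simp: eventually_at_filter cutoff_exp_def)
    then show ?thesis using 2 by (simp add: DERIV_def cutoff_exp_def)
  next
    case 3
    have d: "((\<lambda>t. 1 / t) has_real_derivative - ((1 / t)\<^sup>2)) (at t)"
      using 3 by (auto intro!: derivative_eq_intros simp: power2_eq_square)
    have "((\<lambda>t. (1 / t) ^ m * exp (- (1 / t))) has_real_derivative
        real m * ((1 / t) ^ (m - Suc 0) * - ((1 / t)\<^sup>2)) * exp (- (1 / t))
          + (exp (- (1 / t)) * - (- ((1 / t)\<^sup>2))) * (1 / t) ^ m) (at t)"
      using DERIV_mult[OF DERIV_power[OF d, of m] DERIV_fun_exp[OF DERIV_minus[OF d]]]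
      by (simp add: mult_ac)
    moreover have "real m * ((1 / t) ^ (m - Suc 0) * - ((1 / t)\<^sup>2)) * exp (- (1 / t))
          + (exp (- (1 / t)) * - (- ((1 / t)\<^sup>2))) * (1 / t) ^ m
        = cutoff_exp (m + 2) t - real m * cutoff_exp (m + 1) t"
      using 3 by (cases m) (simp_all add: cutoff_exp_def power_add power2_eq_square mult_ac)
    ultimately have "((\<lambda>t. (1 / t) ^ m * exp (- (1 / t))) has_real_derivative
        (cutoff_exp (m + 2) t - real m * cutoff_exp (m + 1) t)) (at t)" by simp
    then show ?thesis
      by (rule has_field_derivative_transform_within_open[where S = "{0<..}"])
        (use 3 in \<open>auto simp: cutoff_exp_def\<close>)
  qed
qed

lemma times_differentiable_cutoff_exp_comp:
  fixes u :: "'a::real_normed_vector \<Rightarrow> real"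
  assumes "\<And>k. times_differentiable k u"
  shows "times_differentiable k (\<lambda>x. cutoff_exp m (u x))"
proof (induction k arbitrary: m)
  case 0
  have "isCont (cutoff_exp m) t" for t by (rule DERIV_isCont[OF has_derivative_cutoff_exp])
  then have "continuous_on UNIV (cutoff_exp m)" by (simp add: continuous_at_imp_continuous_on)
  then show ?case using assms[of 0] by (auto intro: continuous_on_compose2)
next
  case (Suc k)
  show ?case
  proof (rule times_differentiable_SucI)
    fix x
    show "((\<lambda>x. cutoff_exp m (u x)) has_derivative
      (\<lambda>h. (cutoff_exp (m + 2) (u x) + (- real m) * cutoff_exp (m + 1) (u x)) * frechet_derivative u (at x) h)) (at x)"
      using has_derivative_compose[OF times_differentiable_SucD(1)[OF assms]
          has_derivative_cutoff_exp[of m "u x", unfolded has_field_derivative_def]] by simp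
  next
    fix v
    show "times_differentiable k (\<lambda>x. (cutoff_exp (m + 2) (u x) + (- real m) * cutoff_exp (m + 1) (u x)) * frechet_derivative u (at x) v)"
      by (intro times_differentiable_mult times_differentiable_add times_differentiable_const Suc.IH
          times_differentiable_SucD(2)[OF assms])
  qed
qed

text \<open>The squared norm keeps the argument of \<open>cutoff_exp\<close> smooth at the
  origin.\<close>

definition bump :: "real \<Rightarrow> 'a::euclidean_space \<Rightarrow> real"
  where "bump e x = cutoff_exp 0 (e\<^sup>2 - inner x x)"

lemma smooth_bump: "smooth (bump e :: 'a::euclidean_space \<Rightarrow> real)"
proof -
  have "times_differentiable k (\<lambda>x::'a. inner x x)" for k
  proof (cases k)
    case 0
    then show ?thesis by (auto intro: continuous_intros)
  next
    case (Suc j)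
    show ?thesis unfolding Suc
    proof (rule times_differentiable_SucI)
      fix x v :: 'a
      show "((\<lambda>x::'a. inner x x) has_derivative (\<lambda>h. 2 * inner h x)) (at x)"
        by (auto intro!: derivative_eq_intros simp: inner_commute)
      show "times_differentiable j (\<lambda>x. 2 * inner v x)"
        by (intro times_differentiable_bounded_linear bounded_linear_intros)
    qed
  qed
  then have "times_differentiable k (\<lambda>x::'a. e\<^sup>2 + (-1) * inner x x)" for k
    by (intro times_differentiable_add times_differentiable_mult times_differentiable_const)
  then have "times_differentiable k (\<lambda>x::'a. e\<^sup>2 - inner x x)" for k by simp
  then show ?thesis unfolding smooth_def bump_def by (intro allI times_differentiable_cutoff_exp_comp)
qed

lemma bump_nonneg: "0 \<le> bump e x"
  by (simp add: bump_def cutoff_exp_def)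

lemma bump_pos: "norm x < e \<Longrightarrow> 0 < bump e x"
  using power_strict_mono[of "norm x" e 2] by (simp add: bump_def cutoff_exp_def dot_square_norm)

lemma bump_eq_0: "0 \<le> e \<Longrightarrow> e \<le> norm x \<Longrightarrow> bump e x = 0"
  by (auto simp: bump_def cutoff_exp_def dot_square_norm power_mono)

lemma smooth_mult_left: "smooth f \<Longrightarrow> smooth (\<lambda>x. c * f x :: real)"
  unfolding smooth_def by (intro allI times_differentiable_mult times_differentiable_const) auto

lemma integrable_compact_support:
  fixes f :: "'a::euclidean_space \<Rightarrow> real"
  assumes "continuous_on UNIV f" "compact K" "\<And>x. x \<notin> K \<Longrightarrow> f x = 0"
  shows "integrable lborel f"
proof -
  have "integrable lborel (\<lambda>x. indicator K x *\<^sub>R f x)"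
    by (rule borel_integrable_compact[OF assms(2) continuous_on_subset[OF assms(1)]]) simp
  moreover have "(\<lambda>x. indicator K x *\<^sub>R f x) = f" using assms(3) by (force simp: indicator_def)
  ultimately show ?thesis by simp
qed

lemma exists_mollifier:
  fixes e :: real
  assumes "0 < e"
  obtains k :: "'a::euclidean_space \<Rightarrow> real" where "smooth k" "\<And>x. 0 \<le> k x"
    "\<And>x. e \<le> norm x \<Longrightarrow> k x = 0" "(LINT x|lborel. k x) = 1"
proof -
  let ?b = "bump e :: 'a \<Rightarrow> real"
  have c: "continuous_on UNIV ?b" using smooth_bump[of e] unfolding smooth_def
    by (metis times_differentiable.simps(1))
  have i: "integrable lborel ?b"
    by (rule integrable_compact_support[OF c compact_cball[of 0 e]]) (use assms in \<open>auto intro!: bump_eq_0\<close>)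
  have "(LINT x|lborel. ?b x) \<noteq> 0"
  proof
    assume "(LINT x|lborel. ?b x) = 0"
    then have "AE x in lborel. ?b x = 0"
      using integral_nonneg_eq_0_iff_AE[OF i] by (simp add: bump_nonneg)
    then have "AE x in lborel. x \<notin> ball (0::'a) e"
      by eventually_elim (use bump_pos in force)
    then have "emeasure lborel (ball (0::'a) e) = 0"
      by (subst (asm) AE_iff_measurable[OF _ refl]) (auto simp: ball_def)
    then show False using emeasure_ball[of e "0::'a"] assms unit_ball_vol_pos[of "real DIM('a)"]
      by (simp add: ennreal_eq_0_iff mult_le_0_iff) (metis assms not_le zero_less_power of_nat_0_le_iff unit_ball_vol_pos)
  qed
  moreover have "0 \<le> (LINT x|lborel. ?b x)" by (intro integral_nonneg_AE) (simp add: bump_nonneg)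
  ultimately have p: "0 < (LINT x|lborel. ?b x)" by simp
  show thesis
  proof (rule that[of "\<lambda>x. 1 / (LINT x|lborel. ?b x) * ?b x"])
    show "smooth (\<lambda>x. 1 / (LINT x|lborel. ?b x) * ?b x)" by (rule smooth_mult_left[OF smooth_bump])
    show "(LINT x|lborel. 1 / (LINT x|lborel. ?b x) * ?b x) = 1"
      using p by (subst integral_mult_right_zero) simp
  qed (use p assms in \<open>auto simp: bump_nonneg bump_eq_0\<close>)
qed

text \<open>If one of the points lies outside the ball of radius \<open>r + 1\<close>, then
  \<open>d \<le> 1\<close> puts both where \<open>g\<close> vanishes; otherwise both lie in a
  compact ball.\<close>

lemma uniformly_continuous_of_compact_support:
  fixes g :: "'a::euclidean_space \<Rightarrow> 'b::real_normed_vector"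
  assumes "continuous_on UNIV g" "\<And>z. r < norm z \<Longrightarrow> g z = 0" "0 < e"
  obtains d where "0 < d" "d \<le> 1" "\<And>z w. norm (w - z) < d \<Longrightarrow> norm (g w - g z) < e"
proof -
  have "uniformly_continuous_on (cball 0 (r + 2)) g"
    by (intro compact_uniformly_continuous continuous_on_subset[OF assms(1)]) auto
  then obtain d where d: "0 < d" "\<And>z w. z \<in> cball 0 (r + 2) \<Longrightarrow> w \<in> cball 0 (r + 2) \<Longrightarrow> dist w z < d \<Longrightarrow> dist (g w) (g z) < e"
    using assms(3) unfolding uniformly_continuous_on_def by metis
  show thesis
  proof (rule that[of "min d 1"])
    fix z w :: 'a assume zw: "norm (w - z) < min d 1"
    have tri: "norm w \<le> norm z + 1" "norm z \<le> norm w + 1"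
      using zw norm_triangle_sub[of w z] norm_triangle_sub[of z w] by (simp_all add: norm_minus_commute)
    show "norm (g w - g z) < e"
    proof (cases "norm z \<le> r + 1")
      case True
      then show ?thesis using d(2)[of z w] tri zw by (simp add: dist_norm)
    next
      case False
      then have "g z = 0" "g w = 0" using tri by (auto intro!: assms(2))
      then show ?thesis using assms(3) by simp
    qed
  qed (use d in auto)
qed

text \<open>The conclusion asks for a strict inequality because the derivative is computed in an
  open set on which \<open>k\<close> vanishes.\<close>

lemma frechet_derivative_eq_0_outside:
  assumes "\<And>z. r \<le> norm z \<Longrightarrow> k z = 0" "r < norm x"
  shows "frechet_derivative k (at x) v = 0"
proof -
  have "open {z. r < norm z}" by (rule open_Collect_less) (intro continuous_intros)+
  then have "(k has_derivative (\<lambda>_. 0)) (at x)"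
    by (rule has_derivative_transform_within_open[OF has_derivative_const[of 0]]) (use assms in auto)
  then show ?thesis by (simp flip: frechet_derivative_at)
qed

text \<open>The error is uniform in \<open>z\<close>, so the expansion can be integrated against
  \<open>\<phi>\<close>: this is what permits differentiation of a mollification under the integral
  sign.\<close>

lemma uniform_linear_approximation:
  fixes k :: "'a::euclidean_space \<Rightarrow> real"
  assumes k: "times_differentiable 1 k" "\<And>z. r \<le> norm z \<Longrightarrow> k z = 0" and e: "0 < e"
  obtains d where "0 < d" "d \<le> 1"
    "\<And>z h. norm h < d \<Longrightarrow> \<bar>k (z + h) - k z - frechet_derivative k (at z) h\<bar> \<le> e * norm h"
proof -
  let ?D = "\<lambda>z. frechet_derivative k (at z)"
  have der: "(k has_derivative ?D z) (at z)" for z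
    using k(1) times_differentiable_SucD(1)[of 0 k] by simp
  have lin: "linear (?D z)" for z using der has_derivative_linear by blast
  have cont: "continuous_on UNIV (\<lambda>z. ?D z b)" for b
    using k(1) times_differentiable_SucD(2)[of 0 k b] by simp
  have "\<exists>d>0. d \<le> 1 \<and> (\<forall>z w. norm (w - z) < d \<longrightarrow> norm (?D w b - ?D z b) < e / DIM('a))" for b
    by (rule uniformly_continuous_of_compact_support[OF cont[of b], of r "e / DIM('a)"])
      (use e frechet_derivative_eq_0_outside[of r k] k(2) in \<open>auto\<close>)
  then obtain \<delta> where \<delta>: "\<And>b. 0 < \<delta> b" "\<And>b. \<delta> b \<le> 1"
    "\<And>b z w. norm (w - z) < \<delta> b \<Longrightarrow> norm (?D w b - ?D z b) < e / DIM('a)" by metis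
  define d where "d = Min (\<delta> ` (Basis :: 'a set))"
  have d: "0 < d" "\<And>b. b \<in> Basis \<Longrightarrow> d \<le> \<delta> b" unfolding d_def using \<delta>(1) by auto
  have d1: "d \<le> 1" using d(2) \<delta>(2) SOME_Basis order_trans by blast
  have on: "\<bar>?D w h - ?D z h\<bar> \<le> e * norm h" if "norm (w - z) < d" for w z h
  proof -
    have l: "linear (\<lambda>h. ?D w h - ?D z h)" by (intro linear_compose_sub lin)
    have "?D w h - ?D z h = (\<Sum>b\<in>Basis. (h \<bullet> b) *\<^sub>R (?D w b - ?D z b))"
      using linear_sum[OF l, of "\<lambda>b. (h \<bullet> b) *\<^sub>R b" Basis] linear_cmul[OF l]
      by (simp add: euclidean_representation)
    also have "\<bar>\<dots>\<bar> \<le> (\<Sum>b\<in>Basis. \<bar>(h \<bullet> b) *\<^sub>R (?D w b - ?D z b)\<bar>)" by (rule sum_abs)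
    also have "\<dots> \<le> (\<Sum>b\<in>(Basis :: 'a set). norm h * (e / DIM('a)))"
    proof (rule sum_mono)
      fix b :: 'a assume b: "b \<in> Basis"
      have "norm (?D w b - ?D z b) < e / DIM('a)" using that d(2)[OF b] by (intro \<delta>(3)) simp
      then show "\<bar>(h \<bullet> b) *\<^sub>R (?D w b - ?D z b)\<bar> \<le> norm h * (e / DIM('a))"
        using Basis_le_norm[OF b, of h] by (simp add: abs_mult del: times_divide_eq_right) (intro mult_mono, auto)
    qed
    also have "\<dots> = e * norm h" by simp
    finally show ?thesis .
  qed
  show thesis
  proof (rule that[OF d(1) d1])
    fix z h :: 'a assume h: "norm h < d"
    have "norm (k (z + h) - k z - ?D z (z + h - z)) \<le> norm (z + h - z) * e"
    proof (rule differentiable_bound_linearization[where S = "ball z d"])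
      show "z + t *\<^sub>R (z + h - z) \<in> ball z d" if "t \<in> {0..1}" for t
        using that h mult_left_le_one_le[of "norm h" t] by (auto simp: dist_norm)
      show "(k has_derivative ?D x) (at x within ball z d)" for x
        by (rule has_derivative_at_withinI[OF der])
      show "onorm (?D x - ?D z) \<le> e" if "x \<in> ball z d" for x
        using on[of x z] that e by (intro onorm_le) (auto simp: dist_norm norm_minus_commute)
      show "z \<in> ball z d" using d by simp
    qed
    then show "\<bar>k (z + h) - k z - ?D z h\<bar> \<le> e * norm h" by (simp add: mult.commute)
  qed
qed

section \<open>Mollification of a continuous function\<close>

lemma lborel_integral_translation:
  fixes f :: "'a::euclidean_space \<Rightarrow> real"
  assumes "f \<in> borel_measurable borel"
  shows "(LINT y|lborel. f y) = (LINT z|lborel. f (c + z))"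
proof -
  have "(LINT y|lborel. f y) = (LINT y|distr lborel borel ((+) c). f y)"
    by (simp add: lborel_distr_plus)
  also have "\<dots> = (LINT z|lborel. f (c + z))" by (rule integral_distr) (use assms in simp_all)
  finally show ?thesis .
qed

text \<open>The variable \<open>x\<close> occurs in the kernel alone, so derivatives fall on
  \<open>k\<close>. With \<open>k (y - x)\<close> rather than \<open>k (x - y)\<close>, each
  derivative brings a minus sign, and \<open>k z\<close> weights the shifted value
  \<open>\<phi> (x + z)\<close>.\<close>

definition mollify :: "('a::euclidean_space \<Rightarrow> real) \<Rightarrow> ('a \<Rightarrow> real) \<Rightarrow> 'a \<Rightarrow> real"
  where "mollify k \<phi> x = (LINT y|lborel. \<phi> y * k (y - x))"

context
  fixes \<phi> :: "'a::euclidean_space \<Rightarrow> real"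
  assumes \<phi>: "continuous_on UNIV \<phi>"
begin

lemma mollify_integrable:
  assumes "continuous_on UNIV k" "\<And>z. r < norm z \<Longrightarrow> k z = 0"
  shows "integrable lborel (\<lambda>y. \<phi> y * k (y - x))"
proof (rule integrable_compact_support[of _ "cball x r"])
  show "continuous_on UNIV (\<lambda>y. \<phi> y * k (y - x))"
    by (intro continuous_intros \<phi> continuous_on_compose2[OF assms(1)]) auto
qed (auto intro!: assms(2) simp: dist_norm norm_minus_commute)

lemma mollify_translate:
  assumes "continuous_on UNIV k"
  shows "mollify k \<phi> x = (LINT z|lborel. \<phi> (x + z) * k z)"
proof -
  have "(\<lambda>y. \<phi> y * k (y - x)) \<in> borel_measurable borel"
    by (intro borel_measurable_continuous_onI continuous_intros \<phi> continuous_on_compose2[OF assms]) auto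
  then show ?thesis unfolding mollify_def by (subst lborel_integral_translation[where c = x]) simp_all
qed

lemma has_derivative_mollify:
  assumes k: "times_differentiable 1 k" "\<And>z. r \<le> norm z \<Longrightarrow> k z = 0" and "0 \<le> r"
  shows "(mollify k \<phi> has_derivative (\<lambda>v. mollify (\<lambda>z. - frechet_derivative k (at z) v) \<phi> x)) (at x)"
proof -
  let ?D = "\<lambda>z. frechet_derivative k (at z)"
  have der: "(k has_derivative ?D z) (at z)" for z
    using k(1) times_differentiable_SucD(1)[of 0 k] by simp
  have kc: "continuous_on UNIV k" using k(1) times_differentiable_Suc_imp[of 0 k] by simp
  have cont: "continuous_on UNIV (\<lambda>z. - ?D z b)" for b
    using k(1) times_differentiable_SucD(2)[of 0 k b] by (auto intro: continuous_intros)
  have D0: "- ?D z b = 0" if "r < norm z" for z b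
    using frechet_derivative_eq_0_outside[OF k(2) that] by simp
  have k0: "k z = 0" if "r < norm z" for z using k(2) that by simp
  have lin: "linear (?D z)" for z using der has_derivative_linear by blast
  have iD: "integrable lborel (\<lambda>y. \<phi> y * - ?D (y - x) b)" for x b
    by (rule mollify_integrable[OF cont D0])
  have ik: "integrable lborel (\<lambda>y. \<phi> y * k (y - x))" for x
    by (rule mollify_integrable[OF kc k0])
  have "linear (\<lambda>v. mollify (\<lambda>z. - ?D z v) \<phi> x)"
  proof (rule linearI)
    show "mollify (\<lambda>z. - ?D z (a + b)) \<phi> x = mollify (\<lambda>z. - ?D z a) \<phi> x + mollify (\<lambda>z. - ?D z b) \<phi> x" for a b
      unfolding mollify_def using iD
      by (subst Bochner_Integration.integral_add[symmetric]) (simp_all add: linear_add[OF lin] algebra_simps)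
    show "mollify (\<lambda>z. - ?D z (c *\<^sub>R b)) \<phi> x = c *\<^sub>R mollify (\<lambda>z. - ?D z b) \<phi> x" for c b
      unfolding mollify_def real_scaleR_def
      by (subst integral_mult_right_zero[symmetric]) (simp add: linear_cmul[OF lin] mult_ac)
  qed
  then have bl: "bounded_linear (\<lambda>v. mollify (\<lambda>z. - ?D z v) \<phi> x)"
    by (simp add: linear_conv_bounded_linear)
  \<comment> \<open>For \<open>x'\<close> within distance 1 of \<open>x\<close> both shifted kernels
    live in this larger ball. The later division by \<open>I + 1\<close> avoids the case
    \<open>I = 0\<close>.\<close>
  define I where "I = (LINT y:cball x (r + 1)|lborel. \<bar>\<phi> y\<bar>)"
  have Ii: "set_integrable lborel (cball x (r + 1)) (\<lambda>y. \<bar>\<phi> y\<bar>)"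
    by (intro set_integrable_compact compact_cball continuous_intros continuous_on_subset[OF \<phi>]) auto
  have I0: "0 \<le> I" unfolding I_def set_lebesgue_integral_def by (intro integral_nonneg_AE) auto
  show ?thesis unfolding has_derivative_at_alt
  proof (intro conjI bl allI impI)
    fix e :: real assume e: "0 < e"
    then have "0 < e / (I + 1)" using I0 by simp
    then obtain d where d: "0 < d" "d \<le> 1"
      "\<And>z h. norm h < d \<Longrightarrow> \<bar>k (z + h) - k z - ?D z h\<bar> \<le> e / (I + 1) * norm h"
      using uniform_linear_approximation[OF k] by metis
    show "\<exists>d>0. \<forall>y. norm (y - x) < d \<longrightarrow>
        norm (mollify k \<phi> y - mollify k \<phi> x - mollify (\<lambda>z. - ?D z (y - x)) \<phi> x) \<le> e * norm (y - x)"
    proof (intro exI[of _ d] conjI allI impI d(1))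
      fix x' assume x': "norm (x' - x) < d"
      let ?R = "\<lambda>y. \<phi> y * (k (y - x') - k (y - x) + ?D (y - x) (x' - x))"
      have eq: "mollify k \<phi> x' - mollify k \<phi> x - mollify (\<lambda>z. - ?D z (x' - x)) \<phi> x = (LINT y|lborel. ?R y)"
        unfolding mollify_def using ik[of x'] ik[of x] iD[of x "x' - x"]
        by (simp add: algebra_simps flip: Bochner_Integration.integral_diff Bochner_Integration.integral_add)
      have R: "norm (?R y) \<le> e / (I + 1) * norm (x' - x) * (indicator (cball x (r + 1)) y * \<bar>\<phi> y\<bar>)" for y
      proof (cases "y \<in> cball x (r + 1)")
        case True
        have "\<bar>k (y - x + (x - x')) - k (y - x) - ?D (y - x) (x - x')\<bar> \<le> e / (I + 1) * norm (x - x')"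
          using x' by (intro d(3)) (simp add: norm_minus_commute)
        moreover have "?D (y - x) (x - x') = - ?D (y - x) (x' - x)"
          using linear_neg[OF lin, of "y - x" "x' - x"] by simp
        ultimately have "\<bar>k (y - x') - k (y - x) + ?D (y - x) (x' - x)\<bar> \<le> e / (I + 1) * norm (x' - x)"
          by (simp add: norm_minus_commute)
        then have "\<bar>\<phi> y\<bar> * \<bar>k (y - x') - k (y - x) + ?D (y - x) (x' - x)\<bar> \<le> \<bar>\<phi> y\<bar> * (e / (I + 1) * norm (x' - x))"
          by (intro mult_left_mono) auto
        then show ?thesis using True by (simp add: abs_mult mult_ac)
      next
        case False
        then have n: "r + 1 < norm (y - x)" by (simp add: dist_norm norm_minus_commute)
        moreover have "norm (y - x) \<le> norm (y - x') + norm (x' - x)"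
          using norm_triangle_ineq[of "y - x'" "x' - x"] by simp
        ultimately have "r < norm (y - x')" using x' d(2) by linarith
        then have "?R y = 0" using n k0 frechet_derivative_eq_0_outside[OF k(2), where x = "y - x"] by simp
        then show ?thesis using False by simp
      qed
      have "norm (LINT y|lborel. ?R y) \<le> (LINT y|lborel. e / (I + 1) * norm (x' - x) * (indicator (cball x (r + 1)) y * \<bar>\<phi> y\<bar>))"
      proof (rule Bochner_Integration.integral_norm_bound_integral)
        show "integrable lborel ?R"
          using ik[of x'] ik[of x] iD[of x "x' - x"]
          by (simp add: algebra_simps)
        show "integrable lborel (\<lambda>y. e / (I + 1) * norm (x' - x) * (indicator (cball x (r + 1)) y * \<bar>\<phi> y\<bar>))"
          using Ii unfolding set_integrable_def by simp
      qed (rule R)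
      also have "\<dots> = e / (I + 1) * norm (x' - x) * I"
        unfolding I_def set_lebesgue_integral_def by simp
      also have "\<dots> = e * norm (x' - x) * (I / (I + 1))" by simp
      also have "\<dots> \<le> e * norm (x' - x) * 1" using I0 e by (intro mult_left_mono) auto
      finally show "norm (mollify k \<phi> x' - mollify k \<phi> x - mollify (\<lambda>z. - ?D z (x' - x)) \<phi> x) \<le> e * norm (x' - x)"
        unfolding eq by simp
    qed
  qed
qed

lemma times_differentiable_mollify:
  assumes "smooth k" "\<And>z. r \<le> norm z \<Longrightarrow> k z = 0" "0 \<le> r"
  shows "times_differentiable j (mollify k \<phi>)"
  using assms
proof (induction j arbitrary: k r)
  case 0
  then have "times_differentiable 1 k" by (simp only: smooth_def)
  from has_derivative_mollify[OF this 0(2,3)] show ?case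
    by (auto simp: continuous_on_eq_continuous_at intro: has_derivative_continuous)
next
  case (Suc j)
  then have k1: "times_differentiable 1 k" by (simp only: smooth_def)
  show ?case
  proof (rule times_differentiable_SucI[OF has_derivative_mollify[OF k1 Suc.prems(2,3)]], assumption)
    fix v
    show "times_differentiable j (mollify (\<lambda>z. - frechet_derivative k (at z) v) \<phi>)"
    proof (rule Suc.IH)
      have "times_differentiable i (\<lambda>z. (-1) * frechet_derivative k (at z) v)" for i
        using Suc.prems(1) unfolding smooth_def
        by (intro times_differentiable_mult times_differentiable_const times_differentiable_SucD(2)) blast
      then show "smooth (\<lambda>z. - frechet_derivative k (at z) v)" by (simp add: smooth_def)
      \<comment> \<open>The radius grows at each differentiation: the derivative is known to vanish
        where \<open>r < norm z\<close>, while the induction hypothesis asks for a non-strict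
        inequality.\<close>
      show "- frechet_derivative k (at z) v = 0" if "r + 1 \<le> norm z" for z
        using frechet_derivative_eq_0_outside[OF Suc.prems(2), where x = z and v = v] that by simp
    qed (use Suc.prems in simp)
  qed
qed

text \<open>A second difference of the average is the average of the shifted second differences, and
  a nonnegative kernel of mass one preserves their common lower bound.\<close>

lemma sum_second_difference_mollify_ge:
  assumes k: "continuous_on UNIV k" "\<And>z. 0 \<le> k z" "\<And>z. r < norm z \<Longrightarrow> k z = 0" "(LINT z|lborel. k z) = 1"
    and b: "\<And>z. norm z \<le> r \<Longrightarrow> c \<le> (\<Sum>i\<in>I. second_difference \<phi> (v i) (x + z))"
  shows "c \<le> (\<Sum>i\<in>I. second_difference (mollify k \<phi>) (v i) x)"
proof -
  have i: "integrable lborel (\<lambda>z. \<phi> (y + z) * k z)" for y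
    by (rule integrable_compact_support[of _ "cball 0 r"])
      (auto intro!: continuous_intros continuous_on_compose2[OF \<phi>] k)
  have ik: "integrable lborel k"
    by (rule integrable_compact_support[of _ "cball 0 r"]) (auto intro!: k)
  have eq: "second_difference \<phi> v (x + z) * k z = \<phi> (x + v + z) * k z + \<phi> (x - v + z) * k z - 2 * (\<phi> (x + z) * k z)" for v z
    by (simp add: second_difference_def algebra_simps)
  have sdi: "integrable lborel (\<lambda>z. second_difference \<phi> v (x + z) * k z)" for v
    unfolding eq using i by simp
  have m: "second_difference (mollify k \<phi>) v x = (LINT z|lborel. second_difference \<phi> v (x + z) * k z)" for v
    unfolding second_difference_def[of "mollify k \<phi>"] mollify_translate[OF k(1)] eq using i by simp
  have "c = (LINT z|lborel. c * k z)" using k(4) by simp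
  also have "\<dots> \<le> (LINT z|lborel. (\<Sum>i\<in>I. second_difference \<phi> (v i) (x + z) * k z))"
  proof (rule integral_mono)
    fix z
    show "c * k z \<le> (\<Sum>i\<in>I. second_difference \<phi> (v i) (x + z) * k z)"
    proof (cases "norm z \<le> r")
      case True
      then show ?thesis unfolding sum_distrib_right[symmetric] by (intro mult_right_mono b k(2))
    qed (simp add: k(3))
  qed (use sdi ik in auto)
  also have "\<dots> = (\<Sum>i\<in>I. second_difference (mollify k \<phi>) (v i) x)"
    unfolding m using sdi by (intro Bochner_Integration.integral_sum)
  finally show ?thesis .
qed

lemma mollify_lipschitz:
  assumes k: "continuous_on UNIV k" "\<And>z. 0 \<le> k z" "\<And>z. r < norm z \<Longrightarrow> k z = 0" "(LINT z|lborel. k z) = 1"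
    and b: "\<And>x y. \<bar>\<phi> x - \<phi> y\<bar> \<le> R * norm (x - y)"
  shows "\<bar>mollify k \<phi> x - mollify k \<phi> y\<bar> \<le> R * norm (x - y)"
proof -
  have i: "integrable lborel (\<lambda>z. \<phi> (y + z) * k z)" for y
    by (rule integrable_compact_support[of _ "cball 0 r"])
      (auto intro!: continuous_intros continuous_on_compose2[OF \<phi>] k)
  have ik: "integrable lborel k"
    by (rule integrable_compact_support[of _ "cball 0 r"]) (auto intro!: k)
  have "mollify k \<phi> x - mollify k \<phi> y = (LINT z|lborel. \<phi> (x + z) * k z - \<phi> (y + z) * k z)"
    unfolding mollify_translate[OF k(1)] using i by simp
  also have "norm \<dots> \<le> (LINT z|lborel. R * norm (x - y) * k z)"
  proof (rule Bochner_Integration.integral_norm_bound_integral)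
    fix z
    have "\<bar>\<phi> (x + z) - \<phi> (y + z)\<bar> * k z \<le> R * norm (x - y) * k z"
      using b[of "x + z" "y + z"] k(2) by (intro mult_right_mono) auto
    then show "norm (\<phi> (x + z) * k z - \<phi> (y + z) * k z) \<le> R * norm (x - y) * k z"
      using k(2)[of z] by (simp add: abs_mult flip: left_diff_distrib)
  qed (use i ik in auto)
  also have "\<dots> = R * norm (x - y)" using k(4) by simp
  finally show ?thesis by simp
qed

end

section \<open>Smooth subsolutions of the Monge-Ampere equation\<close>

text \<open>If the Hessian sum were below \<open>\<kappa>\<close>, then for an intermediate
  \<open>\<kappa>'\<close> the sum of second differences minus \<open>\<kappa>' * r\<^sup>2\<close>
  would be nonincreasing near 0, which contradicts the lower bound at a small \<open>r0\<close>. The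
  second derivative enters as the derivative at one point of the gradient
  \<open>\<psi>\<close>.\<close>

lemma second_difference_lower_imp_hessian:
  fixes u :: "real^'n \<Rightarrow> real"
  assumes u: "\<And>x. (u has_derivative (\<lambda>v. inner (\<psi> x) v)) (at x)"
    and \<psi>: "(\<psi> has_derivative (\<lambda>v. H *v v)) (at x)"
    and \<rho>: "0 < \<rho>" "\<And>r. 0 < r \<Longrightarrow> r < \<rho> \<Longrightarrow> \<kappa> * r\<^sup>2 \<le> (\<Sum>i\<in>I. second_difference u (r *\<^sub>R v i) x)"
  shows "\<kappa> \<le> (\<Sum>i\<in>I. inner (v i) (H *v v i))"
proof (rule ccontr)
  let ?S = "\<Sum>i\<in>I. inner (v i) (H *v v i)"
  assume "\<not> \<kappa> \<le> ?S"
  then obtain \<kappa>' where \<kappa>': "?S < \<kappa>'" "\<kappa>' < \<kappa>" using dense not_le by blast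
  \<comment> \<open>The derivative in \<open>r\<close> of the sum of second differences with step
    \<open>r\<close>; its own derivative at 0 is twice the Hessian sum.\<close>
  define g where "g r = (\<Sum>i\<in>I. inner (\<psi> (x + r *\<^sub>R v i)) (v i) - inner (\<psi> (x - r *\<^sub>R v i)) (v i))" for r :: real
  have \<psi>': "((\<lambda>r. \<psi> (x + r *\<^sub>R w)) has_derivative (\<lambda>t. H *v (t *\<^sub>R w))) (at 0)" for w
    by (rule has_derivative_compose[where f = "\<lambda>r. x + r *\<^sub>R w" and g = \<psi>])
      (auto intro!: derivative_eq_intros \<psi>)
  have gd: "(g has_real_derivative 2 * ?S) (at 0)"
  proof -
    have "((\<lambda>r. inner (\<psi> (x + r *\<^sub>R v i)) (v i) - inner (\<psi> (x + r *\<^sub>R (- v i))) (v i)) has_derivative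
       (\<lambda>t. inner (H *v (t *\<^sub>R v i)) (v i) - inner (H *v (t *\<^sub>R (- v i))) (v i))) (at 0)" for i
      by (intro has_derivative_diff has_derivative_inner_left \<psi>')
    then have "(g has_derivative (\<lambda>t. \<Sum>i\<in>I. inner (H *v (t *\<^sub>R v i)) (v i) - inner (H *v (t *\<^sub>R (- v i))) (v i))) (at 0)"
      unfolding g_def by (intro has_derivative_sum) simp
    moreover have "(\<lambda>t. \<Sum>i\<in>I. inner (H *v (t *\<^sub>R v i)) (v i) - inner (H *v (t *\<^sub>R (- v i))) (v i)) = (*) (2 * ?S)"
    proof
      fix t :: real
      have neg: "H *v (- w) = - (H *v w)" for w
        using linear_neg[OF matrix_vector_mul_linear, of H w] by simp
      have "inner (H *v (t *\<^sub>R v i)) (v i) - inner (H *v (t *\<^sub>R (- v i))) (v i) = 2 * t * inner (v i) (H *v v i)" for i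
        by (simp add: matrix_vector_mult_scaleR neg inner_commute)
      then show "(\<Sum>i\<in>I. inner (H *v (t *\<^sub>R v i)) (v i) - inner (H *v (t *\<^sub>R (- v i))) (v i)) = 2 * ?S * t"
        by (simp add: sum_distrib_left sum_distrib_right mult_ac)
    qed
    ultimately show ?thesis by (simp add: has_field_derivative_def)
  qed
  have g0: "g 0 = 0" by (simp add: g_def)
  have "((\<lambda>r. g r / r) \<longlongrightarrow> 2 * ?S) (at 0)" using gd g0 by (simp add: DERIV_def)
  then have "\<forall>\<^sub>F r in at 0. g r / r < 2 * \<kappa>'" by (rule order_tendstoD) (use \<kappa>' in simp)
  then obtain \<delta> where \<delta>: "0 < \<delta>" "\<And>r. r \<noteq> 0 \<Longrightarrow> \<bar>r\<bar> < \<delta> \<Longrightarrow> g r / r < 2 * \<kappa>'"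
    unfolding eventually_at by (auto simp: dist_real_def)
  define r0 where "r0 = min \<delta> \<rho> / 2"
  have r0: "0 < r0" "r0 < \<delta>" "r0 < \<rho>" using \<delta>(1) \<rho>(1) by (auto simp: r0_def)
  define F where "F r = (\<Sum>i\<in>I. second_difference u (r *\<^sub>R v i) x) - \<kappa>' * r\<^sup>2" for r :: real
  have Fd: "(F has_real_derivative (g r - 2 * \<kappa>' * r)) (at r)" for r
  proof -
    have ud: "((\<lambda>r. u (x + r *\<^sub>R w)) has_derivative (\<lambda>t. inner (\<psi> (x + r *\<^sub>R w)) (t *\<^sub>R w))) (at r)" for w
      by (rule has_derivative_compose[where f = "\<lambda>r. x + r *\<^sub>R w" and g = u])
        (auto intro!: derivative_eq_intros u)
    have "((\<lambda>r. u (x + r *\<^sub>R v i) + u (x + r *\<^sub>R (- v i)) - 2 * u x) has_derivative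
        (\<lambda>t. inner (\<psi> (x + r *\<^sub>R v i)) (t *\<^sub>R v i) + inner (\<psi> (x + r *\<^sub>R (- v i))) (t *\<^sub>R (- v i)) - 0)) (at r)" for i
      by (intro has_derivative_diff has_derivative_add ud has_derivative_const)
    then have "((\<lambda>r. \<Sum>i\<in>I. second_difference u (r *\<^sub>R v i) x) has_derivative
        (\<lambda>t. \<Sum>i\<in>I. inner (\<psi> (x + r *\<^sub>R v i)) (t *\<^sub>R v i) + inner (\<psi> (x + r *\<^sub>R (- v i))) (t *\<^sub>R (- v i)) - 0)) (at r)"
      unfolding second_difference_def by (intro has_derivative_sum) simp
    moreover have "(\<lambda>t. \<Sum>i\<in>I. inner (\<psi> (x + r *\<^sub>R v i)) (t *\<^sub>R v i) + inner (\<psi> (x + r *\<^sub>R (- v i))) (t *\<^sub>R (- v i)) - 0) = (*) (g r)"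
      by (rule ext) (simp add: g_def sum_distrib_left right_diff_distrib mult.commute)
    ultimately have "((\<lambda>r. \<Sum>i\<in>I. second_difference u (r *\<^sub>R v i) x) has_real_derivative g r) (at r)"
      by (simp add: has_field_derivative_def)
    moreover have "((\<lambda>r. \<kappa>' * r\<^sup>2) has_real_derivative \<kappa>' * (2 * r)) (at r)"
      by (auto intro!: derivative_eq_intros)
    ultimately show ?thesis unfolding F_def by (auto dest: DERIV_diff simp: mult_ac)
  qed
  have "F r0 \<le> F 0"
  proof (rule DERIV_nonpos_imp_nonincreasing[where f = F and a = 0 and b = r0])
    fix r assume r: "0 \<le> r" "r \<le> r0"
    have "g r - 2 * \<kappa>' * r \<le> 0"
    proof (cases "r = 0")
      case False
      then have "g r / r < 2 * \<kappa>'" using r r0 by (intro \<delta>(2)) auto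
      then show ?thesis using False r by (simp add: field_simps)
    qed (simp add: g0)
    then show "\<exists>y. (F has_real_derivative y) (at r) \<and> y \<le> 0" using Fd by blast
  qed (use r0 in simp)
  also have "F 0 = 0" by (simp add: F_def second_difference_def)
  finally have "\<kappa> * r0\<^sup>2 \<le> \<kappa>' * r0\<^sup>2" using \<rho>(2)[OF r0(1,3)] by (simp add: F_def)
  then show False using \<kappa>' r0 by simp
qed

lemma linear_functional_eq_inner:
  fixes f :: "real^'n \<Rightarrow> real"
  assumes "linear f"
  shows "f v = inner (\<chi> i. f (axis i 1)) v"
proof -
  have "v = (\<Sum>i\<in>UNIV. v$i *\<^sub>R axis i 1)"
    by (simp add: vec_eq_iff axis_def if_distrib cong: if_cong)
  then have "f v = f (\<Sum>i\<in>UNIV. v$i *\<^sub>R axis i 1)" by (rule arg_cong)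
  also have "\<dots> = (\<Sum>i\<in>UNIV. v$i * f (axis i 1))"
    by (simp add: linear_sum[OF assms] linear_cmul[OF assms])
  finally show ?thesis by (simp add: inner_vec_def mult.commute)
qed

text \<open>Along the gradient \<open>p\<close> itself the difference quotients tend to
  \<open>inner p p\<close> and are bounded by \<open>R * norm p\<close>.\<close>

lemma norm_gradient_le:
  fixes u :: "'a::real_inner \<Rightarrow> real"
  assumes d: "(u has_derivative (\<lambda>v. inner p v)) (at x)"
    and l: "\<And>y. \<bar>u y - u x\<bar> \<le> R * norm (y - x)" and R: "0 \<le> R"
  shows "norm p \<le> R"
proof (cases "p = 0")
  case True
  then show ?thesis using R by simp
next
  case False
  have "((\<lambda>r. u (x + r *\<^sub>R p)) has_derivative (\<lambda>t. inner p (t *\<^sub>R p))) (at 0)"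
    by (rule has_derivative_compose[where f = "\<lambda>r. x + r *\<^sub>R p" and g = u])
      (auto intro!: derivative_eq_intros d)
  then have "((\<lambda>r. u (x + r *\<^sub>R p)) has_real_derivative inner p p) (at 0)"
    by (simp add: has_field_derivative_def mult_commute_abs)
  then have "((\<lambda>r. (u (x + r *\<^sub>R p) - u x) / r) \<longlongrightarrow> inner p p) (at 0)" by (simp add: DERIV_def)
  moreover have "(u (x + r *\<^sub>R p) - u x) / r \<le> R * norm p" if r: "r \<noteq> 0" for r
  proof -
    have "(u (x + r *\<^sub>R p) - u x) / r \<le> \<bar>u (x + r *\<^sub>R p) - u x\<bar> / \<bar>r\<bar>"
      by (metis abs_divide abs_ge_self)
    also have "\<dots> \<le> R * norm (r *\<^sub>R p) / \<bar>r\<bar>" using l[of "x + r *\<^sub>R p"] by (intro divide_right_mono) auto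
    also have "\<dots> = R * norm p" using r by simp
    finally show "(u (x + r *\<^sub>R p) - u x) / r \<le> R * norm p" .
  qed
  then have "\<forall>\<^sub>F r in at 0. (u (x + r *\<^sub>R p) - u x) / r \<le> R * norm p"
    by (auto simp: eventually_at_filter)
  ultimately have "inner p p \<le> R * norm p" by (intro tendsto_upperbound[of _ _ "at (0::real)"]) auto
  then show ?thesis using False by (simp add: dot_square_norm power2_eq_square)
qed

text \<open>The Alexandrov solution of \<open>det D\<^sup>2 \<phi> = h ^ d\<close> is not smooth; only its second differences
  are bounded below, up to a dimensional constant, and averaging preserves this bound.\<close>

lemma exists_smooth_monge_ampere_subsolution:
  fixes h :: "real^'n \<Rightarrow> real"
  defines "d \<equiv> CARD('n)"
  assumes h: "continuous_on (cball 0 2) h" "\<And>x. x \<in> cball 0 2 \<Longrightarrow> 0 \<le> h x"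
    and R: "R = root d ((LINT x:cball 0 2|lborel. h x ^ d) / unit_ball_vol (real d))"
    and e: "0 < e"
  shows "\<exists>\<psi> :: real^'n \<Rightarrow> real^'n. smooth \<psi> \<and> (\<forall>x. norm (\<psi> x) \<le> R) \<and>
    (\<forall>x\<in>ball 0 1. \<forall>V::real^'n^'n. root d (det (transpose V ** V)) * max 0 (h x - e)
        \<le> 16 * real d ^ 2 * (\<Sum>i\<in>UNIV. inner (V$i) (jacobian \<psi> (at x) *v V$i)))"
proof -
  let ?X = "cball (0::real^'n) 2"
  have d0: "0 < d" by (simp add: d_def)
  define w where "w x = h x ^ d" for x
  have w: "continuous_on ?X w" "\<And>x. x \<in> ?X \<Longrightarrow> 0 \<le> w x"
    unfolding w_def by (auto intro!: continuous_intros h simp: h(2))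
  have M0: "0 \<le> (LINT x:?X|lborel. w x)"
    unfolding set_lebesgue_integral_def using w(2) by (intro integral_nonneg_AE) (auto simp: indicator_def)
  have vol: "0 < unit_ball_vol (real d)" by simp
  have R0: "0 \<le> R" unfolding R using M0 vol d0 by (simp add: w_def)
  \<comment> \<open>The radius makes the volume of the target equal to the mass of
    \<open>h ^ d\<close>. The potential has its slopes in this ball, whence the bound
    \<open>R\<close> on \<open>\<psi>\<close>.\<close>
  let ?Y = "cball (0::real^'n) R"
  have bal: "(LINT x:?X|lborel. w x) = measure lborel ?Y"
  proof -
    have "R ^ d = (LINT x:?X|lborel. w x) / unit_ball_vol (real d)"
      unfolding R w_def[symmetric] using M0 vol d0 by (intro real_root_pow_pos2) auto
    then have "measure lborel ?Y = (LINT x:?X|lborel. w x)"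
      using content_cball[OF R0, of "0::real^'n"] less_imp_neq[OF vol] by (simp add: d_def)
    then show ?thesis ..
  qed
  have Y: "compact ?Y" "?Y \<noteq> {}" using R0 by auto
  obtain \<psi>0 where \<psi>0: "continuous_on ?Y \<psi>0"
    "\<And>u. continuous_on ?X u \<Longrightarrow> transport_dual ?X ?Y w (conj_on ?Y \<psi>0) \<le> transport_dual ?X ?Y w u"
    by (rule transport_dual_minimiser[OF compact_cball _ Y w bal]) auto
  define \<phi> where "\<phi> = conj_on ?Y \<psi>0"
  have \<phi>c: "continuous_on UNIV \<phi>" unfolding \<phi>_def by (rule continuous_on_conj_on[OF Y \<psi>0(1)])
  have \<phi>l: "\<bar>\<phi> x - \<phi> y\<bar> \<le> R * norm (x - y)" for x y
    unfolding \<phi>_def by (rule conj_on_lipschitz[OF Y \<psi>0(1)]) simp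
  have "uniformly_continuous_on ?X h" by (intro compact_uniformly_continuous h compact_cball)
  then obtain \<delta>0 where \<delta>0: "0 < \<delta>0" "\<And>x y. x \<in> ?X \<Longrightarrow> y \<in> ?X \<Longrightarrow> dist y x < \<delta>0 \<Longrightarrow> dist (h y) (h x) < e"
    using e unfolding uniformly_continuous_on_def by metis
  \<comment> \<open>A point of the unit ball is moved by at most \<open>\<delta>\<close> by the
    mollifier and once more by less than \<open>\<delta>\<close> inside the cross-polytope. The
    total must stay in \<open>?X\<close>, whose radius 2 leaves this room, and below the modulus
    \<open>\<delta>0\<close> of continuity of \<open>h\<close>.\<close>
  define \<delta> where "\<delta> = min (\<delta>0 / 4) (1 / 2)"
  have \<delta>: "0 < \<delta>" "\<delta> \<le> 1 / 2" "2 * \<delta> < \<delta>0" using \<delta>0(1) by (auto simp: \<delta>_def)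
  obtain k :: "real^'n \<Rightarrow> real" where k: "smooth k" "\<And>x. 0 \<le> k x" "\<And>x. \<delta> \<le> norm x \<Longrightarrow> k x = 0" "(LINT x|lborel. k x) = 1"
    using exists_mollifier[OF \<delta>(1), where 'a = "real^'n"] by metis
  have k1: "times_differentiable 1 k" using k(1) by (simp only: smooth_def)
  have kc: "continuous_on UNIV k" using k(1) unfolding smooth_def by (metis times_differentiable.simps(1))
  have k3: "\<delta> < norm z \<Longrightarrow> k z = 0" for z using k(3) by simp
  let ?u = "mollify k \<phi>"
  let ?D = "\<lambda>x v. mollify (\<lambda>z. - frechet_derivative k (at z) v) \<phi> x"
  define \<psi> where "\<psi> x = (\<chi> i. ?D x (axis i 1))" for x
  have ud: "(?u has_derivative ?D x) (at x)" for x
    by (rule has_derivative_mollify[OF \<phi>c k1 k(3)]) (use \<delta> in auto)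
  have ud': "(?u has_derivative (\<lambda>v. inner (\<psi> x) v)) (at x)" for x
  proof -
    have "?D x = (\<lambda>v. inner (\<psi> x) v)"
      unfolding \<psi>_def by (rule ext) (rule linear_functional_eq_inner[OF has_derivative_linear[OF ud]])
    then show ?thesis using ud[of x] by simp
  qed
  have sm: "smooth \<psi>" unfolding smooth_def \<psi>_def
  proof (intro allI times_differentiable_vec times_differentiable_mollify[OF \<phi>c])
    fix i
    have "times_differentiable j (\<lambda>z. (-1) * frechet_derivative k (at z) (axis i 1))" for j
      using k(1) unfolding smooth_def
      by (intro times_differentiable_mult times_differentiable_const times_differentiable_SucD(2)) blast
    then show "smooth (\<lambda>z. - frechet_derivative k (at z) (axis i 1))" by (simp add: smooth_def)
    show "- frechet_derivative k (at z) (axis i 1) = 0" if "\<delta> + 1 \<le> norm z" for z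
      using frechet_derivative_eq_0_outside[OF k(3), where x = z] that by simp
    show "0 \<le> \<delta> + 1" using \<delta> by simp
  qed
  have ul: "\<bar>?u x - ?u y\<bar> \<le> R * norm (x - y)" for x y
    by (rule mollify_lipschitz[OF \<phi>c kc k(2) k3 k(4) \<phi>l])
  have \<psi>R: "norm (\<psi> x) \<le> R" for x
    by (rule norm_gradient_le[OF ud' ul R0])
  have main: "root d (det (transpose V ** V)) * max 0 (h x - e)
        \<le> 16 * real d ^ 2 * (\<Sum>i\<in>UNIV. inner (V$i) (jacobian \<psi> (at x) *v V$i))"
    if x: "x \<in> ball 0 1" for x and V :: "real^'n^'n"
  proof -
    define a where "a = max 0 (h x - e)"
    \<comment> \<open>\<open>16 d^2\<close> is twice the \<open>8 d^2\<close> of the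
      second-difference estimate: the factor 2 outside the power is moved inside by
      \<open>2 \<le> 2 ^ d\<close> before taking the \<open>d\<close>-th root.\<close>
    define \<kappa> where "\<kappa> = root d ((det V)\<^sup>2) * a / (16 * real d ^ 2)"
    have "\<psi> differentiable (at x)" using sm unfolding smooth_def by (metis times_differentiable.simps(2))
    then have \<psi>d: "(\<psi> has_derivative (\<lambda>v. jacobian \<psi> (at x) *v v)) (at x)" by (simp add: jacobian_works)
    \<comment> \<open>The estimate is applied to the rows of \<open>r *\<^sub>R V\<close>. The
      squared determinant then carries \<open>r ^ (2 d)\<close>, and its \<open>d\<close>-th root
      the factor \<open>r\<^sup>2\<close> proper to second differences.\<close>
    have sd: "\<kappa> * r\<^sup>2 \<le> (\<Sum>i\<in>UNIV. second_difference \<phi> (r *\<^sub>R V$i) (x + z))"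
      if z: "norm z \<le> \<delta>" and r: "0 < r" "r < \<delta> / (1 + (\<Sum>i\<in>UNIV. norm (V$i)))" for z r
    proof -
      let ?s = "\<Sum>i\<in>UNIV. second_difference \<phi> ((r *\<^sub>R V)$i) (x + z)"
      have P: "x + z + y v* (r *\<^sub>R V) \<in> ?X \<and> a ^ d \<le> w (x + z + y v* (r *\<^sub>R V))"
        if y: "(\<Sum>i\<in>UNIV. \<bar>y$i\<bar>) \<le> 1" for y
      proof -
        have y1: "\<bar>y$i\<bar> \<le> 1" for i using member_le_sum[of i UNIV "\<lambda>i. \<bar>y$i\<bar>"] y by simp
        have "y v* (r *\<^sub>R V) = (\<Sum>i\<in>UNIV. y$i *\<^sub>R (r *\<^sub>R V$i))"
          by (simp add: vec_eq_iff vector_matrix_mult_def mult_ac)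
        also have "norm \<dots> \<le> (\<Sum>i\<in>UNIV. r * norm (V$i))"
          using y1 r(1) by (intro sum_norm_le) (auto simp: abs_mult mult_left_le_one_le)
        also have "\<dots> = r * (\<Sum>i\<in>UNIV. norm (V$i))" by (simp add: sum_distrib_left)
        also have "\<dots> \<le> r * (1 + (\<Sum>i\<in>UNIV. norm (V$i)))" using r(1) by (intro mult_left_mono) auto
        also have "\<dots> < \<delta>" using r(2) by (simp add: pos_less_divide_eq sum_nonneg add_pos_nonneg)
        finally have n: "norm (y v* (r *\<^sub>R V)) < \<delta>" .
        have n2: "norm (z + y v* (r *\<^sub>R V)) < 2 * \<delta>"
          using norm_triangle_ineq[of z "y v* (r *\<^sub>R V)"] z n by linarith
        then have inX: "x + z + y v* (r *\<^sub>R V) \<in> ?X"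
          using norm_triangle_ineq[of x "z + y v* (r *\<^sub>R V)"] x \<delta>(2) by (simp add: add.assoc)
        have "dist (h (x + z + y v* (r *\<^sub>R V))) (h x) < e"
          using inX x n2 \<delta>(3) by (intro \<delta>0(2)) (auto simp: dist_norm add.assoc)
        then have "h x - e \<le> h (x + z + y v* (r *\<^sub>R V))" by (simp add: dist_real_def)
        then have "a \<le> h (x + z + y v* (r *\<^sub>R V))" using h(2)[OF inX] by (simp add: a_def)
        then show ?thesis using inX unfolding w_def by (auto intro!: power_mono simp: a_def)
      qed
      have s0: "0 \<le> ?s"
        unfolding \<phi>_def by (intro sum_nonneg second_difference_conj_on_nonneg[OF Y \<psi>0(1)])
      have "a ^ d * (det (r *\<^sub>R V))\<^sup>2 \<le> 2 * (8 * real d ^ 2 * ?s) ^ d"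
        unfolding d_def
        by (rule transport_dual_second_difference[OF compact_cball Y w \<psi>0(1) \<phi>_def _ P[unfolded d_def]])
          (use \<psi>0(2) in \<open>auto simp: \<phi>_def a_def\<close>)
      also have "2 * (8 * real d ^ 2 * ?s) ^ d \<le> 2 ^ d * (8 * real d ^ 2 * ?s) ^ d"
      proof (rule mult_right_mono)
        show "(2::real) \<le> 2 ^ d" using d0 by (intro self_le_power) auto
        show "0 \<le> (8 * real d ^ 2 * ?s) ^ d" by (intro zero_le_power mult_nonneg_nonneg s0) auto
      qed
      also have "\<dots> = (2 * (8 * real d ^ 2 * ?s)) ^ d" by (rule power_mult_distrib[symmetric])
      also have "2 * (8 * real d ^ 2 * ?s) = 16 * real d ^ 2 * ?s" by simp
      finally have "root d (a ^ d * (det (r *\<^sub>R V))\<^sup>2) \<le> root d ((16 * real d ^ 2 * ?s) ^ d)"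
        by (rule real_root_le_mono[OF d0])
      also have "\<dots> = 16 * real d ^ 2 * ?s"
        by (intro real_root_power_cancel d0 mult_nonneg_nonneg s0) auto
      also have "root d (a ^ d * (det (r *\<^sub>R V))\<^sup>2) = a * root d ((det (r *\<^sub>R V))\<^sup>2)"
        unfolding real_root_mult using d0 by (simp add: real_root_power_cancel a_def)
      finally have "a * root d ((det (r *\<^sub>R V))\<^sup>2) \<le> 16 * real d ^ 2 * ?s" .
      moreover have "r *\<^sub>R V = (\<chi> i. r *s V$i)" by (simp add: vec_eq_iff)
      then have "det (r *\<^sub>R V) = r ^ d * det V"
        using det_rows_mul[of "\<lambda>_. r" "\<lambda>i. V$i"] by (simp add: d_def)
      then have "(det (r *\<^sub>R V))\<^sup>2 = (r\<^sup>2) ^ d * (det V)\<^sup>2"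
        by (simp add: power_mult_distrib power_commutes mult.commute flip: power_mult)
      then have "root d ((det (r *\<^sub>R V))\<^sup>2) = r\<^sup>2 * root d ((det V)\<^sup>2)"
        using d0 by (simp add: real_root_mult real_root_power_cancel)
      ultimately show ?thesis using d0 by (simp add: \<kappa>_def field_simps)
    qed
    have "\<kappa> \<le> (\<Sum>i\<in>UNIV. inner (V$i) (jacobian \<psi> (at x) *v V$i))"
    proof (rule second_difference_lower_imp_hessian[OF ud' \<psi>d])
      show "0 < \<delta> / (1 + (\<Sum>i\<in>UNIV. norm (V$i)))" using \<delta> by (simp add: add_pos_nonneg sum_nonneg)
      show "\<kappa> * r\<^sup>2 \<le> (\<Sum>i\<in>UNIV. second_difference ?u (r *\<^sub>R V$i) x)"
        if "0 < r" "r < \<delta> / (1 + (\<Sum>i\<in>UNIV. norm (V$i)))" for r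
        by (rule sum_second_difference_mollify_ge[OF \<phi>c kc k(2) k3 k(4) sd[OF _ that]])
    qed
    moreover have "det (transpose V ** V) = (det V)\<^sup>2" by (simp add: det_mul power2_eq_square)
    ultimately show ?thesis using d0 unfolding \<kappa>_def a_def by (simp add: field_simps)
  qed
  show ?thesis by (rule exI[of _ \<psi>]) (intro conjI allI ballI sm \<psi>R main)
qed

section \<open>Integral estimates\<close>

lemma integrable_mult_bounded:
  fixes f g :: "'a \<Rightarrow> real"
  assumes "integrable M f" "g \<in> borel_measurable M" "\<And>x. x \<in> space M \<Longrightarrow> \<bar>g x\<bar> \<le> B"
  shows "integrable M (\<lambda>x. f x * g x)"
proof (rule Bochner_Integration.integrable_bound)
  show "integrable M (\<lambda>x. B * f x)" using assms(1) by simp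
  show "(\<lambda>x. f x * g x) \<in> borel_measurable M" using assms(1,2) by auto
  show "AE x in M. norm (f x * g x) \<le> norm (B * f x)"
  proof (rule AE_I2)
    fix x assume "x \<in> space M"
    then have "\<bar>g x\<bar> \<le> B" by (rule assms(3))
    then have "\<bar>f x\<bar> * \<bar>g x\<bar> \<le> \<bar>f x\<bar> * \<bar>B\<bar>" by (intro mult_left_mono) auto
    then show "norm (f x * g x) \<le> norm (B * f x)" by (simp add: abs_mult mult.commute)
  qed
qed

lemma continuous_on_det: "continuous_on A (det :: real^'n^'n \<Rightarrow> real)"
  unfolding det_def by (intro continuous_intros)

lemma sets_sphere_measure: "sets sphere_measure = sets (restrict_space borel (sphere 0 1))"
  by (simp add: sphere_measure_def)

lemma space_sphere_measure: "space sphere_measure = sphere 0 1"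
  by (simp add: sphere_measure_def space_restrict_space)

lemma borel_measurable_sphere_measure:
  assumes "f \<in> borel_measurable borel"
  shows "f \<in> borel_measurable sphere_measure"
  using measurable_restrict_space1[OF assms] by (simp add: measurable_cong_sets[OF sets_sphere_measure refl])

text \<open>\<open>root\<close> is total and continuous, so measurability and the linear bound hold
  on all matrices; the sign is controlled on \<open>psd_matrices\<close>.\<close>

definition det_root :: "real^'n^'n \<Rightarrow> real"
  where "det_root S = root CARD('n) (det S)"

lemma borel_measurable_det_root: "det_root \<in> borel_measurable borel"
  unfolding det_root_def by (intro borel_measurable_continuous_onI continuous_intros continuous_on_det)

lemma det_root_nonneg: "S \<in> psd_matrices \<Longrightarrow> 0 \<le> det_root S"
  by (simp add: det_root_def det_psd_nonneg)

lemma det_root_le: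
  fixes S :: "real^'n^'n"
  shows "\<bar>det_root S\<bar> \<le> fact CARD('n) * norm S"
proof -
  have d: "0 < CARD('n)" by simp
  have "\<bar>det S\<bar> \<le> fact CARD('n) * norm S ^ CARD('n)" by (rule abs_det_le)
  also have "\<dots> \<le> (fact CARD('n)) ^ CARD('n) * norm S ^ CARD('n)"
    using self_le_power[of "fact CARD('n) :: real" "CARD('n)"] by (intro mult_right_mono) auto
  also have "\<dots> = (fact CARD('n) * norm S) ^ CARD('n)" by (simp add: power_mult_distrib)
  finally have "root CARD('n) \<bar>det S\<bar> \<le> root CARD('n) ((fact CARD('n) * norm S) ^ CARD('n))"
    by (intro real_root_le_mono d)
  then show ?thesis unfolding det_root_def
    using d by (simp add: real_root_abs real_root_power_cancel)
qed

lemma integrable_det_root: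
  fixes T :: "'x \<Rightarrow> real^'n^'n"
  assumes "integrable M T"
  shows "integrable M (\<lambda>x. det_root (T x))"
proof (rule Bochner_Integration.integrable_bound)
  show "integrable M (\<lambda>x. fact CARD('n) * norm (T x))" using assms by simp
  show "(\<lambda>x. det_root (T x)) \<in> borel_measurable M"
    by (rule measurable_compose[OF borel_measurable_integrable[OF assms] borel_measurable_det_root])
  show "AE x in M. norm (det_root (T x)) \<le> norm (fact CARD('n) * norm (T x))"
    using det_root_le[of "T x" for x] by (intro AE_I2) (simp add: abs_mult)
qed

lemma continuous_on_jacobian:
  fixes \<psi> :: "real^'n \<Rightarrow> real^'m"
  assumes "smooth \<psi>"
  shows "continuous_on A (\<lambda>x. jacobian \<psi> (at x) $ i $ j)"
proof -
  have "times_differentiable 1 \<psi>" using assms by (simp only: smooth_def)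
  then have "continuous_on UNIV (\<lambda>x. frechet_derivative \<psi> (at x) (axis j 1))"
    using times_differentiable_SucD(2)[of 0 \<psi>] by simp
  then have "continuous_on A (\<lambda>x. frechet_derivative \<psi> (at x) (axis j 1) $ i)"
    by (intro continuous_intros) (rule continuous_on_subset, auto)
  then show ?thesis by (simp add: jacobian_def matrix_def)
qed

lemma integrable_trace_mult_jacobian:
  fixes \<psi> :: "real^'n \<Rightarrow> real^'n"
  assumes T: "integrable ball_measure T" and \<psi>: "smooth \<psi>"
  shows "integrable ball_measure (\<lambda>x. trace (T x ** jacobian \<psi> (at x)))"
proof -
  have "integrable ball_measure (\<lambda>x. T x $ a $ b * jacobian \<psi> (at x) $ b $ a)" for a b
  proof -
    have bl: "bounded_linear (\<lambda>A::real^'n^'n. A $ a $ b)"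
      using bounded_linear_compose[OF bounded_linear_vec_nth bounded_linear_vec_nth] .
    have c: "continuous_on (cball 0 1) (\<lambda>x. jacobian \<psi> (at x) $ b $ a)" by (rule continuous_on_jacobian[OF \<psi>])
    then have "bounded ((\<lambda>x. jacobian \<psi> (at x) $ b $ a) ` cball 0 1)"
      by (intro compact_imp_bounded compact_continuous_image) auto
    then obtain B where B: "\<forall>y\<in>(\<lambda>x. jacobian \<psi> (at x) $ b $ a) ` cball 0 1. norm y \<le> B"
      unfolding bounded_iff by blast
    show ?thesis
    proof (rule integrable_mult_bounded[OF integrable_bounded_linear[OF bl T], where B = B])
      show "(\<lambda>x. jacobian \<psi> (at x) $ b $ a) \<in> borel_measurable ball_measure"
        by (intro continuous_imp_measurable_on_sets_lebesgue continuous_on_jacobian \<psi>) simp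
    qed (use B in auto)
  qed
  then show ?thesis unfolding trace_def matrix_matrix_mult_def by simp
qed

text \<open>Testing the definition of the normal trace with \<open>\<psi> = \<nabla>\<phi>\<close>, where \<open>\<phi>\<close> is an approximate
  subsolution of \<open>det D\<^sup>2 \<phi> = h ^ d\<close>.\<close>

lemma det_root_integral_continuous:
  fixes T :: "real^'n \<Rightarrow> real^'n^'n" and h :: "real^'n \<Rightarrow> real"
  defines "d \<equiv> CARD('n)"
  assumes T: "L1_psd_tensor T" and g: "has_normal_trace T g"
    and h: "continuous_on (cball 0 2) h" "\<And>x. x \<in> cball 0 2 \<Longrightarrow> 0 \<le> h x"
  shows "(LINT x|ball_measure. det_root (T x) * h x)
    \<le> 16 * real d ^ 2 * root d ((LINT x:cball 0 2|lborel. h x ^ d) / unit_ball_vol (real d))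
      * (LINT x|sphere_measure. norm (g x))"
proof -
  define R where "R = root d ((LINT x:cball (0::real^'n) 2|lborel. h x ^ d) / unit_ball_vol (real d))"
  define G where "G = (LINT x|sphere_measure. norm (g x))"
  let ?F = "\<lambda>x. det_root (T x)"
  have Ti: "integrable ball_measure T" and psd: "AE x in ball_measure. T x \<in> psd_matrices"
    using T by (auto simp: L1_psd_tensor_def)
  have gi: "integrable sphere_measure g" using g by (simp add: has_normal_trace_def)
  have Fi: "integrable ball_measure ?F" by (rule integrable_det_root[OF Ti])
  have F0: "AE x in ball_measure. 0 \<le> ?F x" using psd by eventually_elim (rule det_root_nonneg)
  have hm: "h \<in> borel_measurable ball_measure"
    by (intro continuous_imp_measurable_on_sets_lebesgue continuous_on_subset[OF h(1)]) auto
  have "bounded (h ` cball 0 2)" by (intro compact_imp_bounded compact_continuous_image h) auto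
  then obtain B where B: "\<forall>y\<in>h ` cball 0 2. norm y \<le> B" unfolding bounded_iff by blast
  have Fhi: "integrable ball_measure (\<lambda>x. ?F x * h x)"
    by (rule integrable_mult_bounded[OF Fi hm, of B]) (use B in auto)
  \<comment> \<open>The subsolution belongs to \<open>max 0 (h x - e)\<close>, so \<open>h\<close>
    is recovered up to \<open>e\<close> times the integral of \<open>?F\<close>; this error
    disappears as \<open>e\<close> tends to 0.\<close>
  have le: "(LINT x|ball_measure. ?F x * h x) \<le> 16 * real d ^ 2 * R * G + e * (LINT x|ball_measure. ?F x)"
    if e: "0 < e" for e
  proof -
    obtain \<psi> :: "real^'n \<Rightarrow> real^'n" where \<psi>': "smooth \<psi> \<and> (\<forall>x. norm (\<psi> x) \<le> R) \<and>
      (\<forall>x\<in>ball 0 1. \<forall>V::real^'n^'n. root d (det (transpose V ** V)) * max 0 (h x - e)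
        \<le> 16 * real d ^ 2 * (\<Sum>i\<in>UNIV. inner (V$i) (jacobian \<psi> (at x) *v V$i)))"
      using exists_smooth_monge_ampere_subsolution[OF h(1) _ R_def[unfolded d_def] e, folded d_def] h(2)
      by (auto elim!: exE)
    have \<psi>: "smooth \<psi>" "norm (\<psi> x) \<le> R" "x \<in> ball 0 1 \<Longrightarrow> root d (det (transpose V ** V)) * max 0 (h x - e)
        \<le> 16 * real d ^ 2 * (\<Sum>i\<in>UNIV. inner (V$i) (jacobian \<psi> (at x) *v V$i))"
      for x and V :: "real^'n^'n"
      using \<psi>' by blast+
    have "(LINT x|ball_measure. ?F x * h x - e * ?F x)
        \<le> (LINT x|ball_measure. 16 * real d ^ 2 * trace (T x ** jacobian \<psi> (at x)))"
    proof (rule integral_mono_AE)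
      show "integrable ball_measure (\<lambda>x. ?F x * h x - e * ?F x)" using Fhi Fi by simp
      show "integrable ball_measure (\<lambda>x. 16 * real d ^ 2 * trace (T x ** jacobian \<psi> (at x)))"
        using integrable_trace_mult_jacobian[OF Ti \<psi>(1)] by simp
      have sp: "AE x in ball_measure. x \<in> ball (0::real^'n) 1" by (intro AE_I2) simp
      show "AE x in ball_measure. ?F x * h x - e * ?F x \<le> 16 * real d ^ 2 * trace (T x ** jacobian \<psi> (at x))"
        using psd sp
      proof eventually_elim
        case (elim x)
        obtain V :: "real^'n^'n" where V: "T x = transpose V ** V" by (rule psd_gram[OF elim(1)])
        have "?F x * h x - e * ?F x = ?F x * (h x - e)" by (simp add: algebra_simps)
        also have "\<dots> \<le> ?F x * max 0 (h x - e)" using det_root_nonneg[OF elim(1)] by (intro mult_left_mono) auto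
        also have "\<dots> \<le> 16 * real d ^ 2 * trace (T x ** jacobian \<psi> (at x))"
          using \<psi>(3)[OF elim(2), of V] unfolding V trace_gram_mult det_root_def d_def .
        finally show ?case .
      qed
    qed
    also have "\<dots> = 16 * real d ^ 2 * (LINT x|sphere_measure. inner (g x) (\<psi> x))"
      using g \<psi>(1) unfolding has_normal_trace_def by simp
    also have "\<dots> \<le> 16 * real d ^ 2 * (R * G)"
    proof (intro mult_left_mono)
      have bd: "norm (inner (g x) (\<psi> x)) \<le> R * norm (g x)" for x
      proof -
        have "\<bar>inner (g x) (\<psi> x)\<bar> \<le> norm (g x) * norm (\<psi> x)" by (rule Cauchy_Schwarz_ineq2)
        also have "\<dots> \<le> norm (g x) * R" by (intro mult_left_mono \<psi>) auto
        finally show ?thesis by (simp add: mult.commute)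
      qed
      have Rgi: "integrable sphere_measure (\<lambda>x. R * norm (g x))" using gi by simp
      have "continuous_on UNIV \<psi>" using \<psi>(1) unfolding smooth_def by (metis times_differentiable.simps(1))
      then have \<psi>m: "\<psi> \<in> borel_measurable sphere_measure"
        by (intro borel_measurable_sphere_measure borel_measurable_continuous_onI)
      have "integrable sphere_measure (\<lambda>x. inner (g x) (\<psi> x))"
      proof (rule Bochner_Integration.integrable_bound[OF Rgi])
        show "(\<lambda>x. inner (g x) (\<psi> x)) \<in> borel_measurable sphere_measure"
          using gi \<psi>m by auto
        show "AE x in sphere_measure. norm (inner (g x) (\<psi> x)) \<le> norm (R * norm (g x))"
          using bd by (intro AE_I2) (smt (verit) real_norm_def)
      qed
      then have "norm (LINT x|sphere_measure. inner (g x) (\<psi> x)) \<le> (LINT x|sphere_measure. R * norm (g x))"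
        by (rule Bochner_Integration.integral_norm_bound_integral[OF _ Rgi bd])
      then show "(LINT x|sphere_measure. inner (g x) (\<psi> x)) \<le> R * G" by (simp add: G_def)
    qed simp
    finally show ?thesis using Fhi Fi by (simp add: mult.assoc)
  qed
  have F0': "0 \<le> (LINT x|ball_measure. ?F x)" by (rule integral_nonneg_AE[OF F0])
  show ?thesis unfolding R_def[symmetric] G_def[symmetric]
  proof (rule le_if_le_add_eps_mult[where c = "(LINT x|ball_measure. ?F x) + 1"])
    fix e :: real assume e: "0 < e"
    show "(LINT x|ball_measure. ?F x * h x) \<le> 16 * real d ^ 2 * R * G + e * ((LINT x|ball_measure. ?F x) + 1)"
      using le[OF e] e by (simp add: distrib_left)
  qed (use F0' in simp)
qed

lemma finite_measure_ball_measure: "finite_measure (ball_measure :: (real^'n) measure)"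
  by (intro finite_measureI)
    (use emeasure_lborel_ball_finite[of "0::real^'n" 1] in
      \<open>simp add: emeasure_restrict_space space_restrict_space less_top\<close>)

lemma AE_ball_measure_not_in_negligible:
  fixes N :: "(real^'n) set"
  assumes "negligible N"
  shows "AE x in ball_measure. x \<notin> N"
proof -
  have "AE x in lebesgue. x \<notin> N" using assms by (intro AE_not_in) (simp add: negligible_iff_null_sets)
  then show ?thesis by (subst AE_restrict_space_iff) auto
qed

text \<open>Passes from continuous to bounded measurable weights by almost everywhere approximation
  and dominated convergence. The weight is extended by zero beyond the unit ball, so the integrals
  over the ball of radius 2 in the continuous estimate converge to one over the unit ball.\<close>

lemma det_root_integral_bounded:
  fixes T :: "real^'n \<Rightarrow> real^'n^'n" and h :: "real^'n \<Rightarrow> real"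
  defines "d \<equiv> CARD('n)"
  assumes T: "L1_psd_tensor T" and g: "has_normal_trace T g"
    and h: "h \<in> borel_measurable ball_measure" "\<And>x. 0 \<le> h x" "\<And>x. h x \<le> B"
  shows "(LINT x|ball_measure. det_root (T x) * h x)
    \<le> 16 * real d ^ 2 * root d ((LINT x|ball_measure. h x ^ d) / unit_ball_vol (real d))
      * (LINT x|sphere_measure. norm (g x))"
proof -
  let ?F = "\<lambda>x. det_root (T x)"
  have d0: "0 < d" by (simp add: d_def)
  have B0: "0 \<le> B" using h(2,3) order_trans by blast
  define h1 where "h1 x = (if x \<in> ball 0 1 then h x else 0)" for x
  have "h1 \<in> borel_measurable lebesgue"
    unfolding h1_def using h(1) by (subst borel_measurable_if) auto
  then have "h1 measurable_on UNIV" by (intro lebesgue_measurable_imp_measurable_on) auto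
  then obtain N q where N: "negligible N" "\<And>n. continuous_on UNIV (q n)" "\<And>x. x \<notin> N \<Longrightarrow> (\<lambda>n. q n x) \<longlonglongrightarrow> h1 x"
    unfolding measurable_on_def by auto
  \<comment> \<open>Truncation to \<open>[0, B]\<close> supplies both the nonnegativity asked for by
    the continuous estimate and a common bound for the limits.\<close>
  define hn where "hn n x = max 0 (min B (q n x))" for n x
  have hnc: "continuous_on A (hn n)" for A n
    unfolding hn_def by (intro continuous_intros continuous_on_subset[OF N(2)]) auto
  have hnb: "0 \<le> hn n x" "hn n x \<le> B" for n x using B0 by (auto simp: hn_def)
  have h1b: "0 \<le> h1 x" "h1 x \<le> B" for x using h(2,3) B0 by (auto simp: h1_def)
  have hnl: "(\<lambda>n. hn n x) \<longlonglongrightarrow> h1 x" if "x \<notin> N" for x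
  proof -
    have "(\<lambda>n. hn n x) \<longlonglongrightarrow> max 0 (min B (h1 x))"
      unfolding hn_def by (intro tendsto_max tendsto_min tendsto_const N(3) that)
    then show ?thesis using h1b[of x] by simp
  qed
  have Fi: "integrable ball_measure ?F" using T by (intro integrable_det_root) (simp add: L1_psd_tensor_def)
  have lim1: "(\<lambda>n. LINT x|ball_measure. ?F x * hn n x) \<longlonglongrightarrow> (LINT x|ball_measure. ?F x * h x)"
  proof (rule integral_dominated_convergence[where w = "\<lambda>x. B * \<bar>?F x\<bar>"])
    show "(\<lambda>x. ?F x * h x) \<in> borel_measurable ball_measure" using Fi h(1) by auto
    show "(\<lambda>x. ?F x * hn n x) \<in> borel_measurable ball_measure" for n
      using Fi continuous_imp_measurable_on_sets_lebesgue[OF hnc, of "ball 0 1"] by auto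
    show "integrable ball_measure (\<lambda>x. B * \<bar>?F x\<bar>)" using Fi by simp
    have sp: "AE x in ball_measure. x \<in> ball (0::real^'n) 1" by (intro AE_I2) simp
    show "AE x in ball_measure. (\<lambda>n. ?F x * hn n x) \<longlonglongrightarrow> ?F x * h x"
      using AE_ball_measure_not_in_negligible[OF N(1)] sp
    proof eventually_elim
      case (elim x)
      then show ?case using hnl[of x] by (intro tendsto_intros) (simp add: h1_def)
    qed
    show "AE x in ball_measure. norm (?F x * hn n x) \<le> B * \<bar>?F x\<bar>" for n
    proof (intro AE_I2)
      fix x
      have "\<bar>?F x\<bar> * \<bar>hn n x\<bar> \<le> \<bar>?F x\<bar> * B" using hnb[of n x] by (intro mult_left_mono) auto
      then show "norm (?F x * hn n x) \<le> B * \<bar>?F x\<bar>" by (simp add: abs_mult mult.commute)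
    qed
  qed
  have lim2: "(\<lambda>n. LINT x:cball 0 2|lborel. hn n x ^ d) \<longlonglongrightarrow> (LINT x|ball_measure. h x ^ d)"
  proof -
    let ?C = "cball (0::real^'n) 2"
    have hnm: "(\<lambda>x. indicat_real ?C x *\<^sub>R hn n x ^ d) \<in> borel_measurable lborel" for n
      using borel_measurable_continuous_onI[OF hnc[of UNIV n]]
      by (intro borel_measurable_scaleR borel_measurable_indicator borel_measurable_power) auto
    have e1: "(LINT x:?C|lborel. hn n x ^ d) = (LINT x|lebesgue. indicat_real ?C x *\<^sub>R hn n x ^ d)" for n
      unfolding set_lebesgue_integral_def by (rule integral_completion[OF hnm, symmetric])
    have e2: "(LINT x|ball_measure. h x ^ d) = (LINT x|lebesgue. indicat_real ?C x *\<^sub>R h1 x ^ d)"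
      using d0 by (subst integral_restrict_space) (auto simp: h1_def indicator_def intro!: Bochner_Integration.integral_cong)
    have "h1 \<in> borel_measurable lebesgue" by fact
    show ?thesis unfolding e1 e2
    proof (rule integral_dominated_convergence[where w = "\<lambda>x. B ^ d * indicat_real ?C x"])
      show "(\<lambda>x. indicat_real ?C x *\<^sub>R h1 x ^ d) \<in> borel_measurable lebesgue"
        using \<open>h1 \<in> borel_measurable lebesgue\<close>
        by (intro borel_measurable_scaleR borel_measurable_indicator borel_measurable_power) auto
      show "(\<lambda>x. indicat_real ?C x *\<^sub>R hn n x ^ d) \<in> borel_measurable lebesgue" for n
        using hnm by (rule measurable_completion)
      show "integrable lebesgue (\<lambda>x. B ^ d * indicat_real ?C x)"
        by (intro integrable_mult_right integrable_real_indicator) (auto simp: emeasure_compact_finite[OF compact_cball, simplified])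
      have "AE x in lebesgue. x \<notin> N" using N(1) by (intro AE_not_in) (simp add: negligible_iff_null_sets)
      then show "AE x in lebesgue. (\<lambda>n. indicat_real ?C x *\<^sub>R hn n x ^ d) \<longlonglongrightarrow> indicat_real ?C x *\<^sub>R h1 x ^ d"
        by eventually_elim (intro tendsto_intros hnl)
      show "AE x in lebesgue. norm (indicat_real ?C x *\<^sub>R hn n x ^ d) \<le> B ^ d * indicat_real ?C x" for n
        using hnb by (intro AE_I2) (auto simp: indicator_def intro!: power_mono)
    qed
  qed
  have "(\<lambda>n. 16 * real d ^ 2 * root d ((LINT x:cball 0 2|lborel. hn n x ^ d) / unit_ball_vol (real d)) * (LINT x|sphere_measure. norm (g x)))
    \<longlonglongrightarrow> 16 * real d ^ 2 * root d ((LINT x|ball_measure. h x ^ d) / unit_ball_vol (real d)) * (LINT x|sphere_measure. norm (g x))"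
    using less_imp_neq[OF unit_ball_vol_pos[of "real d"]] by (intro tendsto_intros lim2) auto
  then show ?thesis
    by (rule LIMSEQ_le[OF lim1])
      (use det_root_integral_continuous[OF T g hnc hnb(1), folded d_def] in blast)
qed

text \<open>For positive \<open>x\<close> the hypothesis says
  \<open>x powr (1 - 1/d) \<le> k\<close>, and the exponents \<open>1 - 1/d\<close> and
  \<open>d/(d-1)\<close> are reciprocal.\<close>

lemma powr_le_of_le_mult_root:
  fixes x k :: real
  assumes "2 \<le> d" "0 \<le> x" "0 \<le> k" "x \<le> k * root d x"
  shows "x \<le> k powr (real d / (real d - 1))"
proof (cases "x = 0")
  case False
  then have x: "0 < x" using assms by simp
  have "x = x powr (1 - 1 / real d) * x powr (1 / real d)"
    using x by (simp flip: powr_add)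
  moreover have "root d x = x powr (1 / real d)" using x assms(1) by (simp add: root_powr_inverse)
  ultimately have "x powr (1 - 1 / real d) * x powr (1 / real d) \<le> k * x powr (1 / real d)"
    using assms(4) by metis
  then have "x powr (1 - 1 / real d) \<le> k" using x by simp
  then have "(x powr (1 - 1 / real d)) powr (real d / (real d - 1)) \<le> k powr (real d / (real d - 1))"
    using assms(1) by (intro powr_mono2) auto
  also have "(x powr (1 - 1 / real d)) powr (real d / (real d - 1)) = x powr 1"
  proof -
    have "(1 - 1 / real d) * (real d / (real d - 1)) = 1" using assms(1) by (simp add: field_simps)
    then show ?thesis by (simp only: powr_powr)
  qed
  finally show ?thesis using x by simp
qed simp

text \<open>Let \<open>m\<close> be the \<open>d\<close>-th root of the determinant cut off at
  height \<open>n\<close>, and take the weight \<open>m powr (1/(d-1))\<close>. Its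
  \<open>d\<close>-th power and its product with \<open>m\<close> are both \<open>m powr p\<close>,
  so the integral of \<open>m powr p\<close> is at most a constant times its own \<open>d\<close>-th
  root. Being finite it can be absorbed, with a bound that does not depend on \<open>n\<close>;
  monotone convergence removes the cutoff.\<close>

theorem det_powr_nn_integral_le:
  fixes T :: "real^'n \<Rightarrow> real^'n^'n"
  defines "d \<equiv> CARD('n)"
  assumes d: "2 \<le> d" and T: "L1_psd_tensor T" and g: "has_normal_trace T g"
  shows "(\<integral>\<^sup>+ x. ennreal (det (T x) powr (1 / (real d - 1))) \<partial>ball_measure)
    \<le> ennreal ((16 * real d ^ 2 * root d (1 / unit_ball_vol (real d)) * (LINT x|sphere_measure. norm (g x))) powr (real d / (real d - 1)))"
proof -
  define p where "p = real d / (real d - 1)"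
  define \<kappa> where "\<kappa> = 16 * real d ^ 2 * root d (1 / unit_ball_vol (real d)) * (LINT x|sphere_measure. norm (g x))"
  have p1: "p = 1 + 1 / (real d - 1)" using d by (simp add: p_def field_simps)
  have \<kappa>0: "0 \<le> \<kappa>" unfolding \<kappa>_def using d by (intro mult_nonneg_nonneg) auto
  define f where "f x = max 0 (det_root (T x))" for x
  have psd: "AE x in ball_measure. T x \<in> psd_matrices" and Ti: "integrable ball_measure T"
    using T by (auto simp: L1_psd_tensor_def)
  have fm: "f \<in> borel_measurable ball_measure"
    unfolding f_def using integrable_det_root[OF Ti] by auto
  have ff: "AE x in ball_measure. det_root (T x) = f x"
    using psd by eventually_elim (simp add: f_def det_root_nonneg)
  have f0: "0 \<le> f x" for x by (simp add: f_def)
  define m where "m n x = min (f x) (real n)" for n x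
  have m0: "0 \<le> m n x" "m n x \<le> real n" "m n x \<le> f x" for n x using f0 by (auto simp: m_def)
  have mm: "(\<lambda>x. m n x powr q) \<in> borel_measurable ball_measure" for n q unfolding m_def using fm by measurable
  have mi: "integrable ball_measure (\<lambda>x. m n x powr q)" if "0 \<le> q" for n q
    by (rule finite_measure.integrable_const_bound[OF finite_measure_ball_measure, of _ "real n powr q"])
      (use that m0 mm in \<open>auto intro!: powr_mono2\<close>)
  have X: "(LINT x|ball_measure. m n x powr p) \<le> \<kappa> powr p" for n
  proof -
    let ?X = "LINT x|ball_measure. m n x powr p"
    let ?h = "\<lambda>x. m n x powr (1 / (real d - 1))"
    have X0: "0 \<le> ?X" by (intro integral_nonneg_AE) auto
    have hb: "?h x \<le> real n powr (1 / (real d - 1))" for x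
      using m0 d by (intro powr_mono2) auto
    have hd: "?h x ^ d = m n x powr p" for x
    proof (cases "m n x = 0")
      case True
      then show ?thesis using d by simp
    next
      case False
      then have "0 < m n x" using m0(1)[of n x] by simp
      then show ?thesis using d by (simp add: powr_powr p_def flip: powr_realpow)
    qed
    have Fhi: "integrable ball_measure (\<lambda>x. det_root (T x) * ?h x)"
      by (rule integrable_mult_bounded[OF integrable_det_root[OF Ti] mm]) (use hb in auto)
    have "?X \<le> (LINT x|ball_measure. det_root (T x) * ?h x)"
    proof (rule integral_mono_AE[OF mi Fhi])
      show "0 \<le> p" using d by (simp add: p_def)
      show "AE x in ball_measure. m n x powr p \<le> det_root (T x) * ?h x"
        using ff
      proof eventually_elim
        case (elim x)
        have "m n x powr p = m n x * ?h x" using m0(1)[of n x] by (cases "m n x = 0") (auto simp: p1 powr_add)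
        also have "\<dots> \<le> f x * ?h x" using m0 by (intro mult_right_mono) auto
        finally show ?case using elim by simp
      qed
    qed
    also have "\<dots> \<le> 16 * real d ^ 2 * root d ((LINT x|ball_measure. ?h x ^ d) / unit_ball_vol (real d))
      * (LINT x|sphere_measure. norm (g x))"
      unfolding d_def by (rule det_root_integral_bounded[OF T g mm _ hb[unfolded d_def]]) simp
    also have "(LINT x|ball_measure. ?h x ^ d) = ?X" by (simp only: hd)
    also have "root d (?X / unit_ball_vol (real d)) = root d (1 / unit_ball_vol (real d)) * root d ?X"
      using d by (simp add: real_root_divide)
    finally have "?X \<le> \<kappa> * root d ?X" unfolding \<kappa>_def by (simp add: mult_ac)
    then show ?thesis unfolding p_def by (intro powr_le_of_le_mult_root d X0 \<kappa>0) (simp add: p_def)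
  qed
  have p0: "0 \<le> p" using d by (simp add: p_def)
  have "(\<integral>\<^sup>+ x. ennreal (det (T x) powr (1 / (real d - 1))) \<partial>ball_measure)
      \<le> (\<integral>\<^sup>+ x. (SUP n. ennreal (m n x powr p)) \<partial>ball_measure)"
  proof (rule nn_integral_mono_AE)
    show "AE x in ball_measure. ennreal (det (T x) powr (1 / (real d - 1))) \<le> (SUP n. ennreal (m n x powr p))"
      using ff psd
    proof eventually_elim
      case (elim x)
      have D: "0 \<le> det (T x)" using elim(2) by (rule det_psd_nonneg)
      obtain n where n: "f x \<le> real n" using real_arch_simple by blast
      have "det (T x) powr (1 / (real d - 1)) = f x powr p"
      proof (cases "det (T x) = 0")
        case True
        then show ?thesis using elim(1) by (simp add: det_root_def)
      next
        case False
        then have "f x = det (T x) powr (1 / real d)"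
          using elim(1) D d by (simp add: det_root_def root_powr_inverse d_def)
        then show ?thesis using d by (simp add: powr_powr p_def)
      qed
      also have "\<dots> = m n x powr p" using n by (simp add: m_def)
      finally show ?case by (simp add: SUP_upper2[of n])
    qed
  qed
  also have "\<dots> = (SUP n. \<integral>\<^sup>+ x. ennreal (m n x powr p) \<partial>ball_measure)"
  proof (rule nn_integral_monotone_convergence_SUP)
    show "incseq (\<lambda>n x. ennreal (m n x powr p))"
    proof (intro incseq_SucI le_funI ennreal_leI powr_mono2 p0 m0)
      show "m n x \<le> m (Suc n) x" for n x by (auto simp: m_def)
    qed
    show "(\<lambda>x. ennreal (m n x powr p)) \<in> borel_measurable ball_measure" for n using mm by measurable
  qed
  also have "\<dots> \<le> ennreal (\<kappa> powr p)"
  proof (rule SUP_least)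
    fix n
    have "(\<integral>\<^sup>+ x. ennreal (m n x powr p) \<partial>ball_measure) = ennreal (LINT x|ball_measure. m n x powr p)"
      by (rule nn_integral_eq_integral[OF mi[OF p0]]) simp
    also have "\<dots> \<le> ennreal (\<kappa> powr p)" by (intro ennreal_leI X)
    finally show "(\<integral>\<^sup>+ x. ennreal (m n x powr p) \<partial>ball_measure) \<le> ennreal (\<kappa> powr p)" .
  qed
  finally show ?thesis unfolding \<kappa>_def p_def .
qed

section \<open>The divergence theorem in the unit ball\<close>

lemma lborel_integral_scaleR:
  fixes f :: "'a::euclidean_space \<Rightarrow> real"
  assumes "f \<in> borel_measurable borel" "0 < s"
  shows "(LINT x|lborel. f x) = s ^ DIM('a) * (LINT x|lborel. f (s *\<^sub>R x))"
proof -
  have "(LINT x|lborel. f x) = (LINT x|density (distr lborel borel (\<lambda>x. 0 + s *\<^sub>R x)) (\<lambda>_. \<bar>s\<bar> ^ DIM('a)). f x)"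
    using assms(2) by (subst lborel_affine[of s 0]) auto
  also have "\<dots> = (LINT x|distr lborel borel (\<lambda>x. 0 + s *\<^sub>R x). \<bar>s\<bar> ^ DIM('a) *\<^sub>R f x)"
    using assms(1) by (intro integral_density) auto
  also have "\<dots> = (LINT x|lborel. \<bar>s\<bar> ^ DIM('a) *\<^sub>R f (0 + s *\<^sub>R x))"
    using assms(1) by (intro integral_distr) auto
  finally show ?thesis using assms(2) by simp
qed

lemma integral_scale_measure:
  fixes f :: "'a \<Rightarrow> real"
  assumes "f \<in> borel_measurable M" "0 \<le> r"
  shows "(LINT x|scale_measure (ennreal r) M. f x) = r * (LINT x|M. f x)"
proof -
  have "scale_measure (ennreal r) M = density M (\<lambda>_. ennreal r)"
    by (rule measure_eqI) (simp_all add: emeasure_density nn_integral_cmult_indicator)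
  then show ?thesis using assms by (simp add: integral_density)
qed

text \<open>The surface measure is defined through cones, so the integrand is extended to the ball
  as a function constant along rays. The origin, where \<open>x /\<^sub>R norm x\<close> is 0 by
  convention, is a null set.\<close>

lemma integral_sphere_measure:
  fixes f :: "'a::euclidean_space \<Rightarrow> real"
  assumes f: "f \<in> borel_measurable borel"
  shows "(LINT x|sphere_measure. f x) = real DIM('a) * (LINT x:ball 0 1|lborel. f (x /\<^sub>R norm x))"
proof -
  let ?M = "restrict_space lborel (ball 0 1 - {0 :: 'a})"
  have b: "(\<lambda>x::'a. x /\<^sub>R norm x) \<in> borel_measurable borel" by measurable
  then have "(\<lambda>x. x /\<^sub>R norm x) \<in> measurable ?M borel" by (intro measurable_restrict_space1) simp
  then have m: "(\<lambda>x. x /\<^sub>R norm x) \<in> measurable ?M (restrict_space borel (sphere 0 1))"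
    by (rule measurable_restrict_space2[rotated]) (auto simp: space_restrict_space)
  have fm: "(\<lambda>x. f (x /\<^sub>R norm x)) \<in> borel_measurable borel" by (rule measurable_compose[OF b f])
  have "(LINT x|sphere_measure. f x) = (LINT x|scale_measure (of_nat DIM('a)) ?M. f (x /\<^sub>R norm x))"
    unfolding sphere_measure_def using m
    by (intro integral_distr measurable_restrict_space1 f) (simp add: measurable_def space_scale_measure)
  also have "\<dots> = real DIM('a) * (LINT x|?M. f (x /\<^sub>R norm x))"
    using integral_scale_measure[of "\<lambda>x. f (x /\<^sub>R norm x)" ?M "real DIM('a)"] fm
    by (simp add: measurable_restrict_space1 ennreal_of_nat_eq_real_of_nat)
  also have "(LINT x|?M. f (x /\<^sub>R norm x)) = (LINT x|lborel. indicator (ball 0 1 - {0}) x *\<^sub>R f (x /\<^sub>R norm x))"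
    by (intro integral_restrict_space) simp
  also have "\<dots> = (LINT x:ball 0 1|lborel. f (x /\<^sub>R norm x))"
    unfolding set_lebesgue_integral_def
  proof (rule Bochner_Integration.integral_cong_AE)
    show "AE x in lborel. indicator (ball 0 1 - {0}) x *\<^sub>R f (x /\<^sub>R norm x) = indicator (ball 0 1) x *\<^sub>R f (x /\<^sub>R norm x)"
      using AE_lborel_singleton[of "0::'a"] by eventually_elim (simp add: indicator_def)
    show "(\<lambda>x. indicator (ball 0 1 - {0}) x *\<^sub>R f (x /\<^sub>R norm x)) \<in> borel_measurable lborel"
      "(\<lambda>x. indicator (ball 0 1) x *\<^sub>R f (x /\<^sub>R norm x)) \<in> borel_measurable lborel"
      by (intro borel_measurable_scaleR borel_measurable_indicator; use fm in simp)+
  qed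
  finally show ?thesis .
qed

text \<open>Translation invariance gives every difference quotient the integral 0, and the Lipschitz
  bound dominates the quotients on a fixed ball. The almost everywhere form accommodates the kinks
  of a radial cutoff.\<close>

lemma integral_directional_derivative_eq_0:
  fixes G :: "'a::euclidean_space \<Rightarrow> real"
  assumes lip: "\<And>x y. \<bar>G x - G y\<bar> \<le> L * norm (x - y)"
    and supp: "\<And>x. 1 \<le> norm x \<Longrightarrow> G x = 0"
    and G': "G' \<in> borel_measurable borel"
      "AE x in lborel. ((\<lambda>t. G (x + t *\<^sub>R v)) has_real_derivative G' x) (at 0)"
  shows "(LINT x|lborel. G' x) = 0"
proof -
  have L0: "0 \<le> L"
  proof -
    obtain b :: 'a where "b \<in> Basis" using nonempty_Basis by blast
    then show ?thesis using lip[of b 0] by (simp add: norm_Basis)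
  qed
  have "L-lipschitz_on UNIV G" using lip L0 by (intro lipschitz_onI) (auto simp: dist_norm)
  then have Gc: "continuous_on UNIV G" by (rule lipschitz_on_continuous_on)
  then have Gm: "G \<in> borel_measurable borel" by (rule borel_measurable_continuous_onI)
  have Gi: "integrable lborel G"
    by (rule integrable_compact_support[OF Gc compact_cball[of 0 1]]) (auto intro: supp)
  define t where "t n = inverse (real (Suc n))" for n
  have t: "0 < t n" "t n \<le> 1" for n by (auto simp: t_def inverse_eq_divide)
  have t0: "t \<longlonglongrightarrow> 0" unfolding t_def by (rule LIMSEQ_inverse_real_of_nat)
  define Q where "Q n x = (G (x + t n *\<^sub>R v) - G x) / t n" for n x
  have shift: "(LINT x|lborel. G (x + t n *\<^sub>R v)) = (LINT x|lborel. G x)" for n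
    using lborel_integral_translation[OF Gm, of "t n *\<^sub>R v"] by (simp add: add.commute)
  have shc: "continuous_on UNIV (\<lambda>x. G (x + t n *\<^sub>R v))" for n
    by (intro continuous_on_compose2[OF Gc] continuous_intros) auto
  have shi: "integrable lborel (\<lambda>x. G (x + t n *\<^sub>R v))" for n
  proof (rule integrable_compact_support[OF shc compact_cball[of 0 "1 + norm v"]])
    fix x :: 'a assume "x \<notin> cball 0 (1 + norm v)"
    then have x: "1 + norm v < norm x" by simp
    have "norm x - norm (t n *\<^sub>R v) \<le> norm (x + t n *\<^sub>R v)" by (metis diff_minus_eq_add norm_minus_cancel norm_triangle_ineq2)
    moreover have "norm (t n *\<^sub>R v) \<le> norm v" using t[of n] by (simp add: mult_left_le_one_le)
    ultimately show "G (x + t n *\<^sub>R v) = 0" using x by (intro supp) linarith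
  qed
  have Q0: "(LINT x|lborel. Q n x) = 0" for n
    unfolding Q_def using shi[of n] Gi shift[of n] by simp
  have "(\<lambda>n. LINT x|lborel. Q n x) \<longlonglongrightarrow> (LINT x|lborel. G' x)"
  proof (rule integral_dominated_convergence[where w = "\<lambda>x. L * norm v * indicator (cball 0 (1 + norm v)) x"])
    show "G' \<in> borel_measurable lborel" using G' by simp
    show "Q n \<in> borel_measurable lborel" for n
      unfolding Q_def using borel_measurable_integrable[OF shi[of n]] Gm by auto
    show "integrable lborel (\<lambda>x::'a. L * norm v * indicator (cball 0 (1 + norm v)) x)"
      by (intro integrable_mult_right integrable_real_indicator) (auto simp: emeasure_compact_finite[OF compact_cball, simplified])
    show "AE x in lborel. (\<lambda>n. Q n x) \<longlonglongrightarrow> G' x"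
      using G'(2)
    proof eventually_elim
      case (elim x)
      then have "((\<lambda>h. (G (x + h *\<^sub>R v) - G x) / h) \<longlongrightarrow> G' x) (at 0)" by (simp add: DERIV_def)
      moreover have "filterlim t (at 0) sequentially"
        using t0 t(1) by (intro filterlim_atI) (auto simp: less_imp_neq[symmetric])
      ultimately show ?case unfolding Q_def by (rule filterlim_compose)
    qed
    show "AE x in lborel. norm (Q n x) \<le> L * norm v * indicator (cball 0 (1 + norm v)) x" for n
    proof (intro AE_I2)
      fix x :: 'a
      show "norm (Q n x) \<le> L * norm v * indicator (cball 0 (1 + norm v)) x"
      proof (cases "x \<in> cball 0 (1 + norm v)")
        case True
        have "\<bar>G (x + t n *\<^sub>R v) - G x\<bar> \<le> L * norm (t n *\<^sub>R v)" using lip[of "x + t n *\<^sub>R v" x] by simp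
        then have "\<bar>G (x + t n *\<^sub>R v) - G x\<bar> / t n \<le> L * norm v" using t(1)[of n] by (simp add: field_simps)
        then show ?thesis using True t(1)[of n] by (simp add: Q_def)
      next
        case False
        then have x: "1 + norm v < norm x" by simp
        have "norm x - norm (t n *\<^sub>R v) \<le> norm (x + t n *\<^sub>R v)" by (metis diff_minus_eq_add norm_minus_cancel norm_triangle_ineq2)
        moreover have "norm (t n *\<^sub>R v) \<le> norm v" using t[of n] by (simp add: mult_left_le_one_le)
        moreover have "1 < norm x" using x norm_ge_zero[of v] by linarith
        ultimately have "G (x + t n *\<^sub>R v) = 0" "G x = 0" using x by (auto intro!: supp)
        then show ?thesis using L0 by (simp add: Q_def)
      qed
    qed
  qed
  then show ?thesis unfolding Q0 by (simp add: LIMSEQ_const_iff)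
qed

lemma C1_lipschitz_on_cball:
  fixes u :: "'a::euclidean_space \<Rightarrow> real"
  assumes "times_differentiable 1 u"
  obtains K where "0 \<le> K" "\<And>x y. norm x \<le> r \<Longrightarrow> norm y \<le> r \<Longrightarrow> \<bar>u x - u y\<bar> \<le> K * norm (x - y)"
proof -
  let ?D = "\<lambda>z. frechet_derivative u (at z)"
  have der: "(u has_derivative ?D z) (at z)" for z
    using assms times_differentiable_SucD(1)[of 0 u] by simp
  have lin: "linear (?D z)" for z using der has_derivative_linear by blast
  have "continuous_on (cball 0 r) (\<lambda>z. \<Sum>b\<in>Basis. \<bar>?D z b\<bar>)"
    using assms times_differentiable_SucD(2)[of 0 u]
    by (intro continuous_intros) (auto intro: continuous_on_subset)
  then have "bounded ((\<lambda>z. \<Sum>b\<in>Basis. \<bar>?D z b\<bar>) ` cball 0 r)"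
    by (intro compact_imp_bounded compact_continuous_image) auto
  then obtain K where K: "\<forall>y\<in>(\<lambda>z. \<Sum>b\<in>Basis. \<bar>?D z b\<bar>) ` cball 0 r. norm y \<le> K"
    unfolding bounded_iff by blast
  have Db: "\<bar>?D z h\<bar> \<le> max K 0 * norm h" if "z \<in> cball 0 r" for z h
  proof -
    have "?D z h = (\<Sum>b\<in>Basis. (h \<bullet> b) * ?D z b)"
      using linear_sum[OF lin[of z], of "\<lambda>b. (h \<bullet> b) *\<^sub>R b" Basis] linear_cmul[OF lin[of z]]
      by (simp add: euclidean_representation)
    also have "\<bar>\<dots>\<bar> \<le> (\<Sum>b\<in>Basis. \<bar>(h \<bullet> b) * ?D z b\<bar>)" by (rule sum_abs)
    also have "\<dots> \<le> (\<Sum>b\<in>Basis. norm h * \<bar>?D z b\<bar>)"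
      by (intro sum_mono) (auto simp: abs_mult Basis_le_norm intro!: mult_right_mono)
    also have "\<dots> = (\<Sum>b\<in>Basis. \<bar>?D z b\<bar>) * norm h" by (simp add: sum_distrib_left mult.commute)
    also have "\<dots> \<le> max K 0 * norm h"
      using K that by (intro mult_right_mono) (force simp: le_max_iff_disj)+
    finally show ?thesis .
  qed
  show thesis
  proof (rule that[of "max K 0"])
    fix x y :: 'a assume "norm x \<le> r" "norm y \<le> r"
    then have "norm (u x - u y) \<le> max K 0 * norm (x - y)"
      by (intro differentiable_bound[where S = "cball 0 r" and f' = ?D])
        (auto intro!: onorm_le has_derivative_at_withinI[OF der] Db)
    then show "\<bar>u x - u y\<bar> \<le> max K 0 * norm (x - y)" by simp
  qed simp
qed


text \<open>Its gradient is the inward radial field of length \<open>1 / e\<close> on a shell of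
  width \<open>e\<close>, an approximation of the surface measure of the unit sphere.\<close>

definition ball_cutoff :: "real \<Rightarrow> 'a::real_normed_vector \<Rightarrow> real"
  where "ball_cutoff e x = max 0 (min 1 ((1 - norm x) / e))"

lemma ball_cutoff_lipschitz:
  assumes "0 < e"
  shows "\<bar>ball_cutoff e x - ball_cutoff e y\<bar> \<le> norm (x - y) / e"
proof -
  have "\<bar>ball_cutoff e x - ball_cutoff e y\<bar> \<le> \<bar>(1 - norm x) / e - (1 - norm y) / e\<bar>"
    unfolding ball_cutoff_def by (auto simp: max_def min_def)
  also have "\<dots> = \<bar>norm x - norm y\<bar> / e" using assms by (simp add: abs_minus_commute flip: diff_divide_distrib)
  also have "\<dots> \<le> norm (x - y) / e" using assms norm_triangle_ineq3[of x y] by (intro divide_right_mono) auto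
  finally show ?thesis .
qed

text \<open>\<open>u\<close> has a global Lipschitz bound on the unit ball only, and the cutoff
  vanishes outside; hence the split according to which points lie in the ball.\<close>

lemma ball_cutoff_mult_lipschitz:
  fixes u :: "'a::euclidean_space \<Rightarrow> real"
  assumes u: "times_differentiable 1 u" and e: "0 < e"
  obtains L where "\<And>x y. \<bar>ball_cutoff e x * u x - ball_cutoff e y * u y\<bar> \<le> L * norm (x - y)"
proof -
  let ?\<eta> = "ball_cutoff e :: 'a \<Rightarrow> real"
  obtain K where K: "0 \<le> K" "\<And>x y. norm x \<le> 1 \<Longrightarrow> norm y \<le> 1 \<Longrightarrow> \<bar>u x - u y\<bar> \<le> K * norm (x - y)"
    by (rule C1_lipschitz_on_cball[OF u, of 1]) blast
  define B where "B = \<bar>u 0\<bar> + K"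
  have B: "\<bar>u x\<bar> \<le> B" if "norm x \<le> 1" for x
  proof -
    have "\<bar>u x - u 0\<bar> \<le> K * norm (x - 0)" using K(2)[of x 0] that by simp
    also have "\<dots> \<le> K * 1" using that K(1) by (intro mult_left_mono) auto
    finally show ?thesis unfolding B_def by linarith
  qed
  have B0: "0 \<le> B" using K(1) by (simp add: B_def)
  have \<eta>1: "\<bar>?\<eta> x\<bar> \<le> 1" for x by (auto simp: ball_cutoff_def)
  have \<eta>0: "?\<eta> x = 0" if "1 < norm x" for x
    using that e by (auto simp: ball_cutoff_def max_def min_def divide_simps)
  have le: "\<bar>?\<eta> x * u x - ?\<eta> y * u y\<bar> \<le> (K + B / e) * norm (x - y)" if x: "norm x \<le> 1" for x y
  proof -
    have 1: "B * \<bar>?\<eta> x - ?\<eta> y\<bar> \<le> B / e * norm (x - y)"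
      using mult_left_mono[OF ball_cutoff_lipschitz[OF e, of x y] B0] by simp
    show ?thesis
    proof (cases "norm y \<le> 1")
      case True
      have "?\<eta> x * u x - ?\<eta> y * u y = ?\<eta> y * (u x - u y) + u x * (?\<eta> x - ?\<eta> y)" by (simp add: algebra_simps)
      also have "\<bar>\<dots>\<bar> \<le> \<bar>?\<eta> y\<bar> * \<bar>u x - u y\<bar> + \<bar>u x\<bar> * \<bar>?\<eta> x - ?\<eta> y\<bar>"
        by (metis abs_mult abs_triangle_ineq)
      also have "\<dots> \<le> 1 * (K * norm (x - y)) + B * \<bar>?\<eta> x - ?\<eta> y\<bar>"
        using K(2)[OF x True] B[OF x] \<eta>1 by (intro add_mono mult_mono) auto
      finally show ?thesis using 1 by (simp add: distrib_right)
    next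
      case False
      then have "?\<eta> y = 0" by (intro \<eta>0) simp
      then have "\<bar>?\<eta> x * u x - ?\<eta> y * u y\<bar> = \<bar>u x\<bar> * \<bar>?\<eta> x - ?\<eta> y\<bar>" by (simp add: abs_mult)
      also have "\<dots> \<le> B * \<bar>?\<eta> x - ?\<eta> y\<bar>" using B[OF x] by (intro mult_right_mono) auto
      also have "\<dots> \<le> K * norm (x - y) + B / e * norm (x - y)" using 1 K(1) by (simp add: add_increasing)
      finally show ?thesis by (simp add: distrib_right)
    qed
  qed
  show thesis
  proof (rule that[of "K + B / e"])
    fix x y :: 'a
    consider "norm x \<le> 1" | "norm y \<le> 1" | "1 < norm x" "1 < norm y" by linarith
    then show "\<bar>?\<eta> x * u x - ?\<eta> y * u y\<bar> \<le> (K + B / e) * norm (x - y)"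
    proof cases
      case 1
      then show ?thesis by (rule le)
    next
      case 2
      then show ?thesis using le[OF 2, of x] by (simp add: abs_minus_commute norm_minus_commute)
    next
      case 3
      then show ?thesis using K(1) B0 e by (simp add: \<eta>0)
    qed
  qed
qed

lemma integral_ball_cutoff_derivative:
  fixes u :: "'a::euclidean_space \<Rightarrow> real"
  assumes u: "times_differentiable 1 u" and e: "0 < e" "e < 1"
  shows "(LINT x:ball 0 1|lborel. ball_cutoff e x * frechet_derivative u (at x) v)
    = (LINT x:ball 0 1 - ball 0 (1 - e)|lborel. u x * inner x v / norm x) / e"
proof -
  let ?\<eta> = "ball_cutoff e :: 'a \<Rightarrow> real" and ?D = "\<lambda>x. frechet_derivative u (at x)"
  let ?S = "ball 0 1 - ball (0::'a) (1 - e)"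
  have der: "(u has_derivative ?D z) (at z)" for z
    using u times_differentiable_SucD(1)[of 0 u] by simp
  have Dc: "continuous_on A (\<lambda>x. ?D x v)" for A
    using u times_differentiable_SucD(2)[of 0 u v] by (auto intro: continuous_on_subset)
  have uc: "continuous_on A u" for A
    using u times_differentiable_Suc_imp[of 0 u] by (auto intro: continuous_on_subset)
  have \<eta>c: "continuous_on A ?\<eta>" for A unfolding ball_cutoff_def using e by (intro continuous_intros) auto
  have \<eta>0: "?\<eta> x = 0" if "1 \<le> norm x" for x
    using that e by (auto simp: ball_cutoff_def max_def min_def divide_simps)
  have \<eta>1: "?\<eta> x = 1" if "norm x \<le> 1 - e" for x
    using that e by (auto simp: ball_cutoff_def max_def min_def divide_simps)
  have \<eta>s: "?\<eta> x = (1 - norm x) / e" if "1 - e \<le> norm x" "norm x \<le> 1" for x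
    using that e by (auto simp: ball_cutoff_def max_def min_def divide_simps)
  define P where "P x = u x * inner x v / norm x" for x
  have Pm: "P \<in> borel_measurable borel" unfolding P_def
    using borel_measurable_continuous_onI[OF uc] by (intro borel_measurable_divide borel_measurable_times) auto
  \<comment> \<open>The product rule for the cutoff times \<open>u\<close>. It holds off the two
    spheres where the cutoff has kinks, and these are null sets.\<close>
  define G' where "G' x = indicator (ball 0 1) x * (?\<eta> x * ?D x v) - indicator ?S x * P x / e" for x
  obtain L where L: "\<And>x y. \<bar>?\<eta> x * u x - ?\<eta> y * u y\<bar> \<le> L * norm (x - y)"
    by (rule ball_cutoff_mult_lipschitz[OF u e(1)]) blast
  have "(LINT x|lborel. G' x) = 0"
  proof (rule integral_directional_derivative_eq_0[where G = "\<lambda>x. ?\<eta> x * u x" and v = v, OF L])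
    show "?\<eta> x * u x = 0" if "1 \<le> norm x" for x using \<eta>0[OF that] by simp
    show "G' \<in> borel_measurable borel" unfolding G'_def
      using borel_measurable_continuous_onI[OF \<eta>c] borel_measurable_continuous_onI[OF Dc] Pm
      by (intro borel_measurable_diff borel_measurable_divide borel_measurable_times borel_measurable_indicator) auto
    have null: "AE x in lborel. x \<notin> sphere (0::'a) r" for r
    proof -
      have "sphere (0::'a) r \<in> null_sets lborel"
        using negligible_sphere[of "0::'a" r] by (simp add: negligible_iff_null_sets null_sets_completion_iff)
      then show ?thesis by (rule AE_not_in)
    qed
    show "AE x in lborel. ((\<lambda>t. ?\<eta> (x + t *\<^sub>R v) * u (x + t *\<^sub>R v)) has_real_derivative G' x) (at 0)"
      using null[of 1] null[of "1 - e"]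
    proof eventually_elim
      case (elim x)
      have ut: "((\<lambda>t. u (x + t *\<^sub>R v)) has_real_derivative ?D x v) (at 0)"
      proof -
        have "((\<lambda>t. u (x + t *\<^sub>R v)) has_derivative (\<lambda>t. ?D x (t *\<^sub>R v))) (at 0)"
          by (rule has_derivative_compose[where f = "\<lambda>t. x + t *\<^sub>R v" and g = u])
            (auto intro!: derivative_eq_intros der)
        moreover have "?D x (t *\<^sub>R v) = ?D x v * t" for t
          using linear_cmul[OF has_derivative_linear[OF der[of x]], of t v] by simp
        ultimately show ?thesis by (simp add: has_field_derivative_def)
      qed
      have tr: "((\<lambda>t. ?\<eta> (x + t *\<^sub>R v)) has_real_derivative c) (at 0)"
        if "open U" "x \<in> U" "\<And>y. y \<in> U \<Longrightarrow> ?\<eta> y = f y"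
          "((\<lambda>t. f (x + t *\<^sub>R v)) has_real_derivative c) (at 0)" for U f c
      proof (rule has_field_derivative_transform_within_open[OF that(4)])
        have "open ((\<lambda>t. x + t *\<^sub>R v) -` U)"
          by (intro open_vimage that(1) continuous_intros)
        then show "open ((\<lambda>t. x + t *\<^sub>R v) -` U)" .
      qed (use that in auto)
      have op: "open {y::'a. norm y < 1 - e}" "open {y::'a. 1 < norm y}"
        "open {y::'a. 1 - e < norm y \<and> norm y < 1}"
        by (intro open_Collect_less open_Collect_conj continuous_intros)+
      consider "norm x < 1 - e" | "1 < norm x" | "1 - e < norm x" "norm x < 1"
        using elim by (auto simp: not_less) (metis less_eq_real_def linorder_not_less)
      then show ?case
      proof cases
        case 1
        have "((\<lambda>t. ?\<eta> (x + t *\<^sub>R v)) has_real_derivative 0) (at 0)"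
          by (rule tr[OF op(1), where f = "\<lambda>_. 1"]) (use 1 \<eta>1 in auto)
        from DERIV_mult[OF this ut] show ?thesis using 1 e by (simp add: G'_def mult.commute \<eta>1)
      next
        case 2
        have "((\<lambda>t. ?\<eta> (x + t *\<^sub>R v)) has_real_derivative 0) (at 0)"
          by (rule tr[OF op(2), where f = "\<lambda>_. 0"]) (use 2 \<eta>0 in auto)
        from DERIV_mult[OF this ut] show ?thesis using 2 by (simp add: G'_def \<eta>0)
      next
        case 3
        then have x0: "x \<noteq> 0" using e by auto
        have "((\<lambda>t. norm (x + t *\<^sub>R v)) has_derivative (\<lambda>t. inner (t *\<^sub>R v) (sgn x))) (at 0)"
          by (rule has_derivative_compose[where f = "\<lambda>t. x + t *\<^sub>R v" and g = norm])
            (use x0 in \<open>auto intro!: derivative_eq_intros has_derivative_norm\<close>)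
        then have "((\<lambda>t. norm (x + t *\<^sub>R v)) has_real_derivative inner x v / norm x) (at 0)"
          by (simp add: has_field_derivative_def sgn_div_norm inner_commute divide_inverse mult_ac fun_eq_iff[symmetric] mult_commute_abs)
        then have "((\<lambda>t. (1 - norm (x + t *\<^sub>R v)) / e) has_real_derivative (0 - inner x v / norm x) / e) (at 0)"
          by (intro DERIV_cdivide DERIV_diff DERIV_const)
        then have "((\<lambda>t. ?\<eta> (x + t *\<^sub>R v)) has_real_derivative (0 - inner x v / norm x) / e) (at 0)"
          by (rule tr[OF op(3), rotated 2]) (use 3 \<eta>s in auto)
        from DERIV_mult[OF this ut] show ?thesis using 3 by (simp add: G'_def P_def mult_ac)
      qed
    qed
  qed
  moreover have i1: "set_integrable lborel (ball 0 1) (\<lambda>x. ?\<eta> x * ?D x v)"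
    by (rule set_integrable_subset[OF set_integrable_compact[OF compact_cball[of 0 1]]])
      (auto intro!: continuous_intros \<eta>c Dc)
  moreover have i2: "set_integrable lborel ?S P"
  proof (rule set_integrable_subset[where A = "cball 0 1 - ball 0 (1 - e)"])
    have "continuous_on (cball 0 1 - ball 0 (1 - e)) P"
      unfolding P_def using e by (intro continuous_intros uc) auto
    then show "set_integrable lborel (cball 0 1 - ball 0 (1 - e)) P"
      by (intro set_integrable_compact compact_diff) auto
  qed auto
  moreover have "(LINT x|lborel. G' x)
      = (LINT x:ball 0 1|lborel. ?\<eta> x * ?D x v) - (LINT x:?S|lborel. P x) / e"
    unfolding G'_def set_lebesgue_integral_def using i1 i2[unfolded set_integrable_def]
    by (subst Bochner_Integration.integral_diff) (simp_all add: set_integrable_def)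
  ultimately show ?thesis unfolding P_def by simp
qed

text \<open>The integral of a \<open>0\<close>-homogeneous function over a shell is a multiple of its integral over
  the ball; as the shell shrinks to the sphere, this produces the surface measure.\<close>

theorem integral_directional_derivative_ball:
  fixes u :: "'a::euclidean_space \<Rightarrow> real"
  assumes u: "times_differentiable 1 u"
  shows "(LINT x:ball 0 1|lborel. frechet_derivative u (at x) v) = (LINT x|sphere_measure. u x * inner x v)"
proof -
  let ?D = "\<lambda>x. frechet_derivative u (at x) v" and ?d = "DIM('a)"
  \<comment> \<open>The shift by 2 keeps \<open>e n\<close> strictly below 1, so the ball removed
    from the shell has positive radius.\<close>
  define e where "e n = 1 / real (n + 2)" for n
  have e: "0 < e n" "e n < 1" for n by (auto simp: e_def)
  have e0: "e \<longlonglongrightarrow> 0"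
    unfolding e_def using LIMSEQ_ignore_initial_segment[OF lim_1_over_n, of 2] by simp
  have e0': "filterlim e (at 0) sequentially"
    using e0 e(1) by (intro filterlim_atI) (auto simp: less_imp_neq[symmetric])
  define S where "S n = ball 0 1 - ball (0::'a) (1 - e n)" for n
  have Dc: "continuous_on A ?D" for A
    using u times_differentiable_SucD(2)[of 0 u v] by (auto intro: continuous_on_subset)
  have uc: "continuous_on A u" for A
    using u times_differentiable_Suc_imp[of 0 u] by (auto intro: continuous_on_subset)
  have um: "u \<in> borel_measurable borel" by (rule borel_measurable_continuous_onI[OF uc])
  have Di: "set_integrable lborel (ball 0 1) ?D"
    by (rule set_integrable_subset[OF set_integrable_compact[OF compact_cball[of 0 1] Dc]]) auto
  have lhs: "(\<lambda>n. LINT x:ball 0 1|lborel. ball_cutoff (e n) x * ?D x) \<longlonglongrightarrow> (LINT x:ball 0 1|lborel. ?D x)"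
    unfolding set_lebesgue_integral_def
  proof (rule integral_dominated_convergence[where w = "\<lambda>x. \<bar>indicator (ball 0 1) x *\<^sub>R ?D x\<bar>"])
    show "integrable lborel (\<lambda>x. \<bar>indicator (ball 0 1) x *\<^sub>R ?D x\<bar>)"
      using Di unfolding set_integrable_def by simp
    show "(\<lambda>x. indicator (ball 0 1) x *\<^sub>R ?D x) \<in> borel_measurable lborel"
      using Di unfolding set_integrable_def by (rule borel_measurable_integrable)
    have "ball_cutoff (e n) \<in> borel_measurable borel" for n
      unfolding ball_cutoff_def by (intro borel_measurable_continuous_onI continuous_intros) (use e(1)[of n] in auto)
    then show "(\<lambda>x. indicator (ball 0 1) x *\<^sub>R (ball_cutoff (e n) x * ?D x)) \<in> borel_measurable lborel" for n
      using borel_measurable_continuous_onI[OF Dc]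
      by (intro borel_measurable_scaleR borel_measurable_indicator borel_measurable_times) auto
    show "AE x in lborel. (\<lambda>n. indicator (ball 0 1) x *\<^sub>R (ball_cutoff (e n) x * ?D x))
        \<longlonglongrightarrow> indicator (ball 0 1) x *\<^sub>R ?D x"
    proof (intro AE_I2)
      fix x :: 'a
      show "(\<lambda>n. indicator (ball 0 1) x *\<^sub>R (ball_cutoff (e n) x * ?D x)) \<longlonglongrightarrow> indicator (ball 0 1) x *\<^sub>R ?D x"
      proof (cases "norm x < 1")
        case True
        then have "\<forall>\<^sub>F n in sequentially. e n < 1 - norm x" by (intro order_tendstoD(2)[OF e0]) simp
        then have "\<forall>\<^sub>F n in sequentially. ball_cutoff (e n) x = 1"
        proof eventually_elim
          case (elim n)
          then show ?case using e(1)[of n] by (auto simp: ball_cutoff_def max_def min_def divide_simps)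
        qed
        then show ?thesis by (intro tendsto_eventually) (auto elim: eventually_mono)
      qed simp
    qed
    have "\<bar>ball_cutoff (e n) x\<bar> \<le> 1" for n and x :: 'a by (auto simp: ball_cutoff_def)
    then show "AE x in lborel. norm (indicator (ball 0 1) x *\<^sub>R (ball_cutoff (e n) x * ?D x)) \<le> \<bar>indicator (ball 0 1) x *\<^sub>R ?D x\<bar>" for n
      by (intro AE_I2) (auto simp: abs_mult indicator_def mult_left_le_one_le)
  qed
  define P where "P x = u x * inner x v / norm x" for x
  \<comment> \<open>\<open>P\<close> with \<open>u\<close> frozen at the radial projection. As
    \<open>Q\<close> is constant along rays, its integral over a shell follows exactly by scaling
    from the one over the ball.\<close>
  define Q where "Q x = u (x /\<^sub>R norm x) * inner (x /\<^sub>R norm x) v" for x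
  have Pm: "P \<in> borel_measurable borel" unfolding P_def using um by auto
  have nb: "(\<lambda>x::'a. x /\<^sub>R norm x) \<in> borel_measurable borel" by measurable
  have Qm: "Q \<in> borel_measurable borel" unfolding Q_def
    using measurable_compose[OF nb um] nb by (intro borel_measurable_times borel_measurable_inner) auto
  obtain K where K: "0 \<le> K" "\<And>x y. norm x \<le> 1 \<Longrightarrow> norm y \<le> 1 \<Longrightarrow> \<bar>u x - u y\<bar> \<le> K * norm (x - y)"
    by (rule C1_lipschitz_on_cball[OF u, of 1]) blast
  have n1: "norm (x /\<^sub>R norm x) \<le> 1" for x :: 'a by (cases "x = 0") auto
  define B where "B = (\<bar>u 0\<bar> + K) * norm v"
  have Qb: "\<bar>Q x\<bar> \<le> B" for x
  proof -
    have "\<bar>u (x /\<^sub>R norm x) - u 0\<bar> \<le> K * norm (x /\<^sub>R norm x - 0)" using K(2)[of "x /\<^sub>R norm x" 0] n1[of x] by simp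
    also have "\<dots> \<le> K * 1" using n1[of x] K(1) by (intro mult_left_mono) auto
    finally have 1: "\<bar>u (x /\<^sub>R norm x)\<bar> \<le> \<bar>u 0\<bar> + K" by linarith
    have "\<bar>inner (x /\<^sub>R norm x) v\<bar> \<le> norm (x /\<^sub>R norm x) * norm v" by (rule Cauchy_Schwarz_ineq2)
    also have "\<dots> \<le> 1 * norm v" by (intro mult_right_mono n1) auto
    finally show ?thesis unfolding Q_def B_def abs_mult using 1 K(1) by (intro mult_mono) auto
  qed
  have finb: "emeasure lborel (ball (0::'a) r) < \<infinity>" for r by (rule emeasure_lborel_ball_finite)
  have Qi: "integrable lborel (\<lambda>x. indicator A x * Q x)" if "A \<in> sets borel" "A \<subseteq> ball 0 1" for A
  proof (rule Bochner_Integration.integrable_bound)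
    show "integrable lborel (\<lambda>x. B * indicator (ball (0::'a) 1) x)"
      using finb[of 1] by (intro integrable_mult_right integrable_real_indicator) auto
    show "(\<lambda>x. indicator A x * Q x) \<in> borel_measurable lborel" using Qm that(1)
      by (intro borel_measurable_times borel_measurable_indicator) auto
    show "AE x in lborel. norm (indicator A x * Q x) \<le> norm (B * indicator (ball (0::'a) 1) x)"
      using Qb that(2) by (intro AE_I2) (auto simp: indicator_def intro: order_trans[OF _ abs_ge_self])
  qed
  define I where "I = (LINT x:ball 0 1|lborel. Q x)"
  have scale: "(LINT x|lborel. indicator (ball 0 s) x * Q x) = s ^ ?d * I" if s: "0 < s" for s
  proof -
    have "(\<lambda>x. indicator (ball 0 s) x * Q x) \<in> borel_measurable borel"
      using Qm by (intro borel_measurable_times borel_measurable_indicator) auto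
    then have "(LINT x|lborel. indicator (ball 0 s) x * Q x)
        = s ^ ?d * (LINT x|lborel. indicator (ball 0 s) (s *\<^sub>R x) * Q (s *\<^sub>R x))"
      using s by (rule lborel_integral_scaleR)
    also have "(\<lambda>x. indicator (ball 0 s) (s *\<^sub>R x) * Q (s *\<^sub>R x)) = (\<lambda>x. indicator (ball 0 1) x *\<^sub>R Q x)"
    proof
      fix x :: 'a
      have "inverse (s * norm x) * s = inverse (norm x)" using s by (cases "x = 0") (auto simp: field_simps)
      then have nx: "(s *\<^sub>R x) /\<^sub>R norm (s *\<^sub>R x) = x /\<^sub>R norm x" using s by (simp only: norm_scaleR abs_of_pos scaleR_scaleR)
      have "Q (s *\<^sub>R x) = Q x" unfolding Q_def nx ..
      moreover have "s *\<^sub>R x \<in> ball 0 s \<longleftrightarrow> x \<in> ball 0 1" using s by simp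
      ultimately show "indicator (ball 0 s) (s *\<^sub>R x) * Q (s *\<^sub>R x) = indicator (ball 0 1) x *\<^sub>R Q x"
        by (simp add: indicator_def)
    qed
    finally show ?thesis unfolding I_def set_lebesgue_integral_def by simp
  qed
  have Sm: "S n \<in> sets borel" for n by (simp add: S_def)
  have shellQ: "(LINT x:S n|lborel. Q x) = (1 - (1 - e n) ^ ?d) * I" for n
  proof -
    have "(LINT x:S n|lborel. Q x) = (LINT x|lborel. indicator (ball 0 1) x * Q x - indicator (ball 0 (1 - e n)) x * Q x)"
      unfolding set_lebesgue_integral_def S_def using e[of n]
      by (intro Bochner_Integration.integral_cong) (auto simp: indicator_def)
    also have "\<dots> = 1 ^ ?d * I - (1 - e n) ^ ?d * I"
      using e[of n] Qi[of "ball 0 1"] Qi[of "ball 0 (1 - e n)"] scale[of 1] scale[of "1 - e n"]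
      by (subst Bochner_Integration.integral_diff) (simp_all add: subset_ball)
    finally show ?thesis by (simp add: algebra_simps)
  qed
  have vol: "measure lborel (S n) = (1 - (1 - e n) ^ ?d) * unit_ball_vol (real ?d)" for n
  proof -
    have "measure lborel (S n) = measure lborel (ball (0::'a) 1) - measure lborel (ball (0::'a) (1 - e n))"
      unfolding S_def using e[of n] finb[of 1] by (intro measure_Diff) (auto simp: less_top)
    then show ?thesis using content_ball[of 1 "0::'a"] content_ball[of "1 - e n" "0::'a"] e[of n]
      by (simp add: algebra_simps)
  qed
  have Sfin: "emeasure lborel (S n) < \<infinity>" for n
  proof -
    have "emeasure lborel (S n) \<le> emeasure lborel (ball (0::'a) 1)"
      by (rule emeasure_mono) (auto simp: S_def)
    then show ?thesis using finb[of 1] by (rule le_less_trans)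
  qed
  have PQ: "\<bar>P x - Q x\<bar> \<le> K * norm v * e n" if "x \<in> S n" for n x
  proof -
    have x: "1 - e n \<le> norm x" "norm x < 1" "x \<noteq> 0" using that e[of n] by (auto simp: S_def)
    have "P x - Q x = (u x - u (x /\<^sub>R norm x)) * inner (x /\<^sub>R norm x) v"
      by (simp add: P_def Q_def algebra_simps divide_inverse)
    also have "\<bar>\<dots>\<bar> \<le> (K * norm (x - x /\<^sub>R norm x)) * (1 * norm v)"
      unfolding abs_mult
    proof (rule mult_mono)
      show "\<bar>u x - u (x /\<^sub>R norm x)\<bar> \<le> K * norm (x - x /\<^sub>R norm x)" using x n1[of x] by (intro K(2)) auto
      have "\<bar>inner (x /\<^sub>R norm x) v\<bar> \<le> norm (x /\<^sub>R norm x) * norm v" by (rule Cauchy_Schwarz_ineq2)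
      also have "\<dots> \<le> 1 * norm v" by (intro mult_right_mono n1) auto
      finally show "\<bar>inner (x /\<^sub>R norm x) v\<bar> \<le> 1 * norm v" .
    qed (use K(1) in auto)
    also have "norm (x - x /\<^sub>R norm x) = 1 - norm x"
    proof -
      have "x - x /\<^sub>R norm x = (1 - 1 / norm x) *\<^sub>R x" by (simp add: scaleR_diff_left divide_inverse)
      then have "norm (x - x /\<^sub>R norm x) = \<bar>(1 - 1 / norm x) * norm x\<bar>" by (simp add: abs_mult)
      then show ?thesis using x by (simp add: left_diff_distrib)
    qed
    also have "K * (1 - norm x) * (1 * norm v) \<le> K * e n * (1 * norm v)"
      using x K(1) by (intro mult_right_mono mult_left_mono) auto
    finally show ?thesis by (simp add: mult_ac)
  qed
  have Si: "integrable lborel (\<lambda>x. indicator (S n) x * P x)" for n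
  proof (rule Bochner_Integration.integrable_bound)
    show "integrable lborel (\<lambda>x. (B + K * norm v * e n) * indicator (S n) x)"
      using Sfin[of n] Sm[of n] by (intro integrable_mult_right integrable_real_indicator) auto
    show "(\<lambda>x. indicator (S n) x * P x) \<in> borel_measurable lborel" using Pm Sm[of n]
      by (intro borel_measurable_times borel_measurable_indicator) auto
    show "AE x in lborel. norm (indicator (S n) x * P x) \<le> norm ((B + K * norm v * e n) * indicator (S n) x)"
    proof (intro AE_I2)
      fix x
      show "norm (indicator (S n) x * P x) \<le> norm ((B + K * norm v * e n) * indicator (S n) x)"
        using PQ[of x n] Qb[of x] by (cases "x \<in> S n") auto
    qed
  qed
  \<comment> \<open>On the shell \<open>P\<close> and \<open>Q\<close> differ by a multiple of
    \<open>e n\<close>; after division by \<open>e n\<close> the error is a multiple of the volume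
    of the shell, which tends to 0.\<close>
  have diff: "\<bar>(LINT x:S n|lborel. P x) / e n - (1 - (1 - e n) ^ ?d) / e n * I\<bar>
      \<le> K * norm v * measure lborel (S n)" for n
  proof -
    have Qn: "integrable lborel (\<lambda>x. indicator (S n) x * Q x)" by (rule Qi[OF Sm]) (auto simp: S_def)
    have "(LINT x:S n|lborel. P x) - (LINT x:S n|lborel. Q x) = (LINT x|lborel. indicator (S n) x * P x - indicator (S n) x * Q x)"
      unfolding set_lebesgue_integral_def using Si[of n] Qn by simp
    also have "norm \<dots> \<le> (LINT x|lborel. (K * norm v * e n) * indicator (S n) x)"
    proof (rule Bochner_Integration.integral_norm_bound_integral)
      show "integrable lborel (\<lambda>x. indicator (S n) x * P x - indicator (S n) x * Q x)" using Si Qn by simp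
      show "integrable lborel (\<lambda>x. (K * norm v * e n) * indicator (S n) x)"
        using Sfin[of n] Sm[of n] by (intro integrable_mult_right integrable_real_indicator) auto
      show "norm (indicator (S n) x * P x - indicator (S n) x * Q x) \<le> (K * norm v * e n) * indicator (S n) x" for x
        using PQ[of x n] by (cases "x \<in> S n") auto
    qed
    also have "\<dots> = K * norm v * e n * measure lborel (S n)" using Sm[of n] by simp
    finally have "\<bar>(LINT x:S n|lborel. P x) - (1 - (1 - e n) ^ ?d) * I\<bar> \<le> K * norm v * measure lborel (S n) * e n"
      unfolding shellQ by (simp add: mult_ac)
    then have "\<bar>(LINT x:S n|lborel. P x) - (1 - (1 - e n) ^ ?d) * I\<bar> / e n \<le> K * norm v * measure lborel (S n)"
      using e[of n] by (simp add: divide_le_eq)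
    moreover have "(LINT x:S n|lborel. P x) / e n - (1 - (1 - e n) ^ ?d) / e n * I
        = ((LINT x:S n|lborel. P x) - (1 - (1 - e n) ^ ?d) * I) / e n"
      by (simp add: diff_divide_distrib left_diff_distrib)
    ultimately show ?thesis using e(1)[of n] by (simp only: abs_divide abs_of_pos)
  qed
  have vol0: "(\<lambda>n. measure lborel (S n)) \<longlonglongrightarrow> 0"
  proof -
    have "(\<lambda>n. (1 - (1 - e n) ^ ?d) * unit_ball_vol (real ?d)) \<longlonglongrightarrow> (1 - (1 - 0) ^ ?d) * unit_ball_vol (real ?d)"
      by (intro tendsto_intros e0)
    then show ?thesis unfolding vol by simp
  qed
  \<comment> \<open>The derivative of \<open>1 - (1 - t) ^ d\<close> at 0. Its value
    \<open>d\<close> is the factor in the definition of the surface measure.\<close>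
  have der: "(\<lambda>n. (1 - (1 - e n) ^ ?d) / e n) \<longlonglongrightarrow> real ?d"
  proof -
    have "((\<lambda>t::real. 1 - (1 - t) ^ ?d) has_real_derivative real ?d) (at 0)"
      by (auto intro!: derivative_eq_intros)
    then have "((\<lambda>t::real. (1 - (1 - t) ^ ?d) / t) \<longlongrightarrow> real ?d) (at 0)" by (simp add: DERIV_def)
    then show ?thesis using e0' by (rule filterlim_compose)
  qed
  have "(\<lambda>n. (LINT x:S n|lborel. P x) / e n - (1 - (1 - e n) ^ ?d) / e n * I) \<longlonglongrightarrow> 0"
  proof (rule Lim_null_comparison)
    show "\<forall>\<^sub>F n in sequentially. norm ((LINT x:S n|lborel. P x) / e n - (1 - (1 - e n) ^ ?d) / e n * I)
        \<le> K * norm v * measure lborel (S n)"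
      using diff by (intro always_eventually allI) (simp only: real_norm_def)
    show "(\<lambda>n. K * norm v * measure lborel (S n)) \<longlonglongrightarrow> 0" using tendsto_mult_right_zero[OF vol0] .
  qed
  from tendsto_add[OF this tendsto_mult[OF der tendsto_const[of I]]]
  have "(\<lambda>n. (LINT x:S n|lborel. P x) / e n) \<longlonglongrightarrow> real ?d * I" by simp
  moreover have "(LINT x:ball 0 1|lborel. ball_cutoff (e n) x * ?D x) = (LINT x:S n|lborel. P x) / e n" for n
    unfolding P_def S_def by (rule integral_ball_cutoff_derivative[OF u e])
  ultimately have "(LINT x:ball 0 1|lborel. ?D x) = real ?d * I"
    using LIMSEQ_unique[OF lhs] by simp
  also have "\<dots> = (LINT x|sphere_measure. u x * inner x v)"
    unfolding I_def Q_def using um by (subst integral_sphere_measure) auto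
  finally show ?thesis .
qed

section \<open>Tensors concentrated near a hyperplane\<close>

lemma ball_measure_integral_eq:
  fixes f :: "real^'n \<Rightarrow> real"
  assumes "f \<in> borel_measurable borel"
  shows "(LINT x|ball_measure. f x) = (LINT x:ball 0 1|lborel. f x)"
proof -
  have m: "(\<lambda>x. indicat_real (ball 0 1) x *\<^sub>R f x) \<in> borel_measurable lborel"
    using assms by (intro borel_measurable_scaleR borel_measurable_indicator) auto
  have "(LINT x|ball_measure. f x) = (LINT x|lebesgue. indicat_real (ball 0 1) x *\<^sub>R f x)"
    by (intro integral_restrict_space) simp
  also have "\<dots> = (LINT x|lborel. indicat_real (ball 0 1) x *\<^sub>R f x)" by (rule integral_completion[OF m])
  finally show ?thesis unfolding set_lebesgue_integral_def .
qed

lemma finite_measure_sphere_measure: "finite_measure (sphere_measure :: 'a::euclidean_space measure)"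
proof (rule finite_measureI)
  have "emeasure (sphere_measure :: 'a measure) (sphere 0 1) =
    of_nat DIM('a) * emeasure lborel {r *\<^sub>R a | r a. a \<in> sphere (0::'a) 1 \<and> 0 < r \<and> r < 1}"
    by (rule emeasure_sphere_measure) auto
  also have "\<dots> \<le> of_nat DIM('a) * emeasure lborel (ball (0::'a) 1)"
    by (intro mult_left_mono emeasure_mono) auto
  also have "\<dots> < \<infinity>"
    using emeasure_lborel_ball_finite[of "0::'a" 1] by (simp add: ennreal_mult_less_top of_nat_less_top)
  finally show "emeasure (sphere_measure :: 'a measure) (space sphere_measure) \<noteq> \<infinity>"
    by (simp add: space_sphere_measure)
qed

lemma integrable_sphere_measure_continuous:
  fixes f :: "'a::euclidean_space \<Rightarrow> 'b::{banach, second_countable_topology}"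
  assumes "continuous_on UNIV f"
  shows "integrable sphere_measure f"
proof -
  have "bounded (f ` sphere 0 1)"
    by (intro compact_imp_bounded compact_continuous_image continuous_on_subset[OF assms]) auto
  then obtain B where "\<forall>y\<in>f ` sphere 0 1. norm y \<le> B" unfolding bounded_iff by blast
  then show ?thesis
    by (intro finite_measure.integrable_const_bound[OF finite_measure_sphere_measure, of _ B] AE_I2
        borel_measurable_sphere_measure borel_measurable_continuous_onI assms)
      (auto simp: space_sphere_measure)
qed

text \<open>A test function vanishes on the sphere, so the field \<open>\<phi>\<close> times a basis
  vector has no boundary term. Symmetry of \<open>T\<close> exchanges the column found in the trace
  with the required row.\<close>

lemma divergence_free_if_normal_trace:
  fixes T :: "real^'n \<Rightarrow> real^'n^'n"
  assumes T: "L1_psd_tensor T" and g: "has_normal_trace T g"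
  shows "divergence_free T"
  unfolding divergence_free_def
proof (intro allI impI)
  fix i :: 'n and \<phi> :: "real^'n \<Rightarrow> real"
  assume \<phi>: "test_function \<phi>"
  let ?D = "\<lambda>x. frechet_derivative \<phi> (at x)"
  have sm: "smooth \<phi>" using \<phi> by (simp add: test_function_def)
  have der: "(\<phi> has_derivative ?D x) (at x)" for x
    using sm times_differentiable_SucD(1)[of 0 \<phi>] unfolding smooth_def by blast
  define \<psi> where "\<psi> x = (\<chi> k. (if k = i then 1 else 0) * \<phi> x)" for x
  have \<psi>s: "smooth \<psi>"
    unfolding smooth_def \<psi>_def using sm unfolding smooth_def
    by (intro allI times_differentiable_vec times_differentiable_mult times_differentiable_const) auto
  have jac: "jacobian \<psi> (at x) $ b $ a = (if b = i then ?D x (axis a 1) else 0)" for x a b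
  proof -
    have "((\<lambda>x. \<phi> x *\<^sub>R (axis i 1 :: real^'n)) has_derivative (\<lambda>v. ?D x v *\<^sub>R axis i 1)) (at x)"
      by (intro has_derivative_scaleR_left der)
    moreover have "\<psi> = (\<lambda>x. \<phi> x *\<^sub>R axis i 1)" by (auto simp: \<psi>_def fun_eq_iff vec_eq_iff axis_def)
    ultimately have "frechet_derivative \<psi> (at x) = (\<lambda>v. ?D x v *\<^sub>R axis i 1)"
      using frechet_derivative_at by metis
    then show ?thesis by (simp add: jacobian_def matrix_def axis_def)
  qed
  have Ti: "integrable ball_measure T" using T by (simp add: L1_psd_tensor_def)
  have psd: "AE x in ball_measure. T x \<in> psd_matrices" using T by (simp add: L1_psd_tensor_def)
  have int: "integrable ball_measure (\<lambda>x. T x $ i $ j * ?D x (axis j 1))" for j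
  proof -
    have bl: "bounded_linear (\<lambda>A::real^'n^'n. A $ i $ j)"
      using bounded_linear_compose[OF bounded_linear_vec_nth bounded_linear_vec_nth] .
    have c: "continuous_on A (\<lambda>x. ?D x (axis j 1))" for A
      using continuous_on_jacobian[OF \<psi>s, of A i j] by (simp add: jac)
    then have "bounded ((\<lambda>x. ?D x (axis j 1)) ` cball 0 1)"
      by (intro compact_imp_bounded compact_continuous_image) auto
    then obtain B where B: "\<forall>y\<in>(\<lambda>x. ?D x (axis j 1)) ` cball 0 1. norm y \<le> B"
      unfolding bounded_iff by blast
    show ?thesis
    proof (rule integrable_mult_bounded[OF integrable_bounded_linear[OF bl Ti], where B = B])
      show "(\<lambda>x. ?D x (axis j 1)) \<in> borel_measurable ball_measure"
        by (intro continuous_imp_measurable_on_sets_lebesgue c) simp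
    qed (use B in auto)
  qed
  have "(\<Sum>j\<in>UNIV. LINT x|ball_measure. T x $ i $ j * ?D x (axis j 1))
      = (LINT x|ball_measure. (\<Sum>j\<in>UNIV. T x $ i $ j * ?D x (axis j 1)))"
    using int by (subst Bochner_Integration.integral_sum) auto
  also have "\<dots> = (LINT x|ball_measure. trace (T x ** jacobian \<psi> (at x)))"
  proof (rule Bochner_Integration.integral_cong_AE)
    show "(\<lambda>x. \<Sum>j\<in>UNIV. T x $ i $ j * ?D x (axis j 1)) \<in> borel_measurable ball_measure"
      using int by (intro borel_measurable_integrable Bochner_Integration.integrable_sum) auto
    show "(\<lambda>x. trace (T x ** jacobian \<psi> (at x))) \<in> borel_measurable ball_measure"
      by (intro borel_measurable_integrable integrable_trace_mult_jacobian Ti \<psi>s)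
    show "AE x in ball_measure. (\<Sum>j\<in>UNIV. T x $ i $ j * ?D x (axis j 1)) = trace (T x ** jacobian \<psi> (at x))"
      using psd
    proof eventually_elim
      case (elim x)
      have "T x $ a $ i = T x $ i $ a" for a
        using elim unfolding psd_matrices_def transpose_def by (auto simp: vec_eq_iff)
      then show ?case
        by (simp add: trace_def matrix_matrix_mult_def jac if_distrib cong: if_cong)
    qed
  qed
  also have "\<dots> = (LINT x|sphere_measure. inner (g x) (\<psi> x))"
    using g \<psi>s unfolding has_normal_trace_def by blast
  also have "\<dots> = integral\<^sup>L sphere_measure (\<lambda>x::real^'n. 0::real)"
  proof (rule Bochner_Integration.integral_cong[OF refl])
    fix x :: "real^'n" assume "x \<in> space sphere_measure"
    then have n: "norm x = 1" by (simp add: space_sphere_measure)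
    have "closure {x. \<phi> x \<noteq> 0} \<subseteq> ball 0 1" using \<phi> unfolding test_function_def by simp
    then have sub: "{x. \<phi> x \<noteq> 0} \<subseteq> ball 0 1" by (rule order_trans[OF closure_subset])
    have "\<phi> x = 0"
    proof (rule ccontr)
      assume "\<phi> x \<noteq> 0"
      then have "x \<in> ball 0 1" using sub by auto
      then show False using n by simp
    qed
    then show "inner (g x) (\<psi> x) = 0" by (simp add: \<psi>_def inner_vec_def)
  qed
  finally show "(\<Sum>j\<in>UNIV. LINT x|ball_measure. T x $ i $ j * ?D x (axis j 1)) = 0" by simp
qed

text \<open>The Gaussian profile allows two simple comparisons: scaling \<open>x\<close> by 2
  amounts to doubling \<open>c\<close>, and a power with exponent at most 4 is at least
  \<open>slab n (2 * c)\<close>, which is the fourth power.\<close>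

definition slab :: "real^'n \<Rightarrow> real \<Rightarrow> real^'n \<Rightarrow> real"
  where "slab n c x = exp (- (c * inner x n)\<^sup>2)"

lemma slab_bounds: "0 < slab n c x" "slab n c x \<le> 1"
  by (auto simp: slab_def)

lemma continuous_on_slab: "continuous_on A (slab n c)"
  unfolding slab_def by (intro continuous_intros)

lemma has_derivative_slab:
  "(slab n c has_derivative (\<lambda>v. - (2 * c\<^sup>2 * inner x n * slab n c x) * inner v n)) (at x)"
  unfolding slab_def
  by (auto intro!: derivative_eq_intros simp: power2_eq_square)

text \<open>Every row of \<open>S\<close> is orthogonal to \<open>n\<close>, so the profile is
  constant along it. The divergence theorem in the direction \<open>S$b\<close> is applied for each
  \<open>b\<close> to the profile times a component of \<open>\<psi>\<close>; the outward normal at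
  a point \<open>x\<close> of the sphere is \<open>x\<close>.\<close>

lemma slab_tensor:
  fixes S :: "real^'n^'n"
  assumes S: "S \<in> psd_matrices" "S *v n = 0"
  shows "L1_psd_tensor (\<lambda>x. slab n c x *\<^sub>R S)"
    and "has_normal_trace (\<lambda>x. slab n c x *\<^sub>R S) (\<lambda>x. slab n c x *\<^sub>R (S *v x))"
proof -
  have sym: "S$i$j = S$j$i" for i j
    using S(1) unfolding psd_matrices_def transpose_def by (auto simp: vec_eq_iff)
  have "integrable ball_measure (slab n c)"
    by (intro finite_measure.integrable_const_bound[OF finite_measure_ball_measure, of _ 1] AE_I2
      continuous_imp_measurable_on_sets_lebesgue continuous_on_slab) (auto simp: abs_of_pos slab_bounds)
  then have int: "integrable ball_measure (\<lambda>x. slab n c x *\<^sub>R S)" by (rule integrable_scaleR_left)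
  have "slab n c x *\<^sub>R S \<in> psd_matrices" for x
    using S(1) slab_bounds(1)[of n c x] unfolding psd_matrices_def
    by (auto simp: transpose_scalar scaleR_matrix_vector_assoc[symmetric] intro!: mult_nonneg_nonneg)
  then show "L1_psd_tensor (\<lambda>x. slab n c x *\<^sub>R S)"
    unfolding L1_psd_tensor_def using int by simp
  have gc: "continuous_on UNIV (\<lambda>x. slab n c x *\<^sub>R (S *v x))"
    by (intro continuous_intros continuous_on_slab linear_continuous_on matrix_vector_mul_bounded_linear)
  show "has_normal_trace (\<lambda>x. slab n c x *\<^sub>R S) (\<lambda>x. slab n c x *\<^sub>R (S *v x))"
    unfolding has_normal_trace_def
  proof (intro conjI allI impI integrable_sphere_measure_continuous gc)
    fix \<psi> :: "real^'n \<Rightarrow> real^'n" assume \<psi>: "smooth \<psi>"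
    let ?J = "\<lambda>x. jacobian \<psi> (at x)"
    have \<psi>1: "times_differentiable 1 \<psi>" using \<psi> by (simp only: smooth_def)
    have \<psi>c: "continuous_on A \<psi>" for A using times_differentiable_Suc_imp[of 0 \<psi>] \<psi>1
      by (auto intro: continuous_on_subset)
    have \<psi>d: "(\<psi> has_derivative (\<lambda>v. ?J x *v v)) (at x)" for x
    proof -
      have "\<psi> differentiable (at x)" using \<psi> unfolding smooth_def by (metis times_differentiable.simps(2))
      then show ?thesis by (simp add: jacobian_works)
    qed
    define u where "u b x = slab n c x * \<psi> x $ b" for b x
    have Sbn: "inner (S$b) n = 0" for b
      using S(2) by (metis matrix_vector_mul_component zero_index)
    have ud: "(u b has_derivative (\<lambda>v. slab n c x * (?J x *v v) $ b + - (2 * c\<^sup>2 * inner x n * slab n c x) * inner v n * \<psi> x $ b)) (at x)" for b x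
      unfolding u_def using bounded_linear.has_derivative[OF bounded_linear_vec_nth \<psi>d]
      by (intro has_derivative_mult has_derivative_slab) auto
    have uD: "frechet_derivative (u b) (at x) v = slab n c x * (?J x *v v) $ b + - (2 * c\<^sup>2 * inner x n * slab n c x) * inner v n * \<psi> x $ b" for b x v
      by (simp only: frechet_derivative_at[OF ud, symmetric])
    have Jc: "continuous_on A (\<lambda>x. (?J x *v v) $ b)" for A b v
      unfolding matrix_vector_mult_def by (simp add: continuous_on_sum continuous_on_mult_right continuous_on_jacobian[OF \<psi>])
    have u1: "times_differentiable 1 (u b)" for b
      unfolding One_nat_def
      by (rule times_differentiable_SucI[OF ud])
        (auto intro!: continuous_intros continuous_on_slab Jc \<psi>c)
    have key: "(LINT x|ball_measure. slab n c x * (?J x *v S$b) $ b)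
        = (LINT x|sphere_measure. u b x * inner x (S$b))" for b
    proof -
      have "(LINT x|ball_measure. slab n c x * (?J x *v S$b) $ b)
          = (LINT x:ball 0 1|lborel. slab n c x * (?J x *v S$b) $ b)"
        by (intro ball_measure_integral_eq borel_measurable_continuous_onI continuous_intros continuous_on_slab Jc)
      also have "\<dots> = (LINT x:ball 0 1|lborel. frechet_derivative (u b) (at x) (S$b))"
        by (simp add: uD Sbn)
      also have "\<dots> = (LINT x|sphere_measure. u b x * inner x (S$b))"
        by (rule integral_directional_derivative_ball[OF u1])
      finally show ?thesis .
    qed
    have bi: "integrable ball_measure (\<lambda>x. slab n c x * (?J x *v S$b) $ b)" for b
    proof -
      have cc: "continuous_on A (\<lambda>x. slab n c x * (?J x *v S$b) $ b)" for A
        by (intro continuous_intros continuous_on_slab Jc)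
      have "bounded ((\<lambda>x. slab n c x * (?J x *v S$b) $ b) ` cball 0 1)"
        by (intro compact_imp_bounded compact_continuous_image cc) auto
      then obtain B where "\<forall>y\<in>(\<lambda>x. slab n c x * (?J x *v S$b) $ b) ` cball 0 1. norm y \<le> B"
        unfolding bounded_iff by blast
      then show ?thesis
        by (intro finite_measure.integrable_const_bound[OF finite_measure_ball_measure, of _ B] AE_I2
            continuous_imp_measurable_on_sets_lebesgue cc) auto
    qed
    have tr: "trace ((slab n c x *\<^sub>R S) ** ?J x) = (\<Sum>b\<in>UNIV. slab n c x * (?J x *v S$b) $ b)" for x
    proof -
      have "trace ((slab n c x *\<^sub>R S) ** ?J x) = (\<Sum>a\<in>UNIV. \<Sum>b\<in>UNIV. slab n c x * S$a$b * ?J x $ b $ a)"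
        by (simp add: trace_def matrix_matrix_mult_def)
      also have "\<dots> = (\<Sum>b\<in>UNIV. \<Sum>a\<in>UNIV. slab n c x * S$a$b * ?J x $ b $ a)" by (rule sum.swap)
      finally show ?thesis by (simp add: matrix_vector_mult_def sum_distrib_left sym mult_ac)
    qed
    have si: "integrable sphere_measure (\<lambda>x. u b x * inner x (S$b))" for b
      unfolding u_def by (intro integrable_sphere_measure_continuous continuous_intros continuous_on_slab \<psi>c)
    have "(LINT x|ball_measure. trace ((slab n c x *\<^sub>R S) ** ?J x))
        = (\<Sum>b\<in>UNIV. LINT x|ball_measure. slab n c x * (?J x *v S$b) $ b)"
      unfolding tr using bi by (intro Bochner_Integration.integral_sum)
    also have "\<dots> = (LINT x|sphere_measure. (\<Sum>b\<in>UNIV. u b x * inner x (S$b)))"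
      unfolding key using si by (intro Bochner_Integration.integral_sum[symmetric])
    also have "(\<lambda>x. \<Sum>b\<in>UNIV. u b x * inner x (S$b)) = (\<lambda>x. inner (slab n c x *\<^sub>R (S *v x)) (\<psi> x))"
      by (rule ext) (simp add: u_def inner_vec_def[of "S *v _"] matrix_vector_mul_component sum_distrib_left inner_commute[of "S $ _"] mult_ac)
    finally show "(LINT x|ball_measure. trace ((slab n c x *\<^sub>R S) ** ?J x))
        = (LINT x|sphere_measure. inner (slab n c x *\<^sub>R (S *v x)) (\<psi> x))" .
  qed
qed

section \<open>Mass of a slab in the ball and on the sphere\<close>

definition slab_mass :: "real^'n \<Rightarrow> real \<Rightarrow> real"
  where "slab_mass n c = (LINT x:ball 0 1|lborel. slab n c x)"

lemma set_integrable_slab: "A \<in> sets borel \<Longrightarrow> A \<subseteq> cball 0 1 \<Longrightarrow> set_integrable lborel A (slab n c)"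
  by (rule set_integrable_subset[OF set_integrable_compact[OF compact_cball[of 0 1] continuous_on_slab]]) auto

lemma slab_mass_pos: "0 < slab_mass n c"
proof -
  define \<delta> where "\<delta> = exp (- (c * norm n)\<^sup>2)"
  have "\<delta> \<le> slab n c x" if "x \<in> ball 0 1" for x
  proof -
    have "\<bar>inner x n\<bar> \<le> norm x * norm n" by (rule Cauchy_Schwarz_ineq2)
    also have "\<dots> \<le> 1 * norm n" using that by (intro mult_right_mono) auto
    finally have "\<bar>c * inner x n\<bar> \<le> \<bar>c * norm n\<bar>" by (simp add: abs_mult mult_left_mono)
    then have "(c * inner x n)\<^sup>2 \<le> (c * norm n)\<^sup>2" by (simp only: abs_le_square_iff)
    then show ?thesis by (simp add: slab_def \<delta>_def)
  qed
  then have "(LINT x:ball (0::real^'a) 1|lborel. \<delta>) \<le> slab_mass n c"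
    unfolding slab_mass_def
    by (intro set_integral_mono set_integrable_slab) 
      (auto intro!: set_integrable_subset[OF set_integrable_compact[OF compact_cball[of 0 1]]] continuous_intros)
  moreover have "(LINT x:ball (0::real^'a) 1|lborel. \<delta>) = \<delta> * measure lborel (ball (0::real^'a) 1)"
    by (simp add: set_lebesgue_integral_def)
  moreover have "0 < \<delta> * measure lborel (ball (0::real^'a) 1)"
    using content_ball[of 1 "0::real^'a"] by (simp add: \<delta>_def)
  ultimately show ?thesis by linarith
qed

text \<open>The substitution of \<open>2 x\<close> for \<open>x\<close> replaces the unit ball by
  the half ball and \<open>c\<close> by \<open>2 * c\<close>. This comparison of the mass with
  itself stands in for its asymptotics in \<open>c\<close>.\<close>

lemma slab_mass_double:
  fixes n :: "real^'n"
  shows "slab_mass n c \<le> 2 ^ CARD('n) * slab_mass n (2 * c)"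
proof -
  have m: "(\<lambda>x. indicator (ball 0 1) x * slab n c x) \<in> borel_measurable borel"
    using borel_measurable_continuous_onI[OF continuous_on_slab] by (intro borel_measurable_times borel_measurable_indicator) auto
  have "slab_mass n c = (LINT x|lborel. indicator (ball 0 1) x * slab n c x)"
    by (simp add: slab_mass_def set_lebesgue_integral_def)
  also have "\<dots> = 2 ^ CARD('n) * (LINT x|lborel. indicator (ball 0 1) (2 *\<^sub>R x) * slab n c (2 *\<^sub>R x))"
    using lborel_integral_scaleR[OF m, of 2] by simp
  also have "(\<lambda>x. indicator (ball 0 1) (2 *\<^sub>R x) * slab n c (2 *\<^sub>R x)) = (\<lambda>x. indicator (ball 0 (1 / 2)) x * slab n (2 * c) x)"
    by (auto simp: fun_eq_iff indicator_def slab_def mult_ac)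
  also have "(LINT x|lborel. indicator (ball 0 (1 / 2)) x * slab n (2 * c) x) \<le> slab_mass n (2 * c)"
    unfolding slab_mass_def set_lebesgue_integral_def
    using set_integrable_slab[of "ball 0 (1/2)" n "2 * c"] set_integrable_slab[of "ball 0 1" n "2 * c"]
    by (intro integral_mono) (auto simp: set_integrable_def indicator_def slab_def subset_iff)
  finally show ?thesis by simp
qed

lemma slab_mass_tendsto_0:
  fixes n :: "real^'n"
  assumes "n \<noteq> 0"
  shows "(\<lambda>k. slab_mass n (real k)) \<longlonglongrightarrow> 0"
proof -
  have "(\<lambda>k. LINT x|lborel. indicator (ball 0 1) x *\<^sub>R slab n (real k) x) \<longlonglongrightarrow> integral\<^sup>L lborel (\<lambda>x::real^'n. 0::real)"
  proof (rule integral_dominated_convergence[where w = "indicator (ball 0 1)"])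
    show "(\<lambda>x. indicator (ball 0 1) x *\<^sub>R slab n (real k) x) \<in> borel_measurable lborel" for k
      using set_integrable_slab[of "ball 0 1" n "real k"] unfolding set_integrable_def
      by (intro borel_measurable_integrable) auto
    show "integrable lborel (indicat_real (ball (0::real^'n) 1))"
      using emeasure_lborel_ball_finite[of "0::real^'n" 1] by (intro integrable_real_indicator) auto
    have "{x. inner n x = 0} \<in> null_sets lborel"
      using negligible_hyperplane[of n 0] assms
      by (simp add: negligible_iff_null_sets null_sets_completion_iff closed_hyperplane borel_closed)
    then have "AE x in lborel. x \<notin> {x. inner n x = 0}" by (rule AE_not_in)
    then show "AE x in lborel. (\<lambda>k. indicator (ball 0 1) x *\<^sub>R slab n (real k) x) \<longlonglongrightarrow> 0"
    proof eventually_elim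
      case (elim x)
      then have i: "0 < \<bar>inner x n\<bar>" by (simp add: inner_commute)
      have q: "filterlim (\<lambda>k. real k * \<bar>inner x n\<bar>) at_top sequentially"
        by (rule filterlim_at_top_mult_tendsto_pos[OF tendsto_const i filterlim_real_sequentially])
      then have "filterlim (\<lambda>k. (real k * \<bar>inner x n\<bar>)\<^sup>2) at_top sequentially"
        by (intro filterlim_pow_at_top) auto
      then have "filterlim (\<lambda>k. - ((real k * \<bar>inner x n\<bar>)\<^sup>2)) at_bot sequentially"
        by (simp add: filterlim_uminus_at_top)
      then have "(\<lambda>k. exp (- ((real k * \<bar>inner x n\<bar>)\<^sup>2))) \<longlonglongrightarrow> 0"
        by (rule filterlim_compose[OF exp_at_bot])
      then have "(\<lambda>k. slab n (real k) x) \<longlonglongrightarrow> 0" by (simp add: slab_def power_mult_distrib)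
      then show ?case using tendsto_mult_right_zero by (auto simp: indicator_def)
    qed
    show "AE x in lborel. norm (indicator (ball 0 1) x *\<^sub>R slab n (real k) x) \<le> indicator (ball 0 1) x" for k
      by (intro AE_I2) (auto simp: indicator_def slab_def)
  qed auto
  then show ?thesis by (simp add: slab_mass_def set_lebesgue_integral_def)
qed

text \<open>Moving a point of the ball radially out to the sphere does not decrease
  \<open>\<bar>inner x n\<bar>\<close>, hence does not increase the Gaussian.\<close>

lemma slab_sphere_integral_le:
  fixes n :: "real^'n"
  shows "(LINT x|sphere_measure. slab n c x) \<le> real CARD('n) * slab_mass n c"
proof -
  have m: "slab n c \<in> borel_measurable borel" by (rule borel_measurable_continuous_onI[OF continuous_on_slab])
  have nb: "(\<lambda>x::real^'n. x /\<^sub>R norm x) \<in> borel_measurable borel" by measurable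
  have fin: "emeasure lborel (ball (0::real^'n) 1) < \<infinity>" by (rule emeasure_lborel_ball_finite)
  have "(LINT x:ball 0 1|lborel. slab n c (x /\<^sub>R norm x)) \<le> slab_mass n c"
    unfolding slab_mass_def
  proof (rule set_integral_mono)
    show "set_integrable lborel (ball 0 1) (\<lambda>x. slab n c (x /\<^sub>R norm x))"
      unfolding set_integrable_def
    proof (rule Bochner_Integration.integrable_bound)
      show "integrable lborel (indicat_real (ball (0::real^'n) 1))" using fin by (intro integrable_real_indicator) auto
      show "(\<lambda>x. indicator (ball 0 1) x *\<^sub>R slab n c (x /\<^sub>R norm x)) \<in> borel_measurable lborel"
        using measurable_compose[OF nb m] by (intro borel_measurable_scaleR borel_measurable_indicator) auto
      show "AE x in lborel. norm (indicator (ball 0 1) x *\<^sub>R slab n c (x /\<^sub>R norm x)) \<le> norm (indicat_real (ball 0 1) x)"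
        by (intro AE_I2) (auto simp: indicator_def slab_def)
    qed
    show "set_integrable lborel (ball 0 1) (slab n c)" by (rule set_integrable_slab) auto
    fix x :: "real^'n" assume x: "x \<in> ball 0 1"
    show "slab n c (x /\<^sub>R norm x) \<le> slab n c x"
    \<comment> \<open>At the origin the radial projection is again 0, by the convention for
      division, and the two sides agree.\<close>
    proof (cases "x = 0")
      case False
      have "\<bar>inner x n\<bar> \<le> \<bar>inner x n\<bar> / norm x" using x False by (simp add: pos_le_divide_eq mult_left_le)
      also have "\<dots> = \<bar>inner (x /\<^sub>R norm x) n\<bar>" by (simp add: abs_mult divide_inverse mult.commute)
      finally have "\<bar>c * inner x n\<bar> \<le> \<bar>c * inner (x /\<^sub>R norm x) n\<bar>"
        by (simp only: abs_mult mult_left_mono abs_ge_zero)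
      then have "(c * inner x n)\<^sup>2 \<le> (c * inner (x /\<^sub>R norm x) n)\<^sup>2" by (simp only: abs_le_square_iff)
      then show ?thesis by (simp add: slab_def)
    qed simp
  qed
  then show ?thesis using integral_sphere_measure[OF m] by simp
qed

text \<open>By homogeneity \<open>f\<close> of the tensor is \<open>slab n c x powr p * f S\<close>,
  at least \<open>f S * slab n (2 * c) x\<close>, while the flux is at most a multiple of
  \<open>slab_mass n c\<close>. Doubling brings both sides to the same \<open>c\<close>; division by
  the mass leaves its power \<open>p - 1 > 0\<close>, which tends to 0.\<close>

theorem maximal_gain_singular_eq_0:
  fixes f :: "real^'n^'n \<Rightarrow> real" and S :: "real^'n^'n"
  assumes d: "2 \<le> CARD('n)" and f: "displays_maximal_gain f"
    and S: "S \<in> psd_matrices" "S *v n = 0" "n \<noteq> 0"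
  shows "f S = 0"
proof -
  define p where "p = real CARD('n) / (real CARD('n) - 1)"
  have p: "1 < p" "p \<le> 2" using d by (auto simp: p_def field_simps)
  obtain C where C: "0 \<le> C" "\<And>T g. L1_psd_tensor T \<Longrightarrow> divergence_free T \<Longrightarrow> has_normal_trace T g \<Longrightarrow>
        (\<integral>\<^sup>+ x. ennreal (f (T x)) \<partial>ball_measure) \<le> ennreal (C * (LINT x|sphere_measure. norm (g x)) powr p)"
    and fS: "0 \<le> f S" and hom: "\<And>t. 0 < t \<Longrightarrow> f (t *\<^sub>R S) = t powr p * f S"
    using f S(1) unfolding displays_maximal_gain_def Let_def p_def by blast
  obtain M where M: "0 < M" "\<And>x. norm (S *v x) \<le> M * norm x"
    using bounded_linear.pos_bounded[OF matrix_vector_mul_bounded_linear[of S]] by (auto simp: mult.commute)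
  define c0 where "c0 = C * (M * real CARD('n)) powr p"
  have main: "f S * slab_mass n (2 * c) \<le> c0 * slab_mass n c powr p" for c
  proof -
    let ?T = "\<lambda>x. slab n c x *\<^sub>R S" and ?g = "\<lambda>x. slab n c x *\<^sub>R (S *v x)"
    note T = slab_tensor[OF S(1,2), of c]
    have sm: "slab n (2 * c) \<in> borel_measurable borel" by (rule borel_measurable_continuous_onI[OF continuous_on_slab])
    have mb: "(\<lambda>x. f S * slab n (2 * c) x) \<in> borel_measurable borel" using sm by simp
    have le: "f S * slab n (2 * c) x \<le> f (?T x)" for x
    proof -
      have "slab n (2 * c) x \<le> slab n c x powr p"
      proof -
        have "p * (c * inner x n)\<^sup>2 \<le> 4 * (c * inner x n)\<^sup>2" using p by (intro mult_right_mono) auto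
        then show ?thesis by (simp add: slab_def powr_def power_mult_distrib)
      qed
      then have "f S * slab n (2 * c) x \<le> f S * slab n c x powr p" using fS by (rule mult_left_mono)
      also have "\<dots> = f (?T x)" by (subst hom[OF slab_bounds(1)]) (rule mult.commute)
      finally show ?thesis .
    qed
    have "ennreal (f S * slab_mass n (2 * c)) = ennreal (LINT x|ball_measure. f S * slab n (2 * c) x)"
      unfolding ball_measure_integral_eq[OF mb] slab_mass_def by simp
    also have "\<dots> = (\<integral>\<^sup>+ x. ennreal (f S * slab n (2 * c) x) \<partial>ball_measure)"
    proof (rule nn_integral_eq_integral[symmetric])
      have "integrable ball_measure (slab n (2 * c))"
        by (intro finite_measure.integrable_const_bound[OF finite_measure_ball_measure, of _ 1] AE_I2
          continuous_imp_measurable_on_sets_lebesgue continuous_on_slab) (auto simp: abs_of_pos slab_bounds)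
      then show "integrable ball_measure (\<lambda>x. f S * slab n (2 * c) x)" by simp
      show "AE x in ball_measure. 0 \<le> f S * slab n (2 * c) x"
        using fS by (intro AE_I2) (simp add: slab_def)
    qed
    also have "\<dots> \<le> (\<integral>\<^sup>+ x. ennreal (f (?T x)) \<partial>ball_measure)"
      by (intro nn_integral_mono ennreal_leI le)
    also have "\<dots> \<le> ennreal (C * (LINT x|sphere_measure. norm (?g x)) powr p)"
      by (intro C(2) T divergence_free_if_normal_trace[OF T])
    also have "\<dots> \<le> ennreal (C * (M * (real CARD('n) * slab_mass n c)) powr p)"
    proof (intro ennreal_leI mult_left_mono powr_mono2 C(1))
      have "(LINT x|sphere_measure. norm (?g x)) \<le> (LINT x|sphere_measure. M * slab n c x)"
      proof (rule integral_mono)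
        show "integrable sphere_measure (\<lambda>x. norm (?g x))"
          using T(2) unfolding has_normal_trace_def by (intro integrable_norm) blast
        show "integrable sphere_measure (\<lambda>x. M * slab n c x)"
          by (intro integrable_sphere_measure_continuous continuous_intros continuous_on_slab)
        fix x :: "real^'n" assume "x \<in> space sphere_measure"
        then have "norm (S *v x) \<le> M" using M(2)[of x] by (simp add: space_sphere_measure)
        then show "norm (?g x) \<le> M * slab n c x" using slab_bounds(1)[of n c x] by (simp add: mult.commute)
      qed
      also have "\<dots> = M * (LINT x|sphere_measure. slab n c x)" by simp
      also have "\<dots> \<le> M * (real CARD('n) * slab_mass n c)"
        using M(1) by (intro mult_left_mono slab_sphere_integral_le) auto
      finally show "(LINT x|sphere_measure. norm (?g x)) \<le> M * (real CARD('n) * slab_mass n c)" .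
      show "0 \<le> (LINT x|sphere_measure. norm (?g x))" by simp
      show "0 \<le> p" using p by simp
    qed
    also have "C * (M * (real CARD('n) * slab_mass n c)) powr p = c0 * slab_mass n c powr p"
      using M(1) slab_mass_pos[of n c] by (simp add: c0_def powr_mult mult_ac)
    finally show ?thesis
      using C(1) by (subst (asm) ennreal_le_iff) (auto simp: c0_def)
  qed
  have "f S \<le> 2 ^ CARD('n) * c0 * slab_mass n (real k) powr (p - 1)" for k
  proof -
    let ?a = "slab_mass n (real k)"
    have a: "0 < ?a" by (rule slab_mass_pos)
    have "f S * ?a \<le> f S * (2 ^ CARD('n) * slab_mass n (2 * real k))"
      by (intro mult_left_mono slab_mass_double fS)
    also have "\<dots> = 2 ^ CARD('n) * (f S * slab_mass n (2 * real k))" by simp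
    also have "\<dots> \<le> 2 ^ CARD('n) * (c0 * ?a powr p)" by (intro mult_left_mono main) auto
    also have "?a powr p = ?a powr (p - 1) * ?a" using a by (simp add: powr_diff)
    finally have "f S * ?a \<le> 2 ^ CARD('n) * c0 * ?a powr (p - 1) * ?a" by (simp add: mult_ac)
    then show ?thesis using a by simp
  qed
  moreover have "(\<lambda>k. 2 ^ CARD('n) * c0 * slab_mass n (real k) powr (p - 1)) \<longlonglongrightarrow> 0"
  proof -
    have "(\<lambda>k. slab_mass n (real k) powr (p - 1)) \<longlonglongrightarrow> 0 powr (p - 1)"
      using p less_imp_le[OF slab_mass_pos]
      by (intro tendsto_powr' slab_mass_tendsto_0 S tendsto_const) (auto intro!: always_eventually)
    then show ?thesis using tendsto_mult_right_zero by fastforce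
  qed
  ultimately have "f S \<le> 0" by (intro LIMSEQ_le_const) auto
  then show ?thesis using fS by simp
qed

section \<open>Irreducible characters of groups of permutations\<close>

lemma one_smult_mat: "(1 :: 'a::semiring_1) \<cdot>\<^sub>m A = A"
  by (intro eq_matI) auto

lemma mat_trace_comm:
  fixes A B :: "'a::comm_semiring_0 Matrix.mat"
  assumes "A \<in> carrier_mat k k" "B \<in> carrier_mat k k"
  shows "mat_trace (A * B) = mat_trace (B * A)"
proof -
  have "mat_trace (A * B) = (\<Sum>i<k. \<Sum>j<k. A $$ (i, j) * B $$ (j, i))"
    using assms by (auto simp: mat_trace_def scalar_prod_def atLeast0LessThan intro!: sum.cong)
  also have "\<dots> = (\<Sum>j<k. \<Sum>i<k. A $$ (i, j) * B $$ (j, i))" by (rule sum.swap)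
  also have "\<dots> = mat_trace (B * A)"
    using assms by (auto simp: mat_trace_def scalar_prod_def atLeast0LessThan mult.commute intro!: sum.cong)
  finally show ?thesis .
qed

text \<open>The relation makes each diagonal entry 0 or 2, and the trace then makes them all 0.
  Above the diagonal, twice an entry is a sum of products of entries strictly closer to the
  diagonal, so induction on \<open>j - i\<close> applies.\<close>

lemma upper_triangular_quasi_idempotent_eq_0:
  fixes B :: "complex Matrix.mat"
  assumes B: "B \<in> carrier_mat k k" "upper_triangular B" "B * B = 2 \<cdot>\<^sub>m B" and tr: "Re (mat_trace B) = 0"
  shows "B = 0\<^sub>m k k"
proof -
  have low: "B $$ (i, j) = 0" if "j < i" "i < k" for i j
    using B(1,2) that by (auto dest: upper_triangularD)
  have sq: "(\<Sum>l<k. B $$ (i, l) * B $$ (l, j)) = 2 * B $$ (i, j)" if "i < k" "j < k" for i j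
  proof -
    have "(B * B) $$ (i, j) = (\<Sum>l<k. B $$ (i, l) * B $$ (l, j))"
      using B(1) that by (auto simp: scalar_prod_def atLeast0LessThan intro!: sum.cong)
    then show ?thesis using B(1,3) that by simp
  qed
  have diag: "B $$ (i, i) = 0 \<or> B $$ (i, i) = 2" if i: "i < k" for i
  proof -
    have "(\<Sum>l<k. B $$ (i, l) * B $$ (l, i)) = (\<Sum>l\<in>{i}. B $$ (i, l) * B $$ (l, i))"
    proof (rule sum.mono_neutral_right)
      show "\<forall>l\<in>{..<k} - {i}. B $$ (i, l) * B $$ (l, i) = 0"
      proof
        fix l assume "l \<in> {..<k} - {i}"
        then have "l < i \<or> i < l \<and> l < k" by auto
        then show "B $$ (i, l) * B $$ (l, i) = 0" using low[of l i] low[of i l] i by auto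
      qed
    qed (use i in auto)
    then show ?thesis using sq[OF i i] by auto
  qed
  have "(\<Sum>i<k. Re (B $$ (i, i))) = 0" using tr B(1) by (simp add: mat_trace_def)
  moreover have "0 \<le> Re (B $$ (i, i))" if "i \<in> {..<k}" for i using diag[of i] that by auto
  ultimately have "Re (B $$ (i, i)) = 0" if "i < k" for i
    using that sum_nonneg_eq_0_iff[of "{..<k}" "\<lambda>i. Re (B $$ (i, i))"] by auto
  then have diag0: "B $$ (i, i) = 0" if "i < k" for i using diag[OF that] that by fastforce
  have "B $$ (i, j) = 0" if "i < k" "j < k" for i j
    using that
  proof (induction "j - i" arbitrary: i j rule: less_induct)
    case less
    consider "j < i" | "j = i" | "i < j" by linarith
    then show ?case
    proof cases
      case 3
      have "B $$ (i, l) * B $$ (l, j) = 0" if l: "l < k" for l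
      proof -
        consider "l \<le> i" | "j \<le> l" | "i < l" "l < j" by linarith
        then show ?thesis
        proof cases
          case 1
          then have "B $$ (i, l) = 0" using low[of l i] diag0[of i] less.prems by (cases "l = i") auto
          then show ?thesis by simp
        next
          case 2
          then have "B $$ (l, j) = 0" using low[of j l] diag0[of j] less.prems l by (cases "l = j") auto
          then show ?thesis by simp
        next
          case 3
          then have "B $$ (i, l) = 0" using less.prems l by (intro less.hyps) auto
          then show ?thesis by simp
        qed
      qed
      then have "(\<Sum>l<k. B $$ (i, l) * B $$ (l, j)) = 0" by (intro sum.neutral) auto
      then show ?thesis using sq[OF less.prems] by simp
    qed (use low diag0 less.prems in auto)
  qed
  then show ?thesis using B(1) by (intro eq_matI) auto
qed

text \<open>The trace is the smallest that an involution can have. \<open>P = A + 1\<close>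
  satisfies \<open>P * P = 2 P\<close> and its trace has real part 0; both properties pass to a
  triangular form of \<open>P\<close>, which must vanish.\<close>

lemma involution_trace_eq_minus_one:
  fixes A :: "complex Matrix.mat"
  assumes A: "A \<in> carrier_mat k k" "A * A = 1\<^sub>m k" and tr: "Re (mat_trace A) = - real k"
  shows "A = (-1) \<cdot>\<^sub>m 1\<^sub>m k"
proof -
  define P where "P = A + 1\<^sub>m k"
  have P: "P \<in> carrier_mat k k" using A by (simp add: P_def)
  have "P * P = A * A + A + (A + 1\<^sub>m k)"
  proof -
    have I: "1\<^sub>m k \<in> carrier_mat k k" by simp
    have "P * P = A * P + 1\<^sub>m k * P" unfolding P_def by (rule add_mult_distrib_mat[OF A(1) I P[unfolded P_def]])
    also have "A * P = A * A + A * 1\<^sub>m k" unfolding P_def by (rule mult_add_distrib_mat[OF A(1) A(1) I])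
    finally show ?thesis using A(1) P by (simp add: P_def)
  qed
  then have PP: "P * P = 2 \<cdot>\<^sub>m P" unfolding A(2) P_def using A(1) by (intro eq_matI) auto
  have trP: "Re (mat_trace P) = 0"
    using tr A(1) by (simp add: mat_trace_def P_def sum.distrib)
  obtain as where "char_poly P = (\<Prod>a\<leftarrow>as. [:- a, 1:])" using char_poly_factorized[OF P] by blast
  from schur_decomposition_exists[OF P this] obtain B where B: "B \<in> carrier_mat k k" "upper_triangular B" "similar_mat P B"
    by blast
  obtain Q R where QR: "similar_mat_wit P B Q R" using B(3) unfolding similar_mat_def by blast
  then have c: "Q \<in> carrier_mat k k" "R \<in> carrier_mat k k" "Q * R = 1\<^sub>m k" "R * Q = 1\<^sub>m k" "P = Q * B * R"
    using P unfolding similar_mat_wit_def Let_def by auto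
  have BR: "B = R * (P * Q)"
  proof -
    have "R * (P * Q) = (R * Q) * B * (R * Q)" unfolding c(5)
      using c(1,2) B(1) by (simp add: assoc_mult_mat[of _ k k _ k _ k])
    then show ?thesis using c(4) B(1) by simp
  qed
  have "mat_trace B = mat_trace ((P * Q) * R)"
    unfolding BR using c P by (intro mat_trace_comm) auto
  also have "(P * Q) * R = P" using c P by (simp add: assoc_mult_mat[of _ k k _ k _ k])
  finally have trB: "Re (mat_trace B) = 0" using trP by simp
  have BB: "B * B = 2 \<cdot>\<^sub>m B"
  proof -
    have "B * B = R * (P * (Q * R) * P) * Q"
      unfolding BR using c(1,2) P by (simp add: assoc_mult_mat[of _ k k _ k _ k])
    also have "\<dots> = R * (2 \<cdot>\<^sub>m P) * Q" unfolding c(3) using P PP by simp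
    also have "\<dots> = 2 \<cdot>\<^sub>m (R * (P * Q))"
      using c(1,2) P by (simp add: mult_smult_distrib[of _ k k _ k] mult_smult_assoc_mat[of _ k k _ k] assoc_mult_mat[of _ k k _ k _ k])
    finally show ?thesis using BR by simp
  qed
  have "B = 0\<^sub>m k k" by (rule upper_triangular_quasi_idempotent_eq_0[OF B(1,2) BB trB])
  then have "P = 0\<^sub>m k k" using c by simp
  then have P0: "(A + 1\<^sub>m k) $$ (i, j) = 0" if "i < k" "j < k" for i j using that by (simp add: P_def)
  show ?thesis
  proof (rule eq_matI)
    fix i j assume ij: "i < dim_row ((-1) \<cdot>\<^sub>m 1\<^sub>m k :: complex Matrix.mat)" "j < dim_col ((-1) \<cdot>\<^sub>m 1\<^sub>m k :: complex Matrix.mat)"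
    then show "A $$ (i, j) = ((-1) \<cdot>\<^sub>m 1\<^sub>m k) $$ (i, j)"
      using P0[of i j] A(1) by (simp add: eq_neg_iff_add_eq_0)
  qed (use A(1) in auto)
qed

section \<open>Scalar representations and the signature\<close>

lemma subspace_vecI:
  fixes W :: "complex Matrix.vec set"
  assumes "W \<subseteq> carrier_vec k" "0\<^sub>v k \<in> W" "\<And>v w. v \<in> W \<Longrightarrow> w \<in> W \<Longrightarrow> v + w \<in> W"
    "\<And>c v. v \<in> W \<Longrightarrow> c \<cdot>\<^sub>v v \<in> W"
  shows "VectorSpace.subspace class_ring W (module_vec TYPE(complex) k)"
  unfolding VectorSpace.subspace_def submodule_def
  using assms vec_vs vec_module by (auto simp: module_vec_simps)

lemma subspace_vecD:
  fixes W :: "complex Matrix.vec set"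
  assumes "VectorSpace.subspace class_ring W (module_vec TYPE(complex) k)"
  shows "W \<subseteq> carrier_vec k" "0\<^sub>v k \<in> W" "v \<in> W \<Longrightarrow> c \<cdot>\<^sub>v v \<in> W"
  using assms unfolding VectorSpace.subspace_def submodule_def by (auto simp: module_vec_simps)

lemma symmetric_group_simps:
  "carrier (symmetric_group :: ('n::finite \<Rightarrow> 'n) monoid) = {p. bij p}"
  "bij p \<Longrightarrow> bij q \<Longrightarrow> p \<otimes>\<^bsub>(symmetric_group :: ('n \<Rightarrow> 'n) monoid)\<^esub> q = p \<circ> q"
  "\<one>\<^bsub>(symmetric_group :: ('n \<Rightarrow> 'n) monoid)\<^esub> = id"
  by (auto simp: BijGroup_def Bij_def compose_def fun_eq_iff)

lemma general_linear_group_simps: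
  "A \<in> carrier (general_linear_group k) \<Longrightarrow> A \<in> carrier_mat k k"
  "A \<otimes>\<^bsub>general_linear_group k\<^esub> B = A * B"
  "\<one>\<^bsub>general_linear_group k\<^esub> = 1\<^sub>m k"
  by (auto simp: general_linear_group_def units_of_def Units_def ring_mat_def)

lemma group_general_linear_group: "group (general_linear_group k)"
  unfolding general_linear_group_def
  by (intro monoid.units_group ring.is_monoid ring_mat)

lemma group_symmetric_group: "group (symmetric_group :: ('n::finite \<Rightarrow> 'n) monoid)"
  by (rule group_BijGroup)

text \<open>If every element acts as a scalar, then every line is invariant.\<close>

lemma irreducible_scalar_representation_degree:
  assumes irr: "irreducible_representation G k \<rho>"
    and sc: "\<And>g. g \<in> carrier G \<Longrightarrow> \<exists>c. \<rho> g = c \<cdot>\<^sub>m 1\<^sub>m k"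
  shows "k = 1"
proof -
  have k: "0 < k" using irr by (simp add: irreducible_representation_def)
  define W where "W = range (\<lambda>c. c \<cdot>\<^sub>v unit_vec k 0 :: complex Matrix.vec)"
  have "VectorSpace.subspace class_ring W (module_vec TYPE(complex) k)"
  proof (rule subspace_vecI)
    show "0\<^sub>v k \<in> W" unfolding W_def by (rule image_eqI[of _ _ 0]) auto
    show "v + w \<in> W" if vw: "v \<in> W" "w \<in> W" for v w
    proof -
      obtain a b where "v = a \<cdot>\<^sub>v unit_vec k 0" "w = b \<cdot>\<^sub>v unit_vec k 0" using vw by (auto simp: W_def)
      then have "v + w = (a + b) \<cdot>\<^sub>v unit_vec k 0" by (simp add: add_smult_distrib_vec)
      then show ?thesis by (simp add: W_def)
    qed
    show "c \<cdot>\<^sub>v v \<in> W" if "v \<in> W" for c v using that by (auto simp: W_def smult_smult_assoc)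
  qed (auto simp: W_def)
  moreover have "\<rho> g *\<^sub>v w \<in> W" if g: "g \<in> carrier G" and w: "w \<in> W" for g w
  proof -
    obtain c where c: "\<rho> g = c \<cdot>\<^sub>m 1\<^sub>m k" using sc[OF g] by blast
    obtain a where a: "w = a \<cdot>\<^sub>v unit_vec k 0" using w by (auto simp: W_def)
    have "\<rho> g *\<^sub>v w = (c * a) \<cdot>\<^sub>v unit_vec k 0"
      unfolding c a by (intro eq_vecI) (auto simp: scalar_prod_def sum.delta if_distrib cong: if_cong)
    then show ?thesis by (simp add: W_def)
  qed
  ultimately have "W = {0\<^sub>v k} \<or> W = carrier_vec k"
    using irr unfolding irreducible_representation_def by blast
  moreover have u0: "unit_vec k 0 \<in> W" unfolding W_def by (rule image_eqI[of _ _ 1]) auto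
  moreover have "unit_vec k 0 \<noteq> (0\<^sub>v k :: complex Matrix.vec)"
    using k by (metis index_unit_vec(1) index_zero_vec(1) zero_neq_one)
  ultimately have W: "W = carrier_vec k" by auto
  show "k = 1"
  proof (rule ccontr)
    assume "k \<noteq> 1"
    then have k1: "1 < k" using k by simp
    have "unit_vec k 1 \<in> W" unfolding W by simp
    then obtain c :: complex where "unit_vec k 1 = c \<cdot>\<^sub>v unit_vec k 0" by (auto simp: W_def)
    then have "vec_index (unit_vec k 1) 1 = vec_index (c \<cdot>\<^sub>v unit_vec k 0 :: complex Matrix.vec) 1" by simp
    then show False using k1 by simp
  qed
qed

text \<open>The sign acts in degree one, where a nonzero vector already spans the space.\<close>

lemma signature_irreducible_character:
  "irreducible_character (symmetric_group :: ('n::finite \<Rightarrow> 'n) monoid) signature_character"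
proof -
  let ?G = "symmetric_group :: ('n \<Rightarrow> 'n) monoid"
  define \<rho> where "\<rho> p = complex_of_int (sign p) \<cdot>\<^sub>m 1\<^sub>m 1" for p :: "'n \<Rightarrow> 'n"
  have mult: "(a \<cdot>\<^sub>m 1\<^sub>m 1) * (b \<cdot>\<^sub>m 1\<^sub>m 1) = (a * b) \<cdot>\<^sub>m (1\<^sub>m 1 :: complex Matrix.mat)" for a b
    by (intro eq_matI) (auto simp: scalar_prod_def)
  have unit: "\<rho> p \<in> carrier (general_linear_group 1)" for p
  proof -
    have "\<rho> p * \<rho> p = 1\<^sub>m 1" unfolding \<rho>_def mult by (simp add: sign_def one_smult_mat)
    moreover have "\<rho> p \<in> carrier_mat 1 1" by (simp add: \<rho>_def)
    ultimately show ?thesis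
      by (auto simp: general_linear_group_def units_of_def Units_def ring_mat_def)
  qed
  have "\<rho> \<in> hom ?G (general_linear_group 1)"
  proof (rule homI)
    fix p q assume pq: "p \<in> carrier ?G" "q \<in> carrier ?G"
    then have b: "bij p" "bij q" by (auto simp: symmetric_group_simps(1))
    then have "permutation p" "permutation q" by (auto simp: permutation)
    then have "sign (p \<circ> q) = sign p * sign q" by (rule sign_compose)
    then show "\<rho> (p \<otimes>\<^bsub>?G\<^esub> q) = \<rho> p \<otimes>\<^bsub>general_linear_group 1\<^esub> \<rho> q"
      unfolding symmetric_group_simps(2)[OF b] general_linear_group_simps(2) \<rho>_def mult by simp
  qed (rule unit)
  moreover have "W = {0\<^sub>v 1} \<or> W = carrier_vec 1"
    if W: "VectorSpace.subspace class_ring W (module_vec TYPE(complex) 1)" for W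
  proof (cases "W \<subseteq> {0\<^sub>v 1}")
    case True
    then show ?thesis using subspace_vecD(2)[OF W] by auto
  next
    case False
    then obtain w where w: "w \<in> W" "w \<noteq> 0\<^sub>v 1" by auto
    have wc: "w \<in> carrier_vec 1" using subspace_vecD(1)[OF W] w by auto
    have w0: "vec_index w 0 \<noteq> 0"
    proof
      assume "vec_index w 0 = 0"
      then have "w = 0\<^sub>v 1" using wc by (intro eq_vecI) auto
      then show False using w by simp
    qed
    have "v \<in> W" if v: "v \<in> carrier_vec 1" for v
    proof -
      have "v = (vec_index v 0 / vec_index w 0) \<cdot>\<^sub>v w" using v wc w0 by (intro eq_vecI) auto
      then show ?thesis using subspace_vecD(3)[OF W w(1)] by metis
    qed
    then show ?thesis using subspace_vecD(1)[OF W] by auto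
  qed
  ultimately have "irreducible_representation ?G 1 \<rho>" unfolding irreducible_representation_def by auto
  moreover have "signature_character = restrict (\<lambda>g. mat_trace (\<rho> g)) (carrier ?G)"
    unfolding signature_character_def by (intro restrict_ext) (simp add: \<rho>_def mat_trace_def)
  ultimately show ?thesis unfolding irreducible_character_def by blast
qed

text \<open>A transposition is an involution, so the trace \<open>- k\<close> makes it act as -1.
  Transpositions generate all permutations, which therefore belong to \<open>G\<close> and act by
  their sign; an irreducible representation by scalars has degree one.\<close>

theorem irreducible_character_eq_signature:
  fixes G :: "('n::finite \<Rightarrow> 'n) set"
  assumes G: "subgroup G symmetric_group"
    and irr: "irreducible_representation (symmetric_group\<lparr>carrier := G\<rparr>) k \<rho>"
    and \<chi>': "\<chi>' = restrict (\<lambda>g. mat_trace (\<rho> g)) G"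
    and tr: "\<And>a b. a \<noteq> b \<Longrightarrow> Transposition.transpose a b \<in> G \<and> Re (\<chi>' (Transposition.transpose a b)) = - real k"
  shows "G = carrier symmetric_group" "\<chi>' = signature_character"
proof -
  let ?G = "symmetric_group\<lparr>carrier := G\<rparr>"
  have hom: "\<rho> \<in> hom ?G (general_linear_group k)" using irr by (simp add: irreducible_representation_def)
  have gG: "group ?G" by (rule subgroup.subgroup_is_group[OF G group_symmetric_group])
  have bijG: "bij g" if "g \<in> G" for g using subgroup.subset[OF G] that by (auto simp: symmetric_group_simps(1))
  have car: "\<rho> g \<in> carrier_mat k k" if "g \<in> G" for g
    using hom_in_carrier[OF hom, of g] that by (auto intro: general_linear_group_simps(1))
  have \<rho>1: "\<rho> id = 1\<^sub>m k"
    using hom_one[OF hom gG group_general_linear_group] by (simp add: symmetric_group_simps(3) general_linear_group_simps(3))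
  have \<rho>m: "\<rho> (g \<circ> h) = \<rho> g * \<rho> h" if "g \<in> G" "h \<in> G" for g h
    using hom_mult[OF hom, of g h] that by (simp add: symmetric_group_simps(2) bijG general_linear_group_simps(2))
  have idG: "id \<in> G" using subgroup.one_closed[OF G] by (simp add: symmetric_group_simps(3))
  have mG: "g \<circ> h \<in> G" if "g \<in> G" "h \<in> G" for g h
    using subgroup.m_closed[OF G that] that by (simp add: symmetric_group_simps(2) bijG)
  have \<tau>: "\<rho> (Transposition.transpose a b) = (-1) \<cdot>\<^sub>m 1\<^sub>m k" if ab: "a \<noteq> b" for a b
  proof (rule involution_trace_eq_minus_one)
    have t: "Transposition.transpose a b \<in> G" using tr[OF ab] by simp
    show "\<rho> (Transposition.transpose a b) \<in> carrier_mat k k" by (rule car[OF t])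
    show "\<rho> (Transposition.transpose a b) * \<rho> (Transposition.transpose a b) = 1\<^sub>m k"
      using \<rho>m[OF t t] \<rho>1 by simp
    show "Re (mat_trace (\<rho> (Transposition.transpose a b))) = - real k"
      using tr[OF ab] t by (simp add: \<chi>')
  qed
  have all: "p \<in> G \<and> \<rho> p = complex_of_int (sign p) \<cdot>\<^sub>m 1\<^sub>m k" if "swapidseq n p" for n p
    using that
  proof (induction rule: swapidseq.induct)
    case id
    show ?case unfolding sign_id of_int_1 one_smult_mat using idG \<rho>1 by blast
  next
    case (comp_Suc n p a b)
    let ?t = "Transposition.transpose a b"
    have t: "?t \<in> G" using tr[OF comp_Suc.hyps(2)] by simp
    have pp: "permutation p" "permutation ?t"
      using comp_Suc.hyps(1) by (auto simp: permutation_def[of p] intro: permutation_swap_id)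
    have "\<rho> (?t \<circ> p) = ((-1) \<cdot>\<^sub>m 1\<^sub>m k) * (complex_of_int (sign p) \<cdot>\<^sub>m 1\<^sub>m k)"
      using \<rho>m[OF t] \<tau>[OF comp_Suc.hyps(2)] comp_Suc.IH by simp
    also have "\<dots> = (- complex_of_int (sign p)) \<cdot>\<^sub>m 1\<^sub>m k"
      by (simp add: mult_smult_assoc_mat[of _ k k _ k])
        (intro eq_matI, auto)
    also have "- complex_of_int (sign p) = complex_of_int (sign (?t \<circ> p))"
      using comp_Suc.hyps(2) sign_compose[OF pp(2,1)] by (simp add: sign_swap_id)
    finally show ?case using mG[OF t] comp_Suc.IH by blast
  qed
  have bij_all: "p \<in> G \<and> \<rho> p = complex_of_int (sign p) \<cdot>\<^sub>m 1\<^sub>m k" if "bij p" for p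
  proof -
    have "permutation p" using that by (simp add: permutation)
    then show ?thesis using all unfolding permutation_def by blast
  qed
  then show Geq: "G = carrier symmetric_group" using bijG by (auto simp: symmetric_group_simps(1))
  have "k = 1" using irr bij_all bijG by (intro irreducible_scalar_representation_degree[OF irr]) auto
  then have "mat_trace (\<rho> p) = complex_of_int (sign p)" if "p \<in> G" for p
    using bij_all[OF bijG[OF that]] by (simp add: mat_trace_def)
  then show "\<chi>' = signature_character"
    unfolding \<chi>' signature_character_def Geq[symmetric] by (intro restrict_ext) simp
qed

section \<open>Immanants\<close>

text \<open>For \<open>a \<noteq> b\<close> a singular positive semi-definite matrix with few
  nonzero entries: the kernel contains \<open>axis a 1 - axis b 1\<close>, and only the identity and
  the transposition of \<open>a\<close> and \<open>b\<close> contribute to an immanant.\<close>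

definition ones_block :: "'n::finite \<Rightarrow> 'n \<Rightarrow> real^'n^'n"
  where "ones_block a b = (\<chi> i j. if i = j \<or> i = a \<and> j = b \<or> i = b \<and> j = a then 1 else 0)"

lemma ones_block_mult:
  fixes v :: "real^'n"
  assumes "a \<noteq> b"
  shows "ones_block a b *v v = v + v$b *\<^sub>R axis a 1 + v$a *\<^sub>R axis b 1"
proof -
  have "(ones_block a b *v v) $ i = (v + v$b *\<^sub>R axis a 1 + v$a *\<^sub>R axis b 1) $ i" for i
  proof -
    have "(ones_block a b *v v) $ i
        = (\<Sum>j\<in>UNIV. (if j = i then v$j else 0) + (if j = b then (if i = a then v$j else 0) else 0)
            + (if j = a then (if i = b then v$j else 0) else 0))"
      unfolding matrix_vector_mult_def ones_block_def vec_lambda_beta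
      by (rule sum.cong) (use assms in auto)
    also have "\<dots> = v$i + (if i = a then v$b else 0) + (if i = b then v$a else 0)"
      by (simp add: sum.distrib)
    finally show ?thesis by (simp add: axis_def)
  qed
  then show ?thesis by (simp add: vec_eq_iff)
qed

lemma ones_block_psd:
  assumes "a \<noteq> b"
  shows "ones_block a b \<in> (psd_matrices :: (real^'n^'n) set)"
  unfolding psd_matrices_def
proof (intro CollectI conjI allI)
  show "transpose (ones_block a b) = (ones_block a b :: real^'n^'n)"
    by (auto simp: transpose_def ones_block_def vec_eq_iff)
  fix v :: "real^'n"
  have "(v$a)\<^sup>2 + (v$b)\<^sup>2 = (\<Sum>i\<in>{a, b}. v$i * v$i)" using assms by (simp add: power2_eq_square)
  also have "\<dots> \<le> inner v v" unfolding inner_vec_def inner_real_def by (rule sum_mono2) auto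
  \<comment> \<open>The form is \<open>inner v v + 2 * v$a * v$b\<close>; two of the squares in
    \<open>inner v v\<close> complete the square of \<open>v$a + v$b\<close>.\<close>
  finally have "0 \<le> inner v v - (v$a)\<^sup>2 - (v$b)\<^sup>2 + (v$a + v$b)\<^sup>2" by simp
  also have "\<dots> = inner v (ones_block a b *v v)"
    unfolding ones_block_mult[OF assms] by (simp add: inner_add_right inner_axis power2_eq_square algebra_simps)
  finally show "0 \<le> inner v (ones_block a b *v v)" .
qed

lemma ones_block_kernel:
  assumes "a \<noteq> b"
  shows "ones_block a b *v (axis a 1 - axis b 1 :: real^'n) = 0"
  unfolding ones_block_mult[OF assms] using assms by (simp add: axis_def vec_eq_iff)

lemma immanant_ones_block:
  fixes G :: "('n::finite \<Rightarrow> 'n) set"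
  assumes ab: "a \<noteq> b" and G: "\<And>g. g \<in> G \<Longrightarrow> bij g" "id \<in> G"
  shows "immanant G \<chi>' (ones_block a b)
    = \<chi>' id + (if Transposition.transpose a b \<in> G then \<chi>' (Transposition.transpose a b) else 0)"
proof -
  let ?t = "Transposition.transpose a b"
  let ?P = "\<lambda>g. \<Prod>i\<in>UNIV. complex_of_real (ones_block a b $ i $ g i)"
  have tid: "?t \<noteq> id" using ab by (metis id_apply transpose_apply_first)
  have one: "?P id = 1" "?P ?t = 1"
    by (auto simp: ones_block_def Transposition.transpose_def intro!: prod.neutral)
  have zero: "?P g = 0" if g: "bij g" "g \<noteq> id" "g \<noteq> ?t" for g
  proof (rule ccontr)
    assume "?P g \<noteq> 0"
    then have nz: "ones_block a b $ i $ g i \<noteq> (0::real)" for i by simp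
    \<comment> \<open>A nonzero product confines \<open>g\<close> to the pattern of
      \<open>ones_block\<close>: it fixes every other index, so injectivity leaves the identity or
      the swap.\<close>
    have c: "i = g i \<or> i = a \<and> g i = b \<or> i = b \<and> g i = a" for i
      using nz[of i] unfolding ones_block_def vec_lambda_beta by (rule contrapos_np) simp
    have inj: "g x = g y \<Longrightarrow> x = y" for x y using g(1) by (simp add: bij_def inj_eq)
    show False
    proof (cases "g a = a")
      case True
      then have gb: "g b = b" using c[of b] inj[of a b] ab by auto
      have "g = id"
      proof
        fix i show "g i = id i" using True gb ab c[of i] by auto
      qed
      then show False using g by simp
    next
      case False
      then have a: "g a = b" using c[of a] ab by auto
      then have b: "g b = a" using c[of b] inj[of a b] ab by auto
      have "g = ?t"
      proof
        fix i show "g i = ?t i" using a b c[of i] by (auto simp: Transposition.transpose_def)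
      qed
      then show False using g by simp
    qed
  qed
  have "immanant G \<chi>' (ones_block a b) = (\<Sum>g\<in>G. \<chi>' g * ?P g)" by (simp add: immanant_def)
  also have "\<dots> = (\<Sum>g\<in>G \<inter> {id, ?t}. \<chi>' g * ?P g)"
    using zero G by (intro sum.mono_neutral_right) auto
  also have "\<dots> = \<chi>' id + (if ?t \<in> G then \<chi>' ?t else 0)"
  proof (cases "?t \<in> G")
    case True
    then have "G \<inter> {id, ?t} = {id, ?t}" using G by auto
    then show ?thesis using True tid[symmetric] one by simp
  next
    case False
    then have "G \<inter> {id, ?t} = {id}" using G by auto
    then show ?thesis using False one by simp
  qed
  finally show ?thesis .
qed

theorem maximal_gain_imp_signature:
  fixes G :: "('n::finite \<Rightarrow> 'n) set"
  assumes d: "2 \<le> CARD('n)" and G: "subgroup G symmetric_group"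
    and \<chi>': "irreducible_character (symmetric_group\<lparr>carrier := G\<rparr>) \<chi>'"
    and gain: "displays_maximal_gain (immanant_root G \<chi>' :: real^'n^'n \<Rightarrow> real)"
  shows "G = carrier symmetric_group" "\<chi>' = signature_character"
proof -
  obtain k \<rho> where irr: "irreducible_representation (symmetric_group\<lparr>carrier := G\<rparr>) k \<rho>"
    and \<chi>'_eq: "\<chi>' = restrict (\<lambda>g. mat_trace (\<rho> g)) G"
    using \<chi>' unfolding irreducible_character_def by auto
  have bijG: "bij g" if "g \<in> G" for g using subgroup.subset[OF G] that by (auto simp: symmetric_group_simps(1))
  have idG: "id \<in> G" using subgroup.one_closed[OF G] by (simp add: symmetric_group_simps(3))
  have k: "0 < k" and hom: "\<rho> \<in> hom (symmetric_group\<lparr>carrier := G\<rparr>) (general_linear_group k)"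
    using irr by (auto simp: irreducible_representation_def)
  have "\<rho> id = 1\<^sub>m k"
    using hom_one[OF hom subgroup.subgroup_is_group[OF G group_symmetric_group] group_general_linear_group]
    by (simp add: symmetric_group_simps(3) general_linear_group_simps(3))
  then have \<chi>'1: "\<chi>' id = of_nat k" using idG by (simp add: \<chi>'_eq mat_trace_def)
  have tr: "Transposition.transpose a b \<in> G \<and> Re (\<chi>' (Transposition.transpose a b)) = - real k" if ab: "a \<noteq> b" for a b
  proof -
    have "immanant_root G \<chi>' (ones_block a b) = 0"
    proof (rule maximal_gain_singular_eq_0[OF d gain ones_block_psd[OF ab] ones_block_kernel[OF ab]])
      show "axis a 1 - axis b 1 \<noteq> (0 :: real^'n)" using ab by (metis axis_eq_axis eq_iff_diff_eq_0 zero_neq_one)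
    qed
    \<comment> \<open>\<open>powr\<close> vanishes exactly when its base is 0, whatever the sign of
      the base.\<close>
    then have "Re (immanant G \<chi>' (ones_block a b)) = 0" by (simp add: immanant_root_def)
    then have "real k + Re (if Transposition.transpose a b \<in> G then \<chi>' (Transposition.transpose a b) else 0) = 0"
      by (simp add: immanant_ones_block[OF ab bijG idG] \<chi>'1)
    \<comment> \<open>A transposition outside \<open>G\<close> would leave \<open>k = 0\<close>,
      against the positive degree.\<close>
    then show ?thesis using k by (auto split: if_splits)
  qed
  show "G = carrier symmetric_group" "\<chi>' = signature_character"
    using irreducible_character_eq_signature[OF G irr \<chi>'_eq tr] by auto
qed

lemma immanant_signature:
  "immanant (carrier symmetric_group) signature_character (S :: real^'n^'n) = of_real (det S)"
proof -
  have c: "carrier symmetric_group = {p :: 'n \<Rightarrow> 'n. p permutes UNIV}"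
    by (auto simp: symmetric_group_simps(1) permutes_univ bij_iff[symmetric] permutes_bij)
  show ?thesis unfolding immanant_def det_def signature_character_def c by simp
qed

lemma immanant_root_signature:
  "immanant_root (carrier symmetric_group) signature_character (S :: real^'n^'n)
    = det S powr (1 / (real CARD('n) - 1))"
  by (simp add: immanant_root_def immanant_signature)

theorem signature_displays_maximal_gain:
  assumes d: "2 \<le> CARD('n::finite)"
  shows "displays_maximal_gain (immanant_root (carrier symmetric_group) signature_character :: real^'n^'n \<Rightarrow> real)"
proof -
  let ?d = "real CARD('n)"
  have f: "immanant_root (carrier symmetric_group) signature_character
      = (\<lambda>S::real^'n^'n. det S powr (1 / (?d - 1)))"
    by (rule ext) (rule immanant_root_signature)
  define c where "c = (16 * ?d ^ 2 * root CARD('n) (1 / unit_ball_vol ?d)) powr (?d / (?d - 1))"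
  show ?thesis unfolding displays_maximal_gain_def Let_def f
  proof (intro conjI ballI allI impI exI[of _ c])
    \<comment> \<open>The exponent \<open>1 / (d - 1)\<close> is positive, so the power is
      continuous up to determinant 0.\<close>
    show "continuous_on psd_matrices (\<lambda>S::real^'n^'n. det S powr (1 / (?d - 1)))"
      using d by (intro continuous_on_powr' continuous_on_det continuous_intros) (auto simp: det_psd_nonneg)
    fix S :: "real^'n^'n" and t :: real
    assume S: "S \<in> psd_matrices" and t: "0 < t"
    have "t *\<^sub>R S = (\<chi> i. t *s S$i)" by (simp add: vec_eq_iff)
    then have "det (t *\<^sub>R S) = t ^ CARD('n) * det S" using det_rows_mul[of "\<lambda>_. t" "\<lambda>i. S$i"] by simp
    also have "\<dots> = t powr ?d * det S" using t by (simp add: powr_realpow)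
    finally show "det (t *\<^sub>R S) powr (1 / (?d - 1)) = t powr (?d / (?d - 1)) * det S powr (1 / (?d - 1))"
      using t det_psd_nonneg[OF S] by (simp add: powr_mult powr_powr)
  next
    fix T :: "real^'n \<Rightarrow> real^'n^'n" and g
    assume "L1_psd_tensor T \<and> divergence_free T \<and> has_normal_trace T g"
    then have "(\<integral>\<^sup>+ x. ennreal (det (T x) powr (1 / (?d - 1))) \<partial>ball_measure)
      \<le> ennreal ((16 * ?d ^ 2 * root CARD('n) (1 / unit_ball_vol ?d) * (LINT x|sphere_measure. norm (g x))) powr (?d / (?d - 1)))"
      using det_powr_nn_integral_le[OF d] by blast
    also have "(16 * ?d ^ 2 * root CARD('n) (1 / unit_ball_vol ?d) * (LINT x|sphere_measure. norm (g x))) powr (?d / (?d - 1))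
        = c * (LINT x|sphere_measure. norm (g x)) powr (?d / (?d - 1))"
      unfolding c_def by (rule powr_mult)
    finally show "(\<integral>\<^sup>+ x. ennreal (det (T x) powr (1 / (?d - 1))) \<partial>ball_measure)
        \<le> ennreal (c * (LINT x|sphere_measure. norm (g x)) powr (?d / (?d - 1)))" .
  qed (simp_all add: c_def)
qed

theorem theorem3p1:
  assumes "2 \<le> CARD('n::finite)"
  shows "{(G, \<chi>'). subgroup G (symmetric_group :: ('n \<Rightarrow> 'n) monoid) \<and>
             irreducible_character (symmetric_group\<lparr>carrier := G\<rparr>) \<chi>' \<and>
             displays_maximal_gain (immanant_root G \<chi>')}
           = {(carrier symmetric_group, signature_character)} \<and>
         (\<forall>S\<in>(psd_matrices :: (real^'n^'n) set).
             immanant_root (carrier symmetric_group) signature_character S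
               = det S powr (1 / (real CARD('n) - 1)))"
proof (intro conjI ballI equalityI subsetI)
  fix x
  assume "x \<in> {(G, \<chi>'). subgroup G (symmetric_group :: ('n \<Rightarrow> 'n) monoid) \<and>
             irreducible_character (symmetric_group\<lparr>carrier := G\<rparr>) \<chi>' \<and>
             displays_maximal_gain (immanant_root G \<chi>')}"
  then show "x \<in> {(carrier symmetric_group, signature_character)}"
    using maximal_gain_imp_signature[OF assms] by auto
next
  fix x :: "('n \<Rightarrow> 'n) set \<times> (('n \<Rightarrow> 'n) \<Rightarrow> complex)"
  assume "x \<in> {(carrier symmetric_group, signature_character)}"
  then show "x \<in> {(G, \<chi>'). subgroup G (symmetric_group :: ('n \<Rightarrow> 'n) monoid) \<and>
             irreducible_character (symmetric_group\<lparr>carrier := G\<rparr>) \<chi>' \<and>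
             displays_maximal_gain (immanant_root G \<chi>')}"
    using group.subgroup_self[OF group_symmetric_group] signature_irreducible_character
      signature_displays_maximal_gain[OF assms] by auto
qed (rule immanant_root_signature)

end
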